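(* Let $\Gamma(n,X,Z)$ be an arithmetical formula and write $\hat\Gamma(X,Z)=\{n\mid\Gamma(n,X,Z)\}$. Then there is an arithmetical functional $G(g,A,<_A,Z)$ (with $g\in C$) such that the following holds: for all $A\subseteq\mathbb N$, every total ordering $<_A$ of $A$ and every $Z\subseteq\mathbb N$, if $F(g):=G(g,A,<_A,Z)$ for $g\in C$ and $g_1,\dots,g_n\in C$ satisfy $C\subseteq C_{\bar g_1(F(g_1))}\cup\dots\cup C_{\bar g_n(F(g_n))}$, then one can construct, uniformly arithmetically in $Z,A,<_A,g_1,\dots,g_n$, a pair $(Y,h)$ with $Y\subseteq\mathbb N^2$ and $h:\mathbb N\to\mathbb N$ such that either $H(Y,Z)$ holds or $h$ is a strictly $<_A$-descending sequence in $A$. Moreover, the verification of this can be formalised in $\mathsf{ACA}_0^\omega$.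
   Context: $C=2^{\mathbb N}$; $C_s$ denotes the set of $f\in C$ extending the finite binary sequence $s$; $\bar g m=\langle g(0),\dots,g(m-1)\rangle$. For $Y\subseteq\mathbb N^2$ and $a\in A$: $Y_a=\{n\mid (a,n)\in Y\}$ and $Y^a=\{(b,m)\in Y\mid b<_A a\}$. $H(Y,Z)$ is the arithmetical statement $(\forall a\in A)(Y_a=\hat\Gamma(Y^a,Z))$. $\mathsf{ACA}_0^\omega$ is Kohlenbach's base theory $\mathsf{RCA}_0^\omega=\mathsf{E\text{-}PRA}^\omega+\mathsf{QF\text{-}AC}^{1,0}$ extended with Feferman's search operator $\mu^2$ (existence of $\mu$ with $(\exists n)(f(n)=0)\to f(\mu(f))=0$ for all $f$). *)

theory Defs
  imports Main
begin

text \<open>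
  Arithmetical formulas, i.e. formulas of second-order arithmetic without set
  quantifiers.  Besides variables for subsets of \<open>\<nat>\<close> there are variables for subsets of
  \<open>\<nat>\<^sup>2\<close>, so that no pairing function has to be fixed.  The three sorts of variables
  (numbers, sets, relations) have separate name spaces.  An element of Cantor space is
  passed to a formula as the set of arguments where it takes the value 1.
\<close>

datatype aterm = AVar string | AZero | ASuc aterm | APlus aterm aterm | ATimes aterm aterm

datatype afm =
    AEq aterm aterm
  | ALess aterm aterm
  | AMem aterm string
  | ARel aterm aterm string
  | AFls
  | AImp afm afm
  | AAll string afm

primrec aval :: "(string \<Rightarrow> nat) \<Rightarrow> aterm \<Rightarrow> nat" where
  "aval e (AVar x) = e x"
| "aval e AZero = 0"
| "aval e (ASuc t) = Suc (aval e t)"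
| "aval e (APlus s t) = aval e s + aval e t"
| "aval e (ATimes s t) = aval e s * aval e t"

primrec asat :: "(string \<Rightarrow> nat) \<Rightarrow> (string \<Rightarrow> nat set) \<Rightarrow> (string \<Rightarrow> (nat \<times> nat) set) \<Rightarrow> afm \<Rightarrow> bool" where
  "asat e U B (AEq s t) = (aval e s = aval e t)"
| "asat e U B (ALess s t) = (aval e s < aval e t)"
| "asat e U B (AMem t X) = (aval e t \<in> U X)"
| "asat e U B (ARel s t X) = ((aval e s, aval e t) \<in> B X)"
| "asat e U B AFls = False"
| "asat e U B (AImp p q) = (asat e U B p \<longrightarrow> asat e U B q)"
| "asat e U B (AAll x p) = (\<forall>n. asat (e(x := n)) U B p)"

primrec atvars :: "aterm \<Rightarrow> string set" where
  "atvars (AVar x) = {x}"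
| "atvars AZero = {}"
| "atvars (ASuc t) = atvars t"
| "atvars (APlus s t) = atvars s \<union> atvars t"
| "atvars (ATimes s t) = atvars s \<union> atvars t"

primrec afree_num :: "afm \<Rightarrow> string set" where
  "afree_num (AEq s t) = atvars s \<union> atvars t"
| "afree_num (ALess s t) = atvars s \<union> atvars t"
| "afree_num (AMem t X) = atvars t"
| "afree_num (ARel s t X) = atvars s \<union> atvars t"
| "afree_num AFls = {}"
| "afree_num (AImp p q) = afree_num p \<union> afree_num q"
| "afree_num (AAll x p) = afree_num p - {x}"

primrec afree_set :: "afm \<Rightarrow> string set" where
  "afree_set (AEq s t) = {}"
| "afree_set (ALess s t) = {}"
| "afree_set (AMem t X) = {X}"
| "afree_set (ARel s t X) = {}"
| "afree_set AFls = {}"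
| "afree_set (AImp p q) = afree_set p \<union> afree_set q"
| "afree_set (AAll x p) = afree_set p"

primrec afree_rel :: "afm \<Rightarrow> string set" where
  "afree_rel (AEq s t) = {}"
| "afree_rel (ALess s t) = {}"
| "afree_rel (AMem t X) = {}"
| "afree_rel (ARel s t X) = {X}"
| "afree_rel AFls = {}"
| "afree_rel (AImp p q) = afree_rel p \<union> afree_rel q"
| "afree_rel (AAll x p) = afree_rel p"

definition arith_in :: "string set \<Rightarrow> string set \<Rightarrow> string set \<Rightarrow> afm \<Rightarrow> bool" where
  "arith_in V U B p \<longleftrightarrow> afree_num p \<subseteq> V \<and> afree_set p \<subseteq> U \<and> afree_rel p \<subseteq> B"


type_synonym cantor = "nat \<Rightarrow> bool"

definition cylinder :: "bool list \<Rightarrow> cantor set" where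
  "cylinder s = {f. \<forall>i < length s. f i = s ! i}"

definition initial :: "cantor \<Rightarrow> nat \<Rightarrow> bool list" where
  "initial g m = map g [0..<m]"

definition total_ordering :: "nat set \<Rightarrow> (nat \<times> nat) set \<Rightarrow> bool" where
  "total_ordering A L \<longleftrightarrow> L \<subseteq> A \<times> A \<and> strict_linear_order_on A L"

definition Gamma_hat :: "afm \<Rightarrow> (nat \<times> nat) set \<Rightarrow> nat set \<Rightarrow> nat set" where
  "Gamma_hat \<Gamma> X Z =
     {n. asat ((\<lambda>_. 0)(''n'' := n)) ((\<lambda>_. {})(''Z'' := Z)) ((\<lambda>_. {})(''X'' := X)) \<Gamma>}"

definition below :: "(nat \<times> nat) set \<Rightarrow> nat \<Rightarrow> (nat \<times> nat) set \<Rightarrow> (nat \<times> nat) set" where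
  "below L a Y = {(b, m). (b, m) \<in> Y \<and> (b, a) \<in> L}"

definition hierarchy :: "afm \<Rightarrow> nat set \<Rightarrow> (nat \<times> nat) set \<Rightarrow> (nat \<times> nat) set \<Rightarrow> nat set \<Rightarrow> bool" where
  "hierarchy \<Gamma> A L Y Z \<longleftrightarrow> (\<forall>a\<in>A. Y `` {a} = Gamma_hat \<Gamma> (below L a Y) Z)"

definition descending_in :: "nat set \<Rightarrow> (nat \<times> nat) set \<Rightarrow> (nat \<Rightarrow> nat) \<Rightarrow> bool" where
  "descending_in A L h \<longleftrightarrow> (\<forall>k. h k \<in> A \<and> (h (Suc k), h k) \<in> L)"

text \<open>The list \<open>g\<^sub>1, \<dots>, g\<^sub>n\<close> enters arithmetical formulas as a number \<open>n\<close> and a relation.\<close>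

definition seq_rel :: "cantor list \<Rightarrow> (nat \<times> nat) set" where
  "seq_rel gs = {(i, k). i < length gs \<and> (gs ! i) k}"

definition defines_G ::
  "afm \<Rightarrow> (cantor \<Rightarrow> nat set \<Rightarrow> (nat \<times> nat) set \<Rightarrow> nat set \<Rightarrow> nat) \<Rightarrow> bool" where
  "defines_G \<gamma> G \<longleftrightarrow>
     arith_in {''m''} {''g'', ''A'', ''Z''} {''L''} \<gamma> \<and>
     (\<forall>g A L Z m. G g A L Z = m \<longleftrightarrow>
        asat ((\<lambda>_. 0)(''m'' := m))
             ((\<lambda>_. {})(''g'' := {k. g k}, ''A'' := A, ''Z'' := Z))
             ((\<lambda>_. {})(''L'' := L)) \<gamma>)"

definition defines_Y ::
  "afm \<Rightarrow> (nat set \<Rightarrow> nat set \<Rightarrow> (nat \<times> nat) set \<Rightarrow> cantor list \<Rightarrow> (nat \<times> nat) set) \<Rightarrow> bool" where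
  "defines_Y \<upsilon> Yc \<longleftrightarrow>
     arith_in {''j'', ''k'', ''l''} {''A'', ''Z''} {''L'', ''gs''} \<upsilon> \<and>
     (\<forall>Z A L gs j k. (j, k) \<in> Yc Z A L gs \<longleftrightarrow>
        asat ((\<lambda>_. 0)(''j'' := j, ''k'' := k, ''l'' := length gs))
             ((\<lambda>_. {})(''A'' := A, ''Z'' := Z))
             ((\<lambda>_. {})(''L'' := L, ''gs'' := seq_rel gs)) \<upsilon>)"

definition defines_h ::
  "afm \<Rightarrow> (nat set \<Rightarrow> nat set \<Rightarrow> (nat \<times> nat) set \<Rightarrow> cantor list \<Rightarrow> nat \<Rightarrow> nat) \<Rightarrow> bool" where
  "defines_h \<eta> hc \<longleftrightarrow>
     arith_in {''k'', ''m'', ''l''} {''A'', ''Z''} {''L'', ''gs''} \<eta> \<and>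
     (\<forall>Z A L gs k m. hc Z A L gs k = m \<longleftrightarrow>
        asat ((\<lambda>_. 0)(''k'' := k, ''m'' := m, ''l'' := length gs))
             ((\<lambda>_. {})(''A'' := A, ''Z'' := Z))
             ((\<lambda>_. {})(''L'' := L, ''gs'' := seq_rel gs)) \<eta>)"


text \<open>
  In the language of finite types, a variable is a name together with a type; the only
  primitive relation is equality at type 0 (\<open>N\<close>).  \<open>KPi\<close> and \<open>KSig\<close> are the combinators
  \<open>\<Pi>\<close> and \<open>\<Sigma>\<close>, \<open>Rec\<close> is the recursor \<open>R\<^sub>0\<close>.  Kleene's recursors with values of type
  \<open>\<rho>\<^sub>1 \<rightarrow> \<dots> \<rightarrow> \<rho>\<^sub>k \<rightarrow> 0\<close> are explicitly definable from \<open>R\<^sub>0\<close>.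
\<close>

datatype ty = N | Fun ty ty (infixr "\<^bold>\<rightarrow>" 65)

datatype tm =
    Var string ty
  | App tm tm (infixl "\<^bold>\<cdot>" 90)
  | Zero
  | Succ
  | KPi ty ty
  | KSig ty ty ty
  | Rec

primrec has_ty :: "tm \<Rightarrow> ty \<Rightarrow> bool" where
  "has_ty (Var x \<rho>) \<tau> = (\<tau> = \<rho>)"
| "has_ty (s \<^bold>\<cdot> t) \<tau> = (\<exists>\<sigma>. has_ty s (\<sigma> \<^bold>\<rightarrow> \<tau>) \<and> has_ty t \<sigma>)"
| "has_ty Zero \<tau> = (\<tau> = N)"
| "has_ty Succ \<tau> = (\<tau> = N \<^bold>\<rightarrow> N)"
| "has_ty (KPi \<rho> \<sigma>) \<tau> = (\<tau> = \<rho> \<^bold>\<rightarrow> \<sigma> \<^bold>\<rightarrow> \<rho>)"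
| "has_ty (KSig \<rho> \<sigma> \<upsilon>) \<tau> = (\<tau> = (\<rho> \<^bold>\<rightarrow> \<sigma> \<^bold>\<rightarrow> \<upsilon>) \<^bold>\<rightarrow> (\<rho> \<^bold>\<rightarrow> \<sigma>) \<^bold>\<rightarrow> \<rho> \<^bold>\<rightarrow> \<upsilon>)"
| "has_ty Rec \<tau> = (\<tau> = N \<^bold>\<rightarrow> N \<^bold>\<rightarrow> (N \<^bold>\<rightarrow> N \<^bold>\<rightarrow> N) \<^bold>\<rightarrow> N)"

primrec tvars :: "tm \<Rightarrow> (string \<times> ty) set" where
  "tvars (Var x \<rho>) = {(x, \<rho>)}"
| "tvars (s \<^bold>\<cdot> t) = tvars s \<union> tvars t"
| "tvars Zero = {}"
| "tvars Succ = {}"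
| "tvars (KPi \<rho> \<sigma>) = {}"
| "tvars (KSig \<rho> \<sigma> \<upsilon>) = {}"
| "tvars Rec = {}"

primrec tsubst :: "string \<Rightarrow> ty \<Rightarrow> tm \<Rightarrow> tm \<Rightarrow> tm" where
  "tsubst x \<rho> r (Var y \<sigma>) = (if (y, \<sigma>) = (x, \<rho>) then r else Var y \<sigma>)"
| "tsubst x \<rho> r (s \<^bold>\<cdot> t) = tsubst x \<rho> r s \<^bold>\<cdot> tsubst x \<rho> r t"
| "tsubst x \<rho> r Zero = Zero"
| "tsubst x \<rho> r Succ = Succ"
| "tsubst x \<rho> r (KPi \<sigma> \<tau>) = KPi \<sigma> \<tau>"
| "tsubst x \<rho> r (KSig \<sigma> \<tau> \<upsilon>) = KSig \<sigma> \<tau> \<upsilon>"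
| "tsubst x \<rho> r Rec = Rec"

datatype fm =
    Eq tm tm (infix "\<^bold>=" 50)
  | Fls
  | Imp fm fm (infixr "\<^bold>\<longrightarrow>" 25)
  | Forall string ty fm

primrec wf_fm :: "fm \<Rightarrow> bool" where
  "wf_fm (s \<^bold>= t) = (has_ty s N \<and> has_ty t N)"
| "wf_fm Fls = True"
| "wf_fm (p \<^bold>\<longrightarrow> q) = (wf_fm p \<and> wf_fm q)"
| "wf_fm (Forall x \<rho> p) = wf_fm p"

primrec fvars :: "fm \<Rightarrow> (string \<times> ty) set" where
  "fvars (s \<^bold>= t) = tvars s \<union> tvars t"
| "fvars Fls = {}"
| "fvars (p \<^bold>\<longrightarrow> q) = fvars p \<union> fvars q"
| "fvars (Forall x \<rho> p) = fvars p - {(x, \<rho>)}"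

primrec qf :: "fm \<Rightarrow> bool" where
  "qf (s \<^bold>= t) = True"
| "qf Fls = True"
| "qf (p \<^bold>\<longrightarrow> q) = (qf p \<and> qf q)"
| "qf (Forall x \<rho> p) = False"

text \<open>Substitution does not rename bound variables; \<open>free_for\<close> rules out capture.\<close>

primrec subst :: "string \<Rightarrow> ty \<Rightarrow> tm \<Rightarrow> fm \<Rightarrow> fm" where
  "subst x \<rho> r (s \<^bold>= t) = (tsubst x \<rho> r s \<^bold>= tsubst x \<rho> r t)"
| "subst x \<rho> r Fls = Fls"
| "subst x \<rho> r (p \<^bold>\<longrightarrow> q) = (subst x \<rho> r p \<^bold>\<longrightarrow> subst x \<rho> r q)"
| "subst x \<rho> r (Forall y \<sigma> p) =
     (if (y, \<sigma>) = (x, \<rho>) then Forall y \<sigma> p else Forall y \<sigma> (subst x \<rho> r p))"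

primrec free_for :: "tm \<Rightarrow> string \<Rightarrow> ty \<Rightarrow> fm \<Rightarrow> bool" where
  "free_for r x \<rho> (s \<^bold>= t) = True"
| "free_for r x \<rho> Fls = True"
| "free_for r x \<rho> (p \<^bold>\<longrightarrow> q) = (free_for r x \<rho> p \<and> free_for r x \<rho> q)"
| "free_for r x \<rho> (Forall y \<sigma> p) =
     ((x, \<rho>) \<notin> fvars (Forall y \<sigma> p) \<or> (y, \<sigma>) \<notin> tvars r \<and> free_for r x \<rho> p)"

abbreviation Neg :: "fm \<Rightarrow> fm" ("\<^bold>\<not> _" [40] 40) where
  "\<^bold>\<not> p \<equiv> p \<^bold>\<longrightarrow> Fls"
abbreviation Conj :: "fm \<Rightarrow> fm \<Rightarrow> fm" (infixr "\<^bold>\<and>" 35) where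
  "p \<^bold>\<and> q \<equiv> \<^bold>\<not> (p \<^bold>\<longrightarrow> \<^bold>\<not> q)"
abbreviation Disj :: "fm \<Rightarrow> fm \<Rightarrow> fm" (infixr "\<^bold>\<or>" 30) where
  "p \<^bold>\<or> q \<equiv> \<^bold>\<not> p \<^bold>\<longrightarrow> q"
abbreviation Iff :: "fm \<Rightarrow> fm \<Rightarrow> fm" (infix "\<^bold>\<longleftrightarrow>" 25) where
  "p \<^bold>\<longleftrightarrow> q \<equiv> (p \<^bold>\<longrightarrow> q) \<^bold>\<and> (q \<^bold>\<longrightarrow> p)"
abbreviation Exists :: "string \<Rightarrow> ty \<Rightarrow> fm \<Rightarrow> fm" where
  "Exists x \<rho> p \<equiv> \<^bold>\<not> Forall x \<rho> (\<^bold>\<not> p)"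

text \<open>A variable name that is longer than, hence distinct from, all names in the given terms.\<close>

primrec width :: "tm \<Rightarrow> nat" where
  "width (Var x \<rho>) = length x"
| "width (s \<^bold>\<cdot> t) = max (width s) (width t)"
| "width Zero = 0"
| "width Succ = 0"
| "width (KPi \<rho> \<sigma>) = 0"
| "width (KSig \<rho> \<sigma> \<upsilon>) = 0"
| "width Rec = 0"

definition fresh :: "tm \<Rightarrow> tm \<Rightarrow> string" where
  "fresh s t = replicate (Suc (max (width s) (width t))) (CHR ''x'')"

text \<open>Equality at higher types is an abbreviation for pointwise equality.\<close>

primrec eq_at :: "ty \<Rightarrow> tm \<Rightarrow> tm \<Rightarrow> fm" where
  "eq_at N s t = (s \<^bold>= t)"
| "eq_at (\<sigma> \<^bold>\<rightarrow> \<tau>) s t =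
     Forall (fresh s t) \<sigma> (eq_at \<tau> (s \<^bold>\<cdot> Var (fresh s t) \<sigma>) (t \<^bold>\<cdot> Var (fresh s t) \<sigma>))"


text \<open>
  Axioms are stated for variables; instances for arbitrary terms follow by
  generalisation and instantiation.
\<close>

inductive_set E_PRA :: "fm set" where
  eq_refl: "(Var ''x'' N \<^bold>= Var ''x'' N) \<in> E_PRA"
| eq_eucl: "(Var ''x'' N \<^bold>= Var ''y'' N \<^bold>\<longrightarrow> Var ''x'' N \<^bold>= Var ''z'' N
             \<^bold>\<longrightarrow> Var ''y'' N \<^bold>= Var ''z'' N) \<in> E_PRA"
| extensionality:
    "(eq_at \<sigma> (Var ''x'' \<sigma>) (Var ''y'' \<sigma>)
      \<^bold>\<longrightarrow> eq_at \<tau> (Var ''z'' (\<sigma> \<^bold>\<rightarrow> \<tau>) \<^bold>\<cdot> Var ''x'' \<sigma>) (Var ''z'' (\<sigma> \<^bold>\<rightarrow> \<tau>) \<^bold>\<cdot> Var ''y'' \<sigma>)) \<in> E_PRA"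
| succ_zero: "(\<^bold>\<not> Succ \<^bold>\<cdot> Var ''x'' N \<^bold>= Zero) \<in> E_PRA"
| succ_inj: "(Succ \<^bold>\<cdot> Var ''x'' N \<^bold>= Succ \<^bold>\<cdot> Var ''y'' N \<^bold>\<longrightarrow> Var ''x'' N \<^bold>= Var ''y'' N) \<in> E_PRA"
| pi: "eq_at \<rho> (KPi \<rho> \<sigma> \<^bold>\<cdot> Var ''x'' \<rho> \<^bold>\<cdot> Var ''y'' \<sigma>) (Var ''x'' \<rho>) \<in> E_PRA"
| sigma:
    "eq_at \<tau>
       (KSig \<rho> \<sigma> \<tau> \<^bold>\<cdot> Var ''x'' (\<rho> \<^bold>\<rightarrow> \<sigma> \<^bold>\<rightarrow> \<tau>) \<^bold>\<cdot> Var ''y'' (\<rho> \<^bold>\<rightarrow> \<sigma>) \<^bold>\<cdot> Var ''z'' \<rho>)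
       (Var ''x'' (\<rho> \<^bold>\<rightarrow> \<sigma> \<^bold>\<rightarrow> \<tau>) \<^bold>\<cdot> Var ''z'' \<rho> \<^bold>\<cdot> (Var ''y'' (\<rho> \<^bold>\<rightarrow> \<sigma>) \<^bold>\<cdot> Var ''z'' \<rho>)) \<in> E_PRA"
| rec_zero: "(Rec \<^bold>\<cdot> Zero \<^bold>\<cdot> Var ''y'' N \<^bold>\<cdot> Var ''z'' (N \<^bold>\<rightarrow> N \<^bold>\<rightarrow> N) \<^bold>= Var ''y'' N) \<in> E_PRA"
| rec_succ:
    "(Rec \<^bold>\<cdot> (Succ \<^bold>\<cdot> Var ''x'' N) \<^bold>\<cdot> Var ''y'' N \<^bold>\<cdot> Var ''z'' (N \<^bold>\<rightarrow> N \<^bold>\<rightarrow> N)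
      \<^bold>= Var ''z'' (N \<^bold>\<rightarrow> N \<^bold>\<rightarrow> N)
          \<^bold>\<cdot> (Rec \<^bold>\<cdot> Var ''x'' N \<^bold>\<cdot> Var ''y'' N \<^bold>\<cdot> Var ''z'' (N \<^bold>\<rightarrow> N \<^bold>\<rightarrow> N)) \<^bold>\<cdot> Var ''x'' N) \<in> E_PRA"
| qf_induction:
    "qf p \<Longrightarrow> wf_fm p \<Longrightarrow>
     (subst x N Zero p \<^bold>\<and> Forall x N (p \<^bold>\<longrightarrow> subst x N (Succ \<^bold>\<cdot> Var x N) p) \<^bold>\<longrightarrow> Forall x N p) \<in> E_PRA"

definition QF_AC_1_0 :: "fm set" where
  "QF_AC_1_0 =
     {Forall f (N \<^bold>\<rightarrow> N) (Exists x N p) \<^bold>\<longrightarrow>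
      Exists F ((N \<^bold>\<rightarrow> N) \<^bold>\<rightarrow> N)
        (Forall f (N \<^bold>\<rightarrow> N) (subst x N (Var F ((N \<^bold>\<rightarrow> N) \<^bold>\<rightarrow> N) \<^bold>\<cdot> Var f (N \<^bold>\<rightarrow> N)) p))
      | p f x F. qf p \<and> wf_fm p \<and> (F, (N \<^bold>\<rightarrow> N) \<^bold>\<rightarrow> N) \<notin> fvars p}"

definition mu_axiom :: fm where
  "mu_axiom =
     Exists ''mu'' ((N \<^bold>\<rightarrow> N) \<^bold>\<rightarrow> N) (Forall ''f'' (N \<^bold>\<rightarrow> N)
       (Exists ''n'' N (Var ''f'' (N \<^bold>\<rightarrow> N) \<^bold>\<cdot> Var ''n'' N \<^bold>= Zero) \<^bold>\<longrightarrow>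
        Var ''f'' (N \<^bold>\<rightarrow> N) \<^bold>\<cdot> (Var ''mu'' ((N \<^bold>\<rightarrow> N) \<^bold>\<rightarrow> N) \<^bold>\<cdot> Var ''f'' (N \<^bold>\<rightarrow> N)) \<^bold>= Zero))"

definition RCA0_omega :: "fm set" where
  "RCA0_omega = E_PRA \<union> QF_AC_1_0"

definition ACA0_omega :: "fm set" where
  "ACA0_omega = RCA0_omega \<union> {mu_axiom}"

inductive derivable :: "fm set \<Rightarrow> fm \<Rightarrow> bool" (infix "\<^bold>\<turnstile>" 20) for T :: "fm set" where
  axiom: "p \<in> T \<Longrightarrow> T \<^bold>\<turnstile> p"
| imp_K: "wf_fm p \<Longrightarrow> wf_fm q \<Longrightarrow> T \<^bold>\<turnstile> p \<^bold>\<longrightarrow> q \<^bold>\<longrightarrow> p"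
| imp_S: "wf_fm p \<Longrightarrow> wf_fm q \<Longrightarrow> wf_fm r \<Longrightarrow>
    T \<^bold>\<turnstile> (p \<^bold>\<longrightarrow> q \<^bold>\<longrightarrow> r) \<^bold>\<longrightarrow> (p \<^bold>\<longrightarrow> q) \<^bold>\<longrightarrow> p \<^bold>\<longrightarrow> r"
| double_neg: "wf_fm p \<Longrightarrow> T \<^bold>\<turnstile> \<^bold>\<not> (\<^bold>\<not> p) \<^bold>\<longrightarrow> p"
| mp: "T \<^bold>\<turnstile> p \<^bold>\<longrightarrow> q \<Longrightarrow> T \<^bold>\<turnstile> p \<Longrightarrow> T \<^bold>\<turnstile> q"
| inst: "wf_fm p \<Longrightarrow> has_ty t \<rho> \<Longrightarrow> free_for t x \<rho> p \<Longrightarrow> T \<^bold>\<turnstile> Forall x \<rho> p \<^bold>\<longrightarrow> subst x \<rho> t p"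
| gen: "T \<^bold>\<turnstile> p \<^bold>\<longrightarrow> q \<Longrightarrow> (x, \<rho>) \<notin> fvars p \<Longrightarrow> T \<^bold>\<turnstile> p \<^bold>\<longrightarrow> Forall x \<rho> q"


text \<open>
  Arithmetical formulas become formulas of the language of finite types.  Variables keep their
  names; sets and binary relations are given by characteristic functions of type
  \<open>0 \<rightarrow> 0\<close> and \<open>0 \<rightarrow> 0 \<rightarrow> 0\<close>, value 1 meaning membership.
\<close>

abbreviation Pt :: ty where "Pt \<equiv> N \<^bold>\<rightarrow> N"
abbreviation Bn :: ty where "Bn \<equiv> N \<^bold>\<rightarrow> N \<^bold>\<rightarrow> N"

abbreviation num :: "string \<Rightarrow> tm" where "num x \<equiv> Var x N"
abbreviation pnt :: "string \<Rightarrow> tm" where "pnt x \<equiv> Var x Pt"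
abbreviation bin :: "string \<Rightarrow> tm" where "bin x \<equiv> Var x Bn"

abbreviation One :: tm where "One \<equiv> Succ \<^bold>\<cdot> Zero"

text \<open>\<open>Succ_fst\<close> is \<open>\<lambda>a b. Suc a\<close>; addition and multiplication recurse on the second argument.
  The last argument of \<open>Rec\<close> in \<open>Times s t\<close> is \<open>\<lambda>a b. a + s\<close>.\<close>

definition Succ_fst :: tm where
  "Succ_fst = KSig N N (N \<^bold>\<rightarrow> N) \<^bold>\<cdot> (KPi Bn N \<^bold>\<cdot> KPi N N) \<^bold>\<cdot> Succ"

definition Plus :: "tm \<Rightarrow> tm \<Rightarrow> tm" where
  "Plus s t = Rec \<^bold>\<cdot> t \<^bold>\<cdot> s \<^bold>\<cdot> Succ_fst"

definition Times :: "tm \<Rightarrow> tm \<Rightarrow> tm" where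
  "Times s t = Rec \<^bold>\<cdot> t \<^bold>\<cdot> Zero \<^bold>\<cdot>
     (KSig N N (N \<^bold>\<rightarrow> N) \<^bold>\<cdot> (KPi Bn N \<^bold>\<cdot> KPi N N) \<^bold>\<cdot>
       (KSig N Bn N \<^bold>\<cdot> (KSig N N (Bn \<^bold>\<rightarrow> N) \<^bold>\<cdot> Rec \<^bold>\<cdot> (KPi N N \<^bold>\<cdot> s)) \<^bold>\<cdot> (KPi Bn N \<^bold>\<cdot> Succ_fst)))"

definition Less :: "tm \<Rightarrow> tm \<Rightarrow> fm" (infix "\<^bold><" 50) where
  "s \<^bold>< t = Exists (fresh s t) N (Plus s (Succ \<^bold>\<cdot> num (fresh s t)) \<^bold>= t)"

definition Mem :: "tm \<Rightarrow> tm \<Rightarrow> fm" (infix "\<^bold>\<in>" 50) where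
  "t \<^bold>\<in> X = (X \<^bold>\<cdot> t \<^bold>= One)"

definition Mem2 :: "tm \<Rightarrow> tm \<Rightarrow> tm \<Rightarrow> fm" where
  "Mem2 s t X = (X \<^bold>\<cdot> s \<^bold>\<cdot> t \<^bold>= One)"

primrec tr_tm :: "aterm \<Rightarrow> tm" where
  "tr_tm (AVar x) = num x"
| "tr_tm AZero = Zero"
| "tr_tm (ASuc t) = Succ \<^bold>\<cdot> tr_tm t"
| "tr_tm (APlus s t) = Plus (tr_tm s) (tr_tm t)"
| "tr_tm (ATimes s t) = Times (tr_tm s) (tr_tm t)"

primrec tr :: "afm \<Rightarrow> fm" where
  "tr (AEq s t) = (tr_tm s \<^bold>= tr_tm t)"
| "tr (ALess s t) = (tr_tm s \<^bold>< tr_tm t)"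
| "tr (AMem t X) = (tr_tm t \<^bold>\<in> pnt X)"
| "tr (ARel s t X) = Mem2 (tr_tm s) (tr_tm t) (bin X)"
| "tr AFls = Fls"
| "tr (AImp p q) = (tr p \<^bold>\<longrightarrow> tr q)"
| "tr (AAll x p) = Forall x N (tr p)"


text \<open>
  In the formalised statement, a sequence
  \<open>g\<^sub>1, \<dots>, g\<^sub>n\<close> is given by its length \<open>l\<close> and a binary 0-1-valued function \<open>gs\<close> with
  \<open>gs i = g\<^sub>i\<^sub>+\<^sub>1\<close> for \<open>i < l\<close>; its values for \<open>i \<ge> l\<close> are normalised to 0, as in \<open>seq_rel\<close>.
\<close>

definition is_pnt :: "string \<Rightarrow> fm" where
  "is_pnt X = Forall ''k'' N (pnt X \<^bold>\<cdot> num ''k'' \<^bold>= Zero \<^bold>\<or> pnt X \<^bold>\<cdot> num ''k'' \<^bold>= One)"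

definition is_bin :: "string \<Rightarrow> fm" where
  "is_bin X = Forall ''j'' N (Forall ''k'' N
     (bin X \<^bold>\<cdot> num ''j'' \<^bold>\<cdot> num ''k'' \<^bold>= Zero \<^bold>\<or> bin X \<^bold>\<cdot> num ''j'' \<^bold>\<cdot> num ''k'' \<^bold>= One))"

definition total_ordering_fm :: fm where
  "total_ordering_fm =
     (Forall ''i'' N (Forall ''j'' N
        (Mem2 (num ''i'') (num ''j'') (bin ''L'') \<^bold>\<longrightarrow>
         num ''i'' \<^bold>\<in> pnt ''A'' \<^bold>\<and> num ''j'' \<^bold>\<in> pnt ''A'')) \<^bold>\<and>
      Forall ''i'' N (\<^bold>\<not> Mem2 (num ''i'') (num ''i'') (bin ''L'')) \<^bold>\<and>
      Forall ''i'' N (Forall ''j'' N (Forall ''k'' N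
        (Mem2 (num ''i'') (num ''j'') (bin ''L'') \<^bold>\<longrightarrow>
         Mem2 (num ''j'') (num ''k'') (bin ''L'') \<^bold>\<longrightarrow>
         Mem2 (num ''i'') (num ''k'') (bin ''L'')))) \<^bold>\<and>
      Forall ''i'' N (Forall ''j'' N
        (num ''i'' \<^bold>\<in> pnt ''A'' \<^bold>\<longrightarrow> num ''j'' \<^bold>\<in> pnt ''A'' \<^bold>\<longrightarrow>
         num ''i'' \<^bold>= num ''j'' \<^bold>\<or>
         Mem2 (num ''i'') (num ''j'') (bin ''L'') \<^bold>\<or>
         Mem2 (num ''j'') (num ''i'') (bin ''L''))))"

definition is_seq_fm :: fm where
  "is_seq_fm =
     (is_bin ''gs'' \<^bold>\<and>
      Forall ''i'' N (Forall ''k'' N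
        (Mem2 (num ''i'') (num ''k'') (bin ''gs'') \<^bold>\<longrightarrow> num ''i'' \<^bold>< num ''l'')))"

abbreviation GTy :: ty where "GTy \<equiv> Pt \<^bold>\<rightarrow> Pt \<^bold>\<rightarrow> Bn \<^bold>\<rightarrow> Pt \<^bold>\<rightarrow> N"

definition G_app :: "tm \<Rightarrow> tm" where
  "G_app g = Var ''G'' GTy \<^bold>\<cdot> g \<^bold>\<cdot> pnt ''A'' \<^bold>\<cdot> bin ''L'' \<^bold>\<cdot> pnt ''Z''"

definition G_fm :: "afm \<Rightarrow> fm" where
  "G_fm \<gamma> =
     Forall ''g'' Pt (Forall ''A'' Pt (Forall ''L'' Bn (Forall ''Z'' Pt
       (is_pnt ''g'' \<^bold>\<and> is_pnt ''A'' \<^bold>\<and> is_bin ''L'' \<^bold>\<and> is_pnt ''Z'' \<^bold>\<longrightarrow>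
        Forall ''m'' N (G_app (pnt ''g'') \<^bold>= num ''m'' \<^bold>\<longleftrightarrow> tr \<gamma>)))))"

definition covers_fm :: fm where
  "covers_fm =
     Forall ''f'' Pt (is_pnt ''f'' \<^bold>\<longrightarrow>
       Exists ''i'' N (num ''i'' \<^bold>< num ''l'' \<^bold>\<and>
         Forall ''k'' N (num ''k'' \<^bold>< G_app (bin ''gs'' \<^bold>\<cdot> num ''i'') \<^bold>\<longrightarrow>
           pnt ''f'' \<^bold>\<cdot> num ''k'' \<^bold>= bin ''gs'' \<^bold>\<cdot> num ''i'' \<^bold>\<cdot> num ''k'')))"

definition hierarchy_fm :: "afm \<Rightarrow> fm" where
  "hierarchy_fm \<Gamma> =
     Forall ''a'' N (num ''a'' \<^bold>\<in> pnt ''A'' \<^bold>\<longrightarrow>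
       Exists ''X'' Bn
         (is_bin ''X'' \<^bold>\<and>
          Forall ''b'' N (Forall ''m'' N
            (Mem2 (num ''b'') (num ''m'') (bin ''X'') \<^bold>\<longleftrightarrow>
             Mem2 (num ''b'') (num ''m'') (bin ''Y'') \<^bold>\<and>
             Mem2 (num ''b'') (num ''a'') (bin ''L''))) \<^bold>\<and>
          Forall ''n'' N (Mem2 (num ''a'') (num ''n'') (bin ''Y'') \<^bold>\<longleftrightarrow> tr \<Gamma>)))"

definition descending_fm :: fm where
  "descending_fm =
     Forall ''k'' N
       (pnt ''h'' \<^bold>\<cdot> num ''k'' \<^bold>\<in> pnt ''A'' \<^bold>\<and>
        Mem2 (pnt ''h'' \<^bold>\<cdot> (Succ \<^bold>\<cdot> num ''k'')) (pnt ''h'' \<^bold>\<cdot> num ''k'') (bin ''L''))"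

definition theorem_fm :: "afm \<Rightarrow> afm \<Rightarrow> afm \<Rightarrow> afm \<Rightarrow> fm" where
  "theorem_fm \<Gamma> \<gamma> \<upsilon> \<eta> =
     Exists ''G'' GTy (G_fm \<gamma> \<^bold>\<and>
       Forall ''A'' Pt (Forall ''L'' Bn (Forall ''Z'' Pt
         (is_pnt ''A'' \<^bold>\<and> is_bin ''L'' \<^bold>\<and> is_pnt ''Z'' \<^bold>\<and> total_ordering_fm \<^bold>\<longrightarrow>
          Forall ''l'' N (Forall ''gs'' Bn
            (is_seq_fm \<^bold>\<and> covers_fm \<^bold>\<longrightarrow>
             Exists ''Y'' Bn (Exists ''h'' Pt
               (is_bin ''Y'' \<^bold>\<and>
                Forall ''j'' N (Forall ''k'' N
                  (Mem2 (num ''j'') (num ''k'') (bin ''Y'') \<^bold>\<longleftrightarrow> tr \<upsilon>)) \<^bold>\<and>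
                Forall ''k'' N (Forall ''m'' N
                  (pnt ''h'' \<^bold>\<cdot> num ''k'' \<^bold>= num ''m'' \<^bold>\<longleftrightarrow> tr \<eta>)) \<^bold>\<and>
                (hierarchy_fm \<Gamma> \<^bold>\<or> descending_fm)))))))))"

end

theory Submission
  imports Defs "HOL-Library.Countable" "HOL-Library.Countable_Set"
begin

text \<open>
  An element \<open>g\<close> of Cantor space codes \<open>Y \<subseteq> \<nat>\<^sup>2\<close> through an injective polynomial pairing. Call \<open>a \<in> A\<close>
  bad for \<open>g\<close> if row \<open>a\<close> of \<open>Y\<close> is not the value of \<open>\<Gamma>\<close> at the rows below \<open>a\<close>, and let \<open>G\<close> bound a
  place where the row of the minimal bad \<open>a\<close> is wrong. Two codes that have no bad point up to \<open>b\<close> agree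
  up to \<open>b\<close>, or else their disagreements form a set without minimum; likewise for the bad points of
  a code without a minimal one. If such a set exists for \<open>g\<^sub>1, \<dots>, g\<^sub>n\<close>, the union of all of them has
  no minimum and yields \<open>h\<close>. Otherwise let row \<open>b\<close> of \<open>Y\<close> be the value of \<open>\<Gamma>\<close> at the rows of any
  \<open>g\<^sub>i\<close> without bad points below \<open>b\<close>. This \<open>Y\<close> is correct where a \<open>g\<^sub>i\<close> first fails, so the
  neighbourhood of \<open>g\<^sub>i\<close> that contains it belongs to a \<open>g\<^sub>i\<close> without bad points, and \<open>Y\<close> agrees
  with that \<open>g\<^sub>i\<close>.

  Derivability in \<open>ACA\<^sub>0\<^sup>\<omega>\<close> is obtained from a Henkin completeness theorem: the argument above uses only
  arithmetical comprehension and induction, and every extensional model of the axioms has both,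
  thanks to \<open>\<mu>\<close>. The quantifier-free axiom of choice is not needed. Since the Henkin models are
  countable, their possibly nonstandard numbers can be taken to be the type of natural numbers with other
  operations, so the same lemmas serve the standard model and all Henkin models.
\<close>

section \<open>The Hilbert calculus and Henkin sets\<close>

text \<open>Why the disagreements have no minimum: if two codes have no bad point up to
  \<open>x\<close> and differ in row \<open>x\<close>, both rows are values of
  \<open>\<Gamma>\<close>, so the codes already differ in a row below \<open>x\<close>. Why
  \<open>Y\<close> cannot lie in the neighbourhood of a \<open>g_i\<close> with a minimal bad point
  \<open>a\<close>: below \<open>a\<close> that \<open>g_i\<close> has no bad points, so row
  \<open>a\<close> of \<open>Y\<close> is the correct one, while the neighbourhood fixes a place
  where row \<open>a\<close> of \<open>g_i\<close> is wrong.

  The obstacle is that numbers, and even the length of the list, may be nonstandard. A path can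
  therefore not be built by recursion from outside, and every induction needs a definable predicate;
  finite paths are coded by numbers, and the sets without minimum are united instead of treated one
  by one.

  A model starts with only the type-0 recursor and quantifier-free induction. Truncated subtraction
  reduces equality to tests for zero, which yields characteristic functions of equations; the search
  operator eliminates number quantifiers from them, and induction for an arithmetical predicate is
  then induction for an equation.\<close>

instance ty :: countable by countable_datatype
instance tm :: countable by countable_datatype
instance fm :: countable by countable_datatype

lemma has_ty_unique: "has_ty t \<rho> \<Longrightarrow> has_ty t \<sigma> \<Longrightarrow> \<rho> = \<sigma>"
  by (induction t arbitrary: \<rho> \<sigma>) fastforce+

lemma finite_tvars: "finite (tvars t)"
  by (induction t) auto

lemma finite_fvars: "finite (fvars p)"
  by (induction p) (auto simp: finite_tvars)

lemma has_ty_tsubst: "has_ty t \<tau> \<Longrightarrow> has_ty r \<rho> \<Longrightarrow> has_ty (tsubst x \<rho> r t) \<tau>"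
  by (induction t arbitrary: \<tau>) fastforce+

lemma wf_subst: "wf_fm p \<Longrightarrow> has_ty r \<rho> \<Longrightarrow> wf_fm (subst x \<rho> r p)"
  by (induction p) (auto simp: has_ty_tsubst)

text \<open>Generalisation is not a rule here; it occurs only inside derivations brought in by
  \<open>ax\<close>, which use no hypothesis from \<open>H\<close>. So the deduction theorem needs
  no condition on variables. Well-formedness is demanded in \<open>ax\<close> because the schemes
  \<open>imp_K\<close> and \<open>imp_S\<close> are restricted to well-formed formulas.\<close>

inductive ded :: "fm set \<Rightarrow> fm set \<Rightarrow> fm \<Rightarrow> bool" for T H where
  hyp: "p \<in> H \<Longrightarrow> ded T H p"
| ax: "T \<^bold>\<turnstile> p \<Longrightarrow> wf_fm p \<Longrightarrow> ded T H p"
| mp: "ded T H (p \<^bold>\<longrightarrow> q) \<Longrightarrow> ded T H p \<Longrightarrow> ded T H q"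

lemma ded_mp_hyp: "(p \<^bold>\<longrightarrow> q) \<in> H \<Longrightarrow> ded T H p \<Longrightarrow> ded T H q"
  by (rule ded.mp[OF ded.hyp])

lemma ded_wf: "ded T H p \<Longrightarrow> \<forall>q\<in>H. wf_fm q \<Longrightarrow> wf_fm p"
  by (induction rule: ded.induct) auto

lemma ded_empty: "ded T {} p \<Longrightarrow> T \<^bold>\<turnstile> p"
  by (induction rule: ded.induct) (auto intro: derivable.mp)

lemma ded_imp_refl:
  assumes "wf_fm p" shows "ded T H (p \<^bold>\<longrightarrow> p)"
proof -
  have "ded T H ((p \<^bold>\<longrightarrow> (p \<^bold>\<longrightarrow> p) \<^bold>\<longrightarrow> p) \<^bold>\<longrightarrow> (p \<^bold>\<longrightarrow> p \<^bold>\<longrightarrow> p) \<^bold>\<longrightarrow> p \<^bold>\<longrightarrow> p)"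
    using assms by (intro ded.ax derivable.imp_S) auto
  moreover have "ded T H (p \<^bold>\<longrightarrow> (p \<^bold>\<longrightarrow> p) \<^bold>\<longrightarrow> p)" "ded T H (p \<^bold>\<longrightarrow> p \<^bold>\<longrightarrow> p)"
    using assms by (intro ded.ax derivable.imp_K; simp)+
  ultimately show ?thesis by (blast intro: ded.mp)
qed

lemma ded_weaken_imp: "ded T H q \<Longrightarrow> wf_fm p \<Longrightarrow> wf_fm q \<Longrightarrow> ded T H (p \<^bold>\<longrightarrow> q)"
  by (rule ded.mp[OF ded.ax[OF derivable.imp_K]]) auto

lemma deduction:
  assumes "ded T (insert p H) q" "wf_fm p" "\<forall>q\<in>H. wf_fm q"
  shows "ded T H (p \<^bold>\<longrightarrow> q)"
  using assms(1)
proof (induction rule: ded.induct)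
  case (hyp q)
  then show ?case using assms by (auto intro: ded_imp_refl ded_weaken_imp ded.hyp)
next
  case (ax q)
  then show ?case using assms by (auto intro: ded_weaken_imp ded.ax)
next
  case (mp r q)
  have wf: "wf_fm r" "wf_fm q"
    using ded_wf[OF mp.hyps(1)] assms by auto
  have "ded T H ((p \<^bold>\<longrightarrow> r \<^bold>\<longrightarrow> q) \<^bold>\<longrightarrow> (p \<^bold>\<longrightarrow> r) \<^bold>\<longrightarrow> p \<^bold>\<longrightarrow> q)"
    using assms wf by (intro ded.ax derivable.imp_S) auto
  then show ?case using mp.IH by (blast intro: ded.mp)
qed

lemma ded_dne: "ded T (insert (\<^bold>\<not> p) H) Fls \<Longrightarrow> wf_fm p \<Longrightarrow> \<forall>q\<in>H. wf_fm q \<Longrightarrow> ded T H p"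
  by (rule ded.mp[OF ded.ax[OF derivable.double_neg]]) (auto intro: deduction)

lemma conj_intro: "wf_fm p \<Longrightarrow> wf_fm q \<Longrightarrow> T \<^bold>\<turnstile> p \<^bold>\<longrightarrow> q \<^bold>\<longrightarrow> p \<^bold>\<and> q"
proof (rule ded_empty, (rule deduction)+)
  let ?H = "{p \<^bold>\<longrightarrow> \<^bold>\<not> q, q, p}"
  have "ded T ?H (\<^bold>\<not> q)" by (rule ded_mp_hyp[of p]) (auto intro: ded.hyp)
  then show "ded T ?H Fls" by (rule ded.mp) (auto intro: ded.hyp)
qed auto

lemma conj_left: 
  assumes "wf_fm p" "wf_fm q" shows "T \<^bold>\<turnstile> p \<^bold>\<and> q \<^bold>\<longrightarrow> p"
proof (rule ded_empty, rule deduction, rule ded_dne)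
  let ?H = "insert (\<^bold>\<not> p) {p \<^bold>\<and> q}"
  \<comment> \<open>A conjunction is a negated implication, so it is refuted by proving that
    \<open>p\<close> implies not \<open>q\<close>; under the hypothesis not \<open>p\<close> this
    holds by ex falso.\<close>
  have "ded T (insert p ?H) Fls" by (rule ded_mp_hyp[of p]) (auto intro: ded.hyp)
  then have "ded T (insert p ?H) (\<^bold>\<not> q)"
    using assms by (auto intro: ded_weaken_imp)
  then have "ded T ?H (p \<^bold>\<longrightarrow> \<^bold>\<not> q)" by (rule deduction) (use assms in auto)
  then show "ded T ?H Fls" by (rule ded_mp_hyp[rotated]) auto
qed (use assms in auto)

lemma conj_right:
  assumes "wf_fm p" "wf_fm q" shows "T \<^bold>\<turnstile> p \<^bold>\<and> q \<^bold>\<longrightarrow> q"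
proof (rule ded_empty, rule deduction, rule ded_dne)
  let ?H = "insert (\<^bold>\<not> q) {p \<^bold>\<and> q}"
  have "ded T ?H (\<^bold>\<not> q)" by (auto intro: ded.hyp)
  then have "ded T ?H (p \<^bold>\<longrightarrow> \<^bold>\<not> q)" by (rule ded_weaken_imp) (use assms in auto)
  then show "ded T ?H Fls" by (rule ded_mp_hyp[rotated]) auto
qed (use assms in auto)

lemma derivable_trans:
  assumes "T \<^bold>\<turnstile> p \<^bold>\<longrightarrow> q" "T \<^bold>\<turnstile> q \<^bold>\<longrightarrow> r" "wf_fm p" "wf_fm q" "wf_fm r"
  shows "T \<^bold>\<turnstile> p \<^bold>\<longrightarrow> r"
proof (rule ded_empty, rule deduction)
  have "ded T {p} (p \<^bold>\<longrightarrow> q)" "ded T {p} (q \<^bold>\<longrightarrow> r)"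
    using assms by (auto intro!: ded.ax)
  then show "ded T (insert p {}) r" by (meson ded.hyp ded.mp insertI1)
qed (use assms in auto)

lemma derivable_refl: "wf_fm p \<Longrightarrow> T \<^bold>\<turnstile> p \<^bold>\<longrightarrow> p"
  by (intro ded_empty ded_imp_refl)

lemma derivable_weaken: "T \<^bold>\<turnstile> q \<Longrightarrow> wf_fm p \<Longrightarrow> wf_fm q \<Longrightarrow> T \<^bold>\<turnstile> p \<^bold>\<longrightarrow> q"
  by (rule derivable.mp[OF derivable.imp_K])

lemma derivable_mp_under:
  "T \<^bold>\<turnstile> d \<^bold>\<longrightarrow> p \<^bold>\<longrightarrow> q \<Longrightarrow> T \<^bold>\<turnstile> d \<^bold>\<longrightarrow> p \<Longrightarrow> wf_fm d \<Longrightarrow> wf_fm p \<Longrightarrow> wf_fm q \<Longrightarrow> T \<^bold>\<turnstile> d \<^bold>\<longrightarrow> q"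
  by (rule derivable.mp[OF derivable.mp[OF derivable.imp_S]])

lemma derivable_curry:
  assumes "T \<^bold>\<turnstile> d \<^bold>\<and> p \<^bold>\<longrightarrow> q" "wf_fm d" "wf_fm p" "wf_fm q"
  shows "T \<^bold>\<turnstile> d \<^bold>\<longrightarrow> p \<^bold>\<longrightarrow> q"
proof (rule ded_empty, rule deduction, rule deduction)
  have "ded T {p, d} (d \<^bold>\<longrightarrow> p \<^bold>\<longrightarrow> d \<^bold>\<and> p)" "ded T {p, d} (d \<^bold>\<and> p \<^bold>\<longrightarrow> q)"
    using assms by (auto intro!: ded.ax conj_intro)
  then show "ded T {p, d} q" by (meson ded.hyp ded.mp insertCI)
qed (use assms in auto)

lemma derivable_dne_under:
  assumes "T \<^bold>\<turnstile> d \<^bold>\<longrightarrow> \<^bold>\<not> \<^bold>\<not> p" "wf_fm d" "wf_fm p"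
  shows "T \<^bold>\<turnstile> d \<^bold>\<longrightarrow> p"
  by (rule derivable_trans[OF assms(1) derivable.double_neg]) (use assms in auto)


section \<open>Bound names, substitution and renaming of bound variables\<close>

primrec bnames :: "fm \<Rightarrow> string set" where
  "bnames (s \<^bold>= t) = {}"
| "bnames Fls = {}"
| "bnames (p \<^bold>\<longrightarrow> q) = bnames p \<union> bnames q"
| "bnames (Forall x \<rho> p) = insert x (bnames p)"

lemma bnames_subst [simp]: "bnames (subst x \<rho> t p) = bnames p"
  by (induction p) auto

lemma tvars_tsubst: "tvars (tsubst x \<rho> r t) \<subseteq> (tvars t - {(x, \<rho>)}) \<union> tvars r"
  by (induction t) auto

lemma fvars_subst: "fvars (subst x \<rho> r p) \<subseteq> (fvars p - {(x, \<rho>)}) \<union> tvars r"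
proof (induction p)
  case (Eq s t)
  then show ?case using tvars_tsubst[of x \<rho> r s] tvars_tsubst[of x \<rho> r t] by auto
qed auto

lemma tsubst_idle [simp]: "(x, \<rho>) \<notin> tvars t \<Longrightarrow> tsubst x \<rho> r t = t"
  by (induction t) auto

lemma tsubst_back: "(y, \<rho>) \<notin> tvars t \<Longrightarrow> tsubst y \<rho> (Var x \<rho>) (tsubst x \<rho> (Var y \<rho>) t) = t"
  by (induction t) auto

lemma subst_idle: "(x, \<rho>) \<notin> fvars p \<Longrightarrow> subst x \<rho> r p = p"
  by (induction p) auto

lemma subst_back:
  "(y, \<rho>) \<notin> fvars p \<Longrightarrow> y \<notin> bnames p \<Longrightarrow> subst y \<rho> (Var x \<rho>) (subst x \<rho> (Var y \<rho>) p) = p"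
  by (induction p) (auto simp: tsubst_back subst_idle)

lemma free_for_back:
  "(y, \<rho>) \<notin> fvars p \<Longrightarrow> y \<notin> bnames p \<Longrightarrow> free_for (Var x \<rho>) y \<rho> (subst x \<rho> (Var y \<rho>) p)"
  by (induction p) auto

text \<open>Instantiating \<open>y\<close> by \<open>x\<close> undoes the substitution, and
  \<open>x\<close> is not free in the premise, so it can be generalised.\<close>

lemma derivable_rename:
  assumes "wf_fm p" "(y, \<rho>) \<notin> fvars p" "y \<notin> bnames p"
  shows "T \<^bold>\<turnstile> Forall y \<rho> (subst x \<rho> (Var y \<rho>) p) \<^bold>\<longrightarrow> Forall x \<rho> p"
proof (rule derivable.gen)
  show "T \<^bold>\<turnstile> Forall y \<rho> (subst x \<rho> (Var y \<rho>) p) \<^bold>\<longrightarrow> p"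
    using derivable.inst[of "subst x \<rho> (Var y \<rho>) p" "Var x \<rho>" \<rho> y T] assms
    by (simp add: wf_subst free_for_back subst_back)
  show "(x, \<rho>) \<notin> fvars (Forall y \<rho> (subst x \<rho> (Var y \<rho>) p))"
    using fvars_subst[of x \<rho> "Var y \<rho>" p] by auto
qed

text \<open>
  Keeping the names of Henkin witnesses apart from those of bound variables makes every
  substitution below capture-free.
\<close>

locale henkin_names =
  fixes henkin :: "string \<Rightarrow> bool"
  assumes infinite_henkin: "infinite {x. henkin x}"
    and henkin_percent: "henkin x \<Longrightarrow> \<exists>y. x = CHR ''%'' # y"
begin

lemma not_henkin [simp]: "c \<noteq> CHR ''%'' \<Longrightarrow> \<not> henkin (c # x)" "\<not> henkin []"
  using henkin_percent by blast+

text \<open>Free variables with Henkin names serve as the new constants of the construction, so the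
  language is not extended; bound variables never carry such names.\<close>

definition henkin_fm :: "fm \<Rightarrow> bool" where
  "henkin_fm p \<longleftrightarrow> wf_fm p \<and> (\<forall>x\<in>bnames p. \<not> henkin x) \<and> (\<forall>(x, \<rho>)\<in>fvars p. henkin x)"

definition henkin_tm :: "ty \<Rightarrow> tm set" where
  "henkin_tm \<rho> = {t. has_ty t \<rho> \<and> (\<forall>(x, \<sigma>)\<in>tvars t. henkin x)}"

lemma henkin_fm_subst:
  assumes "henkin_fm (Forall x \<rho> p)" "t \<in> henkin_tm \<rho>"
  shows "henkin_fm (subst x \<rho> t p)"
  using assms fvars_subst[of x \<rho> t p] unfolding henkin_fm_def henkin_tm_def
  by (fastforce intro: wf_subst)

lemma free_for_henkin:
  "\<forall>x\<in>bnames p. \<not> henkin x \<Longrightarrow> t \<in> henkin_tm \<sigma> \<Longrightarrow> free_for t x \<rho> p"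
  by (induction p) (auto simp: henkin_tm_def)

lemma ex_henkin_fresh:
  assumes "finite V" shows "\<exists>y. henkin y \<and> (y, \<rho>) \<notin> V"
proof -
  have "inj_on (\<lambda>y. (y, \<rho>)) {x. henkin x}" by (auto simp: inj_on_def)
  then have "\<not> (\<lambda>y. (y, \<rho>)) ` {x. henkin x} \<subseteq> V"
    using assms infinite_henkin by (meson finite_imageD finite_subset)
  then show ?thesis by blast
qed

end

section \<open>Complete extensions with Henkin witnesses\<close>

definition consistent :: "fm set \<Rightarrow> fm \<Rightarrow> bool" where
  "consistent T d \<longleftrightarrow> \<not> (T \<^bold>\<turnstile> \<^bold>\<not> d)"

context henkin_names
begin

definition witness_name :: "ty \<Rightarrow> fm \<Rightarrow> fm \<Rightarrow> string" where
  "witness_name \<rho> d p = (SOME y. henkin y \<and> (y, \<rho>) \<notin> fvars d \<union> fvars p)"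

definition witness :: "fm \<Rightarrow> fm \<Rightarrow> fm" where
  "witness d p = (case p of
     Forall x \<rho> q \<Rightarrow> d \<^bold>\<and> (\<^bold>\<not> subst x \<rho> (Var (witness_name \<rho> d q) \<rho>) q)
   | _ \<Rightarrow> d)"

definition henkin_step :: "fm set \<Rightarrow> fm \<Rightarrow> fm \<Rightarrow> fm" where
  "henkin_step T p d =
     (if \<not> henkin_fm p then d else if consistent T (d \<^bold>\<and> p) then d \<^bold>\<and> p else witness d p)"

text \<open>Each stage is a single formula, the conjunction of what has been added so far. So
  derivability from a stage is derivability of an implication, and a fresh Henkin name exists at
  every stage.\<close>

primrec henkin_chain :: "fm set \<Rightarrow> fm \<Rightarrow> nat \<Rightarrow> fm" where
  "henkin_chain T d 0 = d"
| "henkin_chain T d (Suc n) = henkin_step T (from_nat n) (henkin_chain T d n)"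

definition henkin_set :: "fm set \<Rightarrow> fm \<Rightarrow> fm set" where
  "henkin_set T d = {p. henkin_fm p \<and> (\<exists>n. T \<^bold>\<turnstile> henkin_chain T d n \<^bold>\<longrightarrow> p)}"

lemma witness_name:
  "henkin (witness_name \<rho> d p)" "(witness_name \<rho> d p, \<rho>) \<notin> fvars d" "(witness_name \<rho> d p, \<rho>) \<notin> fvars p"
  using someI_ex[OF ex_henkin_fresh[of "fvars d \<union> fvars p" \<rho>]]
  unfolding witness_name_def by (auto simp: finite_fvars)

lemma inconsistent_conj:
  assumes "\<not> consistent T (d \<^bold>\<and> p)" "wf_fm d" "wf_fm p"
  shows "T \<^bold>\<turnstile> d \<^bold>\<longrightarrow> \<^bold>\<not> p"
  using assms by (intro derivable_curry) (auto simp: consistent_def)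

text \<open>If adding the counterexample were inconsistent, \<open>d\<close> would prove the
  instance at the fresh name \<open>y\<close>, hence by generalisation and renaming the universal
  formula itself. But \<open>d\<close> refutes that formula, as \<open>d \<and> p\<close> is
  inconsistent.\<close>

lemma witness_consistent:
  assumes d: "henkin_fm d" "consistent T d" and p: "henkin_fm p"
    and inc: "\<not> consistent T (d \<^bold>\<and> p)"
  shows "henkin_fm (witness d p) \<and> consistent T (witness d p) \<and> (T \<^bold>\<turnstile> witness d p \<^bold>\<longrightarrow> d)"
proof (cases "\<exists>x \<rho> q. p = Forall x \<rho> q")
  case False
  then have "witness d p = d" by (auto simp: witness_def split: fm.split)
  then show ?thesis using d by (auto simp: henkin_fm_def intro!: derivable_refl)
next
  case True
  then obtain x \<rho> q where pq: "p = Forall x \<rho> q" by auto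
  define y where "y = witness_name \<rho> d q"
  define r where "r = subst x \<rho> (Var y \<rho>) q"
  note y = witness_name[of \<rho> d q, folded y_def]
  have w: "witness d p = (d \<^bold>\<and> (\<^bold>\<not> r))" by (simp add: witness_def pq y_def r_def)
  have r: "henkin_fm r"
    unfolding r_def using p pq y(1) by (auto intro: henkin_fm_subst simp: henkin_tm_def)
  have wf: "wf_fm d" "wf_fm p" "wf_fm r" "wf_fm q" and nb: "y \<notin> bnames q"
    using d p r y by (auto simp: henkin_fm_def pq)
  have "consistent T (d \<^bold>\<and> (\<^bold>\<not> r))"
  proof (rule ccontr)
    assume "\<not> ?thesis"
    then have "T \<^bold>\<turnstile> d \<^bold>\<longrightarrow> \<^bold>\<not> \<^bold>\<not> r" by (rule inconsistent_conj) (use wf in auto)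
    then have "T \<^bold>\<turnstile> d \<^bold>\<longrightarrow> r" by (rule derivable_dne_under) (use wf in auto)
    then have "T \<^bold>\<turnstile> d \<^bold>\<longrightarrow> Forall y \<rho> r" by (rule derivable.gen) (use y in auto)
    moreover have "T \<^bold>\<turnstile> Forall y \<rho> r \<^bold>\<longrightarrow> p"
      unfolding r_def pq using wf y nb by (intro derivable_rename)
    ultimately have "T \<^bold>\<turnstile> d \<^bold>\<longrightarrow> p" by (rule derivable_trans) (use wf in auto)
    moreover have "T \<^bold>\<turnstile> d \<^bold>\<longrightarrow> \<^bold>\<not> p" by (rule inconsistent_conj) (use inc wf in auto)
    ultimately have "T \<^bold>\<turnstile> \<^bold>\<not> d"
      using derivable_mp_under[of T d p Fls] wf by simp
    then show False using d by (simp add: consistent_def)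
  qed
  moreover have "henkin_fm (d \<^bold>\<and> (\<^bold>\<not> r))" using d r by (auto simp: henkin_fm_def)
  moreover have "T \<^bold>\<turnstile> d \<^bold>\<and> (\<^bold>\<not> r) \<^bold>\<longrightarrow> d" using wf by (intro conj_left) auto
  ultimately show ?thesis unfolding w by blast
qed

lemma henkin_step:
  assumes "henkin_fm d" "consistent T d"
  shows "henkin_fm (henkin_step T p d) \<and> consistent T (henkin_step T p d)
    \<and> (T \<^bold>\<turnstile> henkin_step T p d \<^bold>\<longrightarrow> d)"
proof (cases "henkin_fm p")
  case True
  then have "T \<^bold>\<turnstile> d \<^bold>\<and> p \<^bold>\<longrightarrow> d" "henkin_fm (d \<^bold>\<and> p)"
    using assms conj_left[of d p] by (auto simp: henkin_fm_def)
  then show ?thesis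
    using assms True witness_consistent[OF assms, of p] by (simp add: henkin_step_def)
next
  case False
  then show ?thesis
    using assms derivable_refl[of d] by (simp add: henkin_step_def henkin_fm_def)
qed

end

locale henkin_theory = henkin_names henkin for henkin :: "string \<Rightarrow> bool" +
  fixes T :: "fm set" and d0 :: fm
  assumes d0: "henkin_fm d0" "consistent T d0"
begin

abbreviation "chain \<equiv> henkin_chain T d0"
abbreviation "\<Delta> \<equiv> henkin_set T d0"

lemma chain: "henkin_fm (chain n) \<and> consistent T (chain n)"
  by (induction n) (auto simp: d0 henkin_step)

lemma wf_chain: "wf_fm (chain n)"
  using chain by (auto simp: henkin_fm_def)

lemma chain_mono: "m \<le> n \<Longrightarrow> T \<^bold>\<turnstile> chain n \<^bold>\<longrightarrow> chain m"
proof (induction n rule: dec_induct)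
  case base
  then show ?case using wf_chain by (auto intro: derivable_refl)
next
  case (step n)
  have "T \<^bold>\<turnstile> chain (Suc n) \<^bold>\<longrightarrow> chain n" using henkin_step chain by auto
  then show ?case by (rule derivable_trans[OF _ step.IH wf_chain wf_chain wf_chain])
qed

lemma henkin_setD: "p \<in> \<Delta> \<Longrightarrow> henkin_fm p \<and> wf_fm p"
  by (auto simp: henkin_set_def henkin_fm_def)

lemma derivable_in: "T \<^bold>\<turnstile> p \<Longrightarrow> henkin_fm p \<Longrightarrow> p \<in> \<Delta>"
  using wf_chain by (auto simp: henkin_set_def henkin_fm_def intro: derivable_weaken)

lemma d0_in: "d0 \<in> \<Delta>"
  using chain_mono[of 0 0] d0 by (auto simp: henkin_set_def intro!: exI[of _ 0])

lemma chain_later: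
  "T \<^bold>\<turnstile> chain m \<^bold>\<longrightarrow> p \<Longrightarrow> wf_fm p \<Longrightarrow> m \<le> n \<Longrightarrow> T \<^bold>\<turnstile> chain n \<^bold>\<longrightarrow> p"
  using derivable_trans[OF chain_mono] wf_chain by blast

lemma mp_in:
  assumes "(p \<^bold>\<longrightarrow> q) \<in> \<Delta>" "p \<in> \<Delta>" shows "q \<in> \<Delta>"
proof -
  obtain m n where mn: "T \<^bold>\<turnstile> chain m \<^bold>\<longrightarrow> p \<^bold>\<longrightarrow> q" "T \<^bold>\<turnstile> chain n \<^bold>\<longrightarrow> p"
    using assms by (auto simp: henkin_set_def)
  have wf: "wf_fm p" "wf_fm q" using henkin_setD[OF assms(1)] by auto
  have "T \<^bold>\<turnstile> chain (max m n) \<^bold>\<longrightarrow> q"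
    by (rule derivable_mp_under[OF chain_later[OF mn(1)] chain_later[OF mn(2)]])
      (use wf wf_chain in auto)
  then show ?thesis using henkin_setD[OF assms(1)] by (auto simp: henkin_set_def henkin_fm_def)
qed

lemma Fls_notin: "Fls \<notin> \<Delta>"
  using chain by (auto simp: henkin_set_def consistent_def)

text \<open>Besides deciding \<open>p\<close>, the second alternative records that a counterexample
  is inserted at this very stage; \<open>forall_in_iff\<close> depends on it.\<close>

lemma in_or_neg_at:
  assumes p: "henkin_fm p" and n: "from_nat n = p"
  shows "(T \<^bold>\<turnstile> chain (Suc n) \<^bold>\<longrightarrow> p) \<or> (T \<^bold>\<turnstile> chain n \<^bold>\<longrightarrow> \<^bold>\<not> p) \<and> chain (Suc n) = witness (chain n) p"
proof (cases "consistent T (chain n \<^bold>\<and> p)")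
  case True
  then have "chain (Suc n) = (chain n \<^bold>\<and> p)" using p by (simp add: henkin_step_def n)
  then show ?thesis using p wf_chain conj_right[of "chain n" p] by (simp add: henkin_fm_def)
next
  case False
  then show ?thesis
    using p inconsistent_conj[OF False wf_chain] by (simp add: henkin_step_def n henkin_fm_def)
qed

lemma complete:
  assumes "henkin_fm p" shows "p \<in> \<Delta> \<or> (\<^bold>\<not> p) \<in> \<Delta>"
proof -
  have "henkin_fm (\<^bold>\<not> p)" using assms by (simp add: henkin_fm_def)
  then show ?thesis
    using in_or_neg_at[OF assms from_nat_to_nat] assms unfolding henkin_set_def by blast
qed

lemma imp_in_iff:
  assumes "henkin_fm p" "henkin_fm q"
  shows "(p \<^bold>\<longrightarrow> q) \<in> \<Delta> \<longleftrightarrow> (p \<in> \<Delta> \<longrightarrow> q \<in> \<Delta>)"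
proof
  have wf: "wf_fm p" "wf_fm q" and pq: "henkin_fm (p \<^bold>\<longrightarrow> q)"
    using assms by (auto simp: henkin_fm_def)
  assume *: "p \<in> \<Delta> \<longrightarrow> q \<in> \<Delta>"
  show "(p \<^bold>\<longrightarrow> q) \<in> \<Delta>"
  proof (cases "q \<in> \<Delta>")
    case True
    have "(q \<^bold>\<longrightarrow> p \<^bold>\<longrightarrow> q) \<in> \<Delta>"
      using wf assms by (intro derivable_in derivable.imp_K) (auto simp: henkin_fm_def)
    then show ?thesis using True mp_in by blast
  next
    case False
    then have np: "(\<^bold>\<not> p) \<in> \<Delta>" using * complete[OF assms(1)] by auto
    have "ded T {p, \<^bold>\<not> p} q"
      by (rule ded_dne, rule ded_mp_hyp[of p]) (use wf in \<open>auto intro: ded.hyp\<close>)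
    then have "T \<^bold>\<turnstile> \<^bold>\<not> p \<^bold>\<longrightarrow> p \<^bold>\<longrightarrow> q"
      using wf by (intro ded_empty deduction) auto
    then have "(\<^bold>\<not> p \<^bold>\<longrightarrow> p \<^bold>\<longrightarrow> q) \<in> \<Delta>"
      using assms by (intro derivable_in) (auto simp: henkin_fm_def)
    then show ?thesis using np mp_in by blast
  qed
qed (use mp_in in blast)

text \<open>From right to left: the stage that treats the universal formula either adds it or adds a
  counterexample named by a Henkin variable, and the latter contradicts the instance at that
  variable.\<close>

lemma forall_in_iff:
  assumes "henkin_fm (Forall x \<rho> p)"
  shows "Forall x \<rho> p \<in> \<Delta> \<longleftrightarrow> (\<forall>t\<in>henkin_tm \<rho>. subst x \<rho> t p \<in> \<Delta>)"
proof
  assume f: "Forall x \<rho> p \<in> \<Delta>"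
  show "\<forall>t\<in>henkin_tm \<rho>. subst x \<rho> t p \<in> \<Delta>"
  proof
    fix t assume t: "t \<in> henkin_tm \<rho>"
    have "T \<^bold>\<turnstile> Forall x \<rho> p \<^bold>\<longrightarrow> subst x \<rho> t p"
      using assms t by (intro derivable.inst free_for_henkin[OF _ t]) (auto simp: henkin_fm_def henkin_tm_def)
    then have "(Forall x \<rho> p \<^bold>\<longrightarrow> subst x \<rho> t p) \<in> \<Delta>"
      using assms henkin_fm_subst[OF assms t] by (intro derivable_in) (auto simp: henkin_fm_def)
    then show "subst x \<rho> t p \<in> \<Delta>" using f mp_in by blast
  qed
next
  assume all: "\<forall>t\<in>henkin_tm \<rho>. subst x \<rho> t p \<in> \<Delta>"
  define n where "n = to_nat (Forall x \<rho> p)"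
  define y where "y = witness_name \<rho> (chain n) p"
  have yt: "Var y \<rho> \<in> henkin_tm \<rho>" using witness_name(1) by (auto simp: henkin_tm_def y_def)
  define r where "r = subst x \<rho> (Var y \<rho>) p"
  have r: "r \<in> \<Delta>" using all yt r_def by blast
  show "Forall x \<rho> p \<in> \<Delta>"
  proof (rule ccontr)
    assume "Forall x \<rho> p \<notin> \<Delta>"
    then have "chain (Suc n) = witness (chain n) (Forall x \<rho> p)"
      using in_or_neg_at[OF assms, of n] assms unfolding henkin_set_def n_def from_nat_to_nat by blast
    then have "chain (Suc n) = (chain n \<^bold>\<and> (\<^bold>\<not> r))"
      by (simp add: witness_def y_def r_def)
    then have "T \<^bold>\<turnstile> chain (Suc n) \<^bold>\<longrightarrow> \<^bold>\<not> r"
      using conj_right[of "chain n" "\<^bold>\<not> r"] wf_chain henkin_setD[OF r] by auto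
    then have "(\<^bold>\<not> r) \<in> \<Delta>"
      using henkin_setD[OF r] unfolding henkin_set_def
      by (auto simp: henkin_fm_def simp del: henkin_chain.simps)
    then show False using r mp_in Fls_notin by blast
  qed
qed

end

section \<open>Term models and completeness\<close>

primrec val :: "('a \<Rightarrow> 'a \<Rightarrow> 'a) \<Rightarrow> (tm \<Rightarrow> 'a) \<Rightarrow> (string \<times> ty \<Rightarrow> 'a) \<Rightarrow> tm \<Rightarrow> 'a" where
  "val ap ct e (Var x \<rho>) = e (x, \<rho>)"
| "val ap ct e (s \<^bold>\<cdot> t) = ap (val ap ct e s) (val ap ct e t)"
| "val ap ct e Zero = ct Zero"
| "val ap ct e Succ = ct Succ"
| "val ap ct e (KPi \<rho> \<sigma>) = ct (KPi \<rho> \<sigma>)"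
| "val ap ct e (KSig \<rho> \<sigma> \<tau>) = ct (KSig \<rho> \<sigma> \<tau>)"
| "val ap ct e Rec = ct Rec"

text \<open>Equality at type 0 is a parameter \<open>Q\<close>. Thus the term model, where it is
  membership of the equation in the Henkin set, and its quotient, where it is identity, are
  instances of one semantics.\<close>

primrec sat :: "(ty \<Rightarrow> 'a set) \<Rightarrow> ('a \<Rightarrow> 'a \<Rightarrow> 'a) \<Rightarrow> (tm \<Rightarrow> 'a) \<Rightarrow> ('a \<Rightarrow> 'a \<Rightarrow> bool)
    \<Rightarrow> (string \<times> ty \<Rightarrow> 'a) \<Rightarrow> fm \<Rightarrow> bool" where
  "sat D ap ct Q e (s \<^bold>= t) = Q (val ap ct e s) (val ap ct e t)"
| "sat D ap ct Q e Fls = False"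
| "sat D ap ct Q e (p \<^bold>\<longrightarrow> q) = (sat D ap ct Q e p \<longrightarrow> sat D ap ct Q e q)"
| "sat D ap ct Q e (Forall x \<rho> p) = (\<forall>a\<in>D \<rho>. sat D ap ct Q (e((x, \<rho>) := a)) p)"

definition typed_env :: "(ty \<Rightarrow> 'a set) \<Rightarrow> (string \<times> ty \<Rightarrow> 'a) \<Rightarrow> bool" where
  "typed_env D e \<longleftrightarrow> (\<forall>x \<rho>. e (x, \<rho>) \<in> D \<rho>)"

lemma typed_env_upd [simp]: "typed_env D e \<Longrightarrow> a \<in> D \<rho> \<Longrightarrow> typed_env D (e((x, \<rho>) := a))"
  by (auto simp: typed_env_def)

lemma val_fresh: "width t < length x \<Longrightarrow> val ap ct (e((x, \<rho>) := a)) t = val ap ct e t"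
  by (induction t) auto

primrec peq :: "(ty \<Rightarrow> 'a set) \<Rightarrow> ('a \<Rightarrow> 'a \<Rightarrow> 'a) \<Rightarrow> ('a \<Rightarrow> 'a \<Rightarrow> bool) \<Rightarrow> ty \<Rightarrow> 'a \<Rightarrow> 'a \<Rightarrow> bool" where
  "peq D ap Q N a b = Q a b"
| "peq D ap Q (\<sigma> \<^bold>\<rightarrow> \<tau>) f g = (\<forall>u\<in>D \<sigma>. peq D ap Q \<tau> (ap f u) (ap g u))"

lemma width_fresh: "width s < length (fresh s t)" "width t < length (fresh s t)"
  by (auto simp: fresh_def)

lemma sat_eq_at:
  "sat D ap ct Q e (eq_at \<rho> s t) \<longleftrightarrow> peq D ap Q \<rho> (val ap ct e s) (val ap ct e t)"
  by (induction \<rho> arbitrary: s t e) (auto simp: val_fresh width_fresh)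

lemma wf_eq_at: "has_ty s \<rho> \<Longrightarrow> has_ty t \<rho> \<Longrightarrow> wf_fm (eq_at \<rho> s t)"
  by (induction \<rho> arbitrary: s t) auto

lemma fvars_eq_at: "fvars (eq_at \<rho> s t) \<subseteq> tvars s \<union> tvars t"
  by (induction \<rho> arbitrary: s t) fastforce+

lemma (in henkin_names) bnames_eq_at: "x \<in> bnames (eq_at \<rho> s t) \<Longrightarrow> \<not> henkin x"
  by (induction \<rho> arbitrary: s t) (auto simp: fresh_def)

primrec is_const :: "tm \<Rightarrow> bool" where
  "is_const (Var x \<rho>) = False"
| "is_const (s \<^bold>\<cdot> t) = False"
| "is_const Zero = True"
| "is_const Succ = True"
| "is_const (KPi \<rho> \<sigma>) = True"
| "is_const (KSig \<rho> \<sigma> \<tau>) = True"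
| "is_const Rec = True"

section \<open>Quotient of a term model by pointwise equality\<close>

locale applicative =
  fixes D :: "ty \<Rightarrow> 'a set" and ap :: "'a \<Rightarrow> 'a \<Rightarrow> 'a" and ct :: "tm \<Rightarrow> 'a"
  assumes ap_type: "f \<in> D (\<sigma> \<^bold>\<rightarrow> \<tau>) \<Longrightarrow> a \<in> D \<sigma> \<Longrightarrow> ap f a \<in> D \<tau>"
    and ct_type: "is_const k \<Longrightarrow> has_ty k \<rho> \<Longrightarrow> ct k \<in> D \<rho>"
begin

lemma val_type: "has_ty t \<rho> \<Longrightarrow> typed_env D e \<Longrightarrow> val ap ct e t \<in> D \<rho>"
  by (induction t arbitrary: \<rho>) (auto simp: typed_env_def intro: ap_type ct_type)

end

text \<open>These are the equality and extensionality axioms as they hold in the term model.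
  Congruence in the function position is built into pointwise equality, so the assumption concerns
  the argument position.\<close>

locale weakly_extensional = applicative D ap ct
  for D :: "ty \<Rightarrow> 'a set" and ap :: "'a \<Rightarrow> 'a \<Rightarrow> 'a" and ct :: "tm \<Rightarrow> 'a" +
  fixes Q :: "'a \<Rightarrow> 'a \<Rightarrow> bool"
  assumes disj: "a \<in> D \<rho> \<Longrightarrow> a \<in> D \<sigma> \<Longrightarrow> \<rho> = \<sigma>"
    and Q_refl: "a \<in> D N \<Longrightarrow> Q a a"
    and Q_eucl: "a \<in> D N \<Longrightarrow> b \<in> D N \<Longrightarrow> c \<in> D N \<Longrightarrow> Q a b \<Longrightarrow> Q a c \<Longrightarrow> Q b c"
    and ap_cong_right: "f \<in> D (\<sigma> \<^bold>\<rightarrow> \<tau>) \<Longrightarrow> a \<in> D \<sigma> \<Longrightarrow> b \<in> D \<sigma> \<Longrightarrow>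
      peq D ap Q \<sigma> a b \<Longrightarrow> peq D ap Q \<tau> (ap f a) (ap f b)"
begin

abbreviation "E \<equiv> peq D ap Q"

lemma E_refl: "a \<in> D \<rho> \<Longrightarrow> E \<rho> a a"
  by (induction \<rho> arbitrary: a) (auto simp: Q_refl ap_type)

lemma E_eucl: "a \<in> D \<rho> \<Longrightarrow> b \<in> D \<rho> \<Longrightarrow> c \<in> D \<rho> \<Longrightarrow> E \<rho> a b \<Longrightarrow> E \<rho> a c \<Longrightarrow> E \<rho> b c"
proof (induction \<rho> arbitrary: a b c)
  case (Fun \<sigma> \<tau>)
  show ?case
    using Fun.prems by (auto intro: Fun.IH(2)[of "ap a _"] ap_type)
qed (auto intro: Q_eucl)

lemma E_sym: "a \<in> D \<rho> \<Longrightarrow> b \<in> D \<rho> \<Longrightarrow> E \<rho> a b \<Longrightarrow> E \<rho> b a"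
  using E_eucl E_refl by blast

lemma E_trans: "a \<in> D \<rho> \<Longrightarrow> b \<in> D \<rho> \<Longrightarrow> c \<in> D \<rho> \<Longrightarrow> E \<rho> a b \<Longrightarrow> E \<rho> b c \<Longrightarrow> E \<rho> a c"
  using E_eucl E_sym by blast

lemma ap_cong:
  assumes "f \<in> D (\<sigma> \<^bold>\<rightarrow> \<tau>)" "g \<in> D (\<sigma> \<^bold>\<rightarrow> \<tau>)" "a \<in> D \<sigma>" "b \<in> D \<sigma>"
    "E (\<sigma> \<^bold>\<rightarrow> \<tau>) f g" "E \<sigma> a b"
  shows "E \<tau> (ap f a) (ap g b)"
proof (rule E_trans)
  show "E \<tau> (ap f a) (ap f b)" using assms ap_cong_right by blast
  show "E \<tau> (ap f b) (ap g b)" using assms by simp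
qed (use assms ap_type in blast)+

text \<open>Chosen representatives instead of equivalence classes keep the quotient on the same
  type, so it is again a model made of terms. By \<open>disj\<close> the type \<open>\<rho>\<close>
  is determined by \<open>a\<close>.\<close>

definition rp :: "'a \<Rightarrow> 'a" where
  "rp a = (SOME b. \<exists>\<rho>. a \<in> D \<rho> \<and> b \<in> D \<rho> \<and> E \<rho> a b)"

definition "D1 \<rho> = rp ` D \<rho>"
definition "ap1 a b = rp (ap a b)"
definition "ct1 k = rp (ct k)"

lemma rp_at: assumes "d \<in> D \<rho>" shows "rp d = (SOME c. c \<in> D \<rho> \<and> E \<rho> d c)"
proof -
  have "(\<lambda>c. \<exists>\<sigma>. d \<in> D \<sigma> \<and> c \<in> D \<sigma> \<and> E \<sigma> d c) = (\<lambda>c. c \<in> D \<rho> \<and> E \<rho> d c)"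
    using assms disj by (intro ext) blast
  then show ?thesis by (simp add: rp_def)
qed

lemma rp: assumes "a \<in> D \<rho>" shows "rp a \<in> D \<rho>" "E \<rho> a (rp a)"
proof -
  have "\<exists>b. b \<in> D \<rho> \<and> E \<rho> a b" using assms E_refl by blast
  from someI_ex[OF this, folded rp_at[OF assms]] show "rp a \<in> D \<rho>" "E \<rho> a (rp a)"
    by blast+
qed

lemma rp_eq_iff: assumes "a \<in> D \<rho>" "b \<in> D \<rho>" shows "rp a = rp b \<longleftrightarrow> E \<rho> a b"
proof
  assume "rp a = rp b"
  then show "E \<rho> a b" using rp assms E_trans E_sym by metis
next
  assume "E \<rho> a b"
  then have "(\<lambda>c. c \<in> D \<rho> \<and> E \<rho> a c) = (\<lambda>c. c \<in> D \<rho> \<and> E \<rho> b c)"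
    using assms E_eucl[of a \<rho> b] E_trans[of a \<rho> b] by (intro ext) blast
  then show "rp a = rp b" using rp_at assms by simp
qed

lemma D1_sub: "a \<in> D1 \<rho> \<Longrightarrow> a \<in> D \<rho>"
  by (auto simp: D1_def rp)

lemma D1_rp: "a \<in> D1 \<rho> \<Longrightarrow> rp a = a"
proof -
  assume "a \<in> D1 \<rho>"
  then obtain b where b: "b \<in> D \<rho>" "a = rp b" by (auto simp: D1_def)
  show "rp a = a" using rp_eq_iff[OF b(1) rp(1)[OF b(1)]] rp(2)[OF b(1)] b(2) by simp
qed

sublocale quot: applicative D1 ap1 ct1
proof
  fix f \<sigma> \<tau> a assume "f \<in> D1 (\<sigma> \<^bold>\<rightarrow> \<tau>)" "a \<in> D1 \<sigma>"
  then show "ap1 f a \<in> D1 \<tau>"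
    using ap_type[of f \<sigma> \<tau> a] by (auto simp: ap1_def D1_sub) (auto simp: D1_def)
qed (auto simp: ct1_def D1_def intro: ct_type)

text \<open>Agreement on representatives is enough, since \<open>ap_cong_right\<close> moves every
  argument to its representative.\<close>

lemma quot_ext:
  assumes fg: "f \<in> D1 (\<sigma> \<^bold>\<rightarrow> \<tau>)" "g \<in> D1 (\<sigma> \<^bold>\<rightarrow> \<tau>)"
    and eq: "\<And>a. a \<in> D1 \<sigma> \<Longrightarrow> ap1 f a = ap1 g a"
  shows "f = g"
proof -
  note fg' = fg[THEN D1_sub]
  have "E (\<sigma> \<^bold>\<rightarrow> \<tau>) f g"
    unfolding peq.simps
  proof
    fix u assume u: "u \<in> D \<sigma>"
    then have ru: "rp u \<in> D \<sigma>" "E \<sigma> u (rp u)" and "rp u \<in> D1 \<sigma>" by (auto simp: rp D1_def)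
    then have "rp (ap f (rp u)) = rp (ap g (rp u))" using eq by (simp add: ap1_def)
    then have "E \<tau> (ap f (rp u)) (ap g (rp u))" using fg' ru ap_type rp_eq_iff by blast
    moreover have "E \<tau> (ap f u) (ap f (rp u))" "E \<tau> (ap g (rp u)) (ap g u)"
      using fg' u ru ap_cong_right E_sym by blast+
    ultimately show "E \<tau> (ap f u) (ap g u)"
      using fg' u ru ap_type E_trans[of "ap f u" \<tau> "ap f (rp u)" "ap g u"]
        E_trans[of "ap f (rp u)" \<tau> "ap g (rp u)" "ap g u"] by blast
  qed
  then show ?thesis using rp_eq_iff[OF fg'] D1_rp fg by metis
qed

lemma val_cong:
  assumes "typed_env D e" "typed_env D e'" "\<And>x \<rho>. E \<rho> (e (x, \<rho>)) (e' (x, \<rho>))"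
  shows "has_ty t \<rho> \<Longrightarrow> E \<rho> (val ap ct e t) (val ap ct e' t)"
proof (induction t arbitrary: \<rho>)
  case (App s t)
  then obtain \<sigma> where st: "has_ty s (\<sigma> \<^bold>\<rightarrow> \<rho>)" "has_ty t \<sigma>" by auto
  show ?case unfolding val.simps
    by (rule ap_cong[OF val_type[OF st(1) assms(1)] val_type[OF st(1) assms(2)]
          val_type[OF st(2) assms(1)] val_type[OF st(2) assms(2)] App.IH(1)[OF st(1)] App.IH(2)[OF st(2)]])
qed (use assms ct_type E_refl in \<open>auto simp del: peq.simps\<close>)

lemma sat_cong:
  assumes "wf_fm p" "typed_env D e" "typed_env D e'" "\<And>x \<rho>. E \<rho> (e (x, \<rho>)) (e' (x, \<rho>))"
  shows "sat D ap ct Q e p \<longleftrightarrow> sat D ap ct Q e' p"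
  using assms
proof (induction p arbitrary: e e')
  case (Eq s t)
  then have "Q (val ap ct e s) (val ap ct e' s)" "Q (val ap ct e t) (val ap ct e' t)"
    using val_cong[of e e' _ N] by auto
  moreover have "val ap ct e s \<in> D N" "val ap ct e t \<in> D N" "val ap ct e' s \<in> D N" "val ap ct e' t \<in> D N"
    using Eq val_type by auto
  ultimately show ?case
    unfolding sat.simps
    using Q_eucl[of "val ap ct e s" "val ap ct e' s" "val ap ct e t"]
      Q_eucl[of "val ap ct e t" "val ap ct e' s" "val ap ct e' t"]
      Q_eucl[of "val ap ct e' s" "val ap ct e s" "val ap ct e' t"]
      Q_eucl[of "val ap ct e' t" "val ap ct e s" "val ap ct e t"]
      E_sym[of _ N, unfolded peq.simps] by fast
next
  case (Forall x \<rho> p)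
  have "sat D ap ct Q (e((x, \<rho>) := a)) p \<longleftrightarrow> sat D ap ct Q (e'((x, \<rho>) := a)) p" if "a \<in> D \<rho>" for a
    using Forall.prems that E_refl by (intro Forall.IH typed_env_upd) auto
  then show ?case by auto
qed auto

lemma val_quot: 
  assumes "typed_env D1 e"
  shows "has_ty t \<rho> \<Longrightarrow> val ap1 ct1 e t = rp (val ap ct e t)"
proof (induction t arbitrary: \<rho>)
  case (App s t)
  then obtain \<sigma> where st: "has_ty s (\<sigma> \<^bold>\<rightarrow> \<rho>)" "has_ty t \<sigma>" by auto
  have e: "typed_env D e" using assms D1_sub by (auto simp: typed_env_def)
  have v: "val ap ct e s \<in> D (\<sigma> \<^bold>\<rightarrow> \<rho>)" "val ap ct e t \<in> D \<sigma>" using st e val_type by auto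
  then have "E \<rho> (ap (rp (val ap ct e s)) (rp (val ap ct e t))) (ap (val ap ct e s) (val ap ct e t))"
    by (intro ap_cong[OF rp(1)[OF v(1)] v(1) rp(1)[OF v(2)] v(2)]
        E_sym[OF v(1) rp(1)[OF v(1)] rp(2)[OF v(1)]] E_sym[OF v(2) rp(1)[OF v(2)] rp(2)[OF v(2)]])
  then show ?case
    using App.IH st v rp[OF v(1)] rp[OF v(2)] rp_eq_iff ap_type by (simp add: ap1_def) metis
next
  case (Var x \<sigma>)
  then show ?case using assms D1_rp[of "e (x, \<sigma>)" \<sigma>] by (simp add: typed_env_def)
qed (auto simp: ct1_def)

text \<open>Quantifiers in the quotient range over representatives; by \<open>sat_cong\<close> this
  loses nothing, as every element is equal to its representative.\<close>

lemma sat_quot: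
  assumes "wf_fm p" "typed_env D1 e"
  shows "sat D1 ap1 ct1 (=) e p \<longleftrightarrow> sat D ap ct Q e p"
  using assms
proof (induction p arbitrary: e)
  case (Eq s t)
  have e: "typed_env D e" using Eq D1_sub by (auto simp: typed_env_def)
  show ?case using Eq val_quot[of e _ N] rp_eq_iff[of _ N] val_type[OF _ e] by simp
next
  case (Forall x \<rho> p)
  have e: "typed_env D e" using Forall D1_sub by (auto simp: typed_env_def)
  have "sat D ap ct Q (e((x, \<rho>) := a)) p \<longleftrightarrow> sat D ap ct Q (e((x, \<rho>) := rp a)) p" if "a \<in> D \<rho>" for a
    using Forall.prems that rp[OF that] e E_refl
    by (intro sat_cong) (auto simp: typed_env_def)
  then show ?case using Forall by (simp add: D1_def)
qed auto

end

section \<open>Simultaneous substitution and the truth lemma\<close>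

context henkin_theory
begin

abbreviation "\<Delta>eq s t \<equiv> (s \<^bold>= t) \<in> \<Delta>"
abbreviation "hsat \<equiv> sat henkin_tm (\<^bold>\<cdot>) id \<Delta>eq"

end

text \<open>Evaluation in the term model, that is \<open>val\<close> with syntactic application and
  \<open>id\<close>, is simultaneous substitution. This extends it to formulas and leaves bound
  variables in place.\<close>

primrec psub :: "(string \<times> ty \<Rightarrow> tm) \<Rightarrow> fm \<Rightarrow> fm" where
  "psub e (s \<^bold>= t) = (val (\<^bold>\<cdot>) id e s \<^bold>= val (\<^bold>\<cdot>) id e t)"
| "psub e Fls = Fls"
| "psub e (p \<^bold>\<longrightarrow> q) = (psub e p \<^bold>\<longrightarrow> psub e q)"
| "psub e (Forall x \<rho> p) = Forall x \<rho> (psub (e((x, \<rho>) := Var x \<rho>)) p)"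

lemma tsubst_val:
  assumes "\<And>v. v \<noteq> (x, \<rho>) \<Longrightarrow> (x, \<rho>) \<notin> tvars (e v)"
  shows "tsubst x \<rho> t (val (\<^bold>\<cdot>) id (e((x, \<rho>) := Var x \<rho>)) s) = val (\<^bold>\<cdot>) id (e((x, \<rho>) := t)) s"
  by (induction s) (use assms in auto)

text \<open>The hypothesis keeps the substitution for \<open>x\<close> from hitting a term already
  inserted for another variable. It holds for Henkin terms, since \<open>x\<close> is a bound
  name.\<close>

lemma subst_psub:
  assumes "\<And>v. v \<noteq> (x, \<rho>) \<Longrightarrow> (x, \<rho>) \<notin> tvars (e v)"
  shows "subst x \<rho> t (psub (e((x, \<rho>) := Var x \<rho>)) p) = psub (e((x, \<rho>) := t)) p"
  using assms
proof (induction p arbitrary: e)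
  case (Forall y \<sigma> p)
  show ?case
  proof (cases "(y, \<sigma>) = (x, \<rho>)")
    case False
    then have "subst x \<rho> t (psub ((e((y, \<sigma>) := Var y \<sigma>))((x, \<rho>) := Var x \<rho>)) p)
      = psub ((e((y, \<sigma>) := Var y \<sigma>))((x, \<rho>) := t)) p"
      using Forall.prems by (intro Forall.IH) auto
    moreover have "e((x, \<rho>) := a, (y, \<sigma>) := b) = e((y, \<sigma>) := b, (x, \<rho>) := a)" for a b
      using False by (intro fun_upd_twist) auto
    ultimately show ?thesis using False by (auto simp del: fun_upd_apply)
  qed (auto simp del: fun_upd_apply)
qed (auto simp: tsubst_val)

lemma has_ty_val: "has_ty t \<tau> \<Longrightarrow> \<forall>x \<rho>. has_ty (e (x, \<rho>)) \<rho> \<Longrightarrow> has_ty (val (\<^bold>\<cdot>) id e t) \<tau>"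
  by (induction t arbitrary: \<tau>) fastforce+

lemma wf_psub: "wf_fm p \<Longrightarrow> \<forall>x \<rho>. has_ty (e (x, \<rho>)) \<rho> \<Longrightarrow> wf_fm (psub e p)"
  by (induction p arbitrary: e) (auto simp: has_ty_val)

lemma bnames_psub: "bnames (psub e p) = bnames p"
  by (induction p arbitrary: e) auto

lemma tvars_val: "tvars (val (\<^bold>\<cdot>) id e t) \<subseteq> (\<Union>v\<in>tvars t. tvars (e v))"
  by (induction t) auto

lemma fvars_psub: "fvars (psub e p) \<subseteq> (\<Union>v\<in>fvars p. tvars (e v))"
proof (induction p arbitrary: e)
  case (Eq s t)
  then show ?case using tvars_val[of e s] tvars_val[of e t] by auto
next
  case (Forall x \<rho> p)
  have "fvars (psub (e((x, \<rho>) := Var x \<rho>)) p) \<subseteq> (\<Union>v\<in>fvars p. tvars ((e((x, \<rho>) := Var x \<rho>)) v))"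
    by (rule Forall.IH)
  then show ?case by (fastforce split: if_splits)
next
  case (Imp p q)
  then show ?case by (simp, blast)
qed simp

lemma val_idle: "\<forall>(x, \<rho>)\<in>tvars t. e (x, \<rho>) = Var x \<rho> \<Longrightarrow> val (\<^bold>\<cdot>) id e t = t"
  by (induction t) auto

lemma psub_idle: "\<forall>(x, \<rho>)\<in>fvars p. e (x, \<rho>) = Var x \<rho> \<Longrightarrow> psub e p = p"
proof (induction p arbitrary: e)
  case (Forall x \<rho> p)
  then have "psub (e((x, \<rho>) := Var x \<rho>)) p = p" by (intro Forall.IH) force
  then show ?case by simp
qed (auto simp: val_idle)

definition closure :: "(string \<times> ty) list \<Rightarrow> fm \<Rightarrow> fm" where
  "closure vs p = foldr (\<lambda>(x, \<rho>) q. Forall x \<rho> q) vs p"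

lemma closure_simps [simp]:
  "closure [] p = p" "closure ((x, \<rho>) # vs) p = Forall x \<rho> (closure vs p)"
  by (auto simp: closure_def)

lemma wf_closure: "wf_fm (closure vs p) \<longleftrightarrow> wf_fm p"
  by (induction vs) auto

lemma fvars_closure: "fvars (closure vs p) = fvars p - set vs"
proof (induction vs)
  case (Cons v vs)
  show ?case by (cases v) (simp add: Cons.IH Diff_insert[symmetric])
qed simp

lemma bnames_closure: "bnames (closure vs p) = bnames p \<union> fst ` set vs"
  by (induction vs) force+

lemma derivable_gen: 
  assumes "T \<^bold>\<turnstile> p" "wf_fm p" shows "T \<^bold>\<turnstile> Forall x \<rho> p"
proof -
  have "T \<^bold>\<turnstile> (Fls \<^bold>\<longrightarrow> Fls) \<^bold>\<longrightarrow> Forall x \<rho> p"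
    using assms by (intro derivable.gen derivable_weaken) auto
  then show ?thesis by (rule derivable.mp) (simp add: derivable_refl)
qed

lemma derivable_closure: "T \<^bold>\<turnstile> p \<Longrightarrow> wf_fm p \<Longrightarrow> T \<^bold>\<turnstile> closure vs p"
proof (induction vs)
  case (Cons v vs)
  then show ?case by (cases v) (simp add: derivable_gen wf_closure)
qed simp

lemma sat_closure: "sat D ap ct Q e (closure vs p) \<Longrightarrow> typed_env D e \<Longrightarrow> sat D ap ct Q e p"
proof (induction vs)
  case (Cons v vs)
  obtain x \<rho> where v: "v = (x, \<rho>)" by force
  then have "sat D ap ct Q (e((x, \<rho>) := e (x, \<rho>))) (closure vs p)"
    using Cons.prems by (auto simp: typed_env_def simp del: fun_upd_triv)
  then show ?case using Cons by simp
qed simp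

context henkin_names
begin

text \<open>Instances of the axiom schemes may contain Henkin names. Axioms without such names are
  the ones transferred to the model, so plainness is checked wherever an axiom is used
  there.\<close>

definition plain :: "fm \<Rightarrow> bool" where
  "plain p \<longleftrightarrow> wf_fm p \<and> (\<forall>x\<in>bnames p. \<not> henkin x) \<and> (\<forall>(x, \<rho>)\<in>fvars p. \<not> henkin x)"

lemma plain_eq_at:
  assumes "has_ty s \<rho>" "has_ty t \<rho>" "\<forall>(x, \<sigma>)\<in>tvars s \<union> tvars t. \<not> henkin x"
  shows "plain (eq_at \<rho> s t)"
  using assms wf_eq_at bnames_eq_at fvars_eq_at[of \<rho> s t] unfolding plain_def by blast

end

context henkin_theory
begin

lemma psub_henkin:
  assumes "wf_fm p" "\<forall>x\<in>bnames p. \<not> henkin x" "typed_env henkin_tm e"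
  shows "henkin_fm (psub e p)"
proof -
  have "henkin x" if "(x, \<rho>) \<in> tvars (e v)" for x \<rho> v
    using assms(3) that by (cases v) (force simp: typed_env_def henkin_tm_def)
  then have "\<forall>(x, \<rho>)\<in>fvars (psub e p). henkin x" using fvars_psub[of e p] by blast
  moreover have "wf_fm (psub e p)"
    using assms by (intro wf_psub) (auto simp: typed_env_def henkin_tm_def)
  ultimately show ?thesis using assms by (simp add: henkin_fm_def bnames_psub)
qed

lemma henkin_truth:
  assumes "wf_fm p" "\<forall>x\<in>bnames p. \<not> henkin x" "typed_env henkin_tm e"
  shows "hsat e p \<longleftrightarrow> psub e p \<in> \<Delta>"
  using assms
proof (induction p arbitrary: e)
  case Fls
  then show ?case by (simp add: Fls_notin)
next
  case (Imp p q)
  then have "henkin_fm (psub e p)" "henkin_fm (psub e q)" by (auto intro: psub_henkin)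
  then show ?case using Imp by (simp add: imp_in_iff)
next
  case (Forall x \<rho> p)
  have nx: "(x, \<rho>) \<notin> tvars (e v)" for v
    using Forall.prems by (cases v) (force simp: typed_env_def henkin_tm_def)
  have "henkin_fm (psub e (Forall x \<rho> p))"
    using Forall.prems by (rule psub_henkin)
  then have "psub e (Forall x \<rho> p) \<in> \<Delta> \<longleftrightarrow> (\<forall>t\<in>henkin_tm \<rho>. psub (e((x, \<rho>) := t)) p \<in> \<Delta>)"
    using nx by (simp add: forall_in_iff subst_psub)
  then show ?case using Forall by simp
qed simp

text \<open>The universal closure of a derivable formula is closed, so it lies in
  \<open>\<Delta>\<close> and \<open>psub\<close> does not change it, whatever the
  environment.\<close>

lemma henkin_sound:
  assumes "T \<^bold>\<turnstile> p" "plain p" "typed_env henkin_tm e"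
  shows "hsat e p"
proof -
  obtain vs where vs: "set vs = fvars p" using finite_list[OF finite_fvars] by metis
  define q where "q = closure vs p"
  have wf: "wf_fm p" using assms by (simp add: plain_def)
  have b: "\<forall>x\<in>bnames q. \<not> henkin x" "fvars q = {}" "wf_fm q"
    using assms by (auto simp: plain_def q_def bnames_closure fvars_closure vs wf_closure)
  have "q \<in> \<Delta>"
    unfolding q_def using assms wf b
    by (intro derivable_in derivable_closure) (auto simp: q_def henkin_fm_def)
  then have "hsat e q" using henkin_truth[OF b(3,1) assms(3)] psub_idle[of q e] b by simp
  then show ?thesis using assms sat_closure unfolding q_def by blast
qed

lemma henkin_weakly_extensional:
  assumes "E_PRA \<subseteq> T"
  shows "weakly_extensional henkin_tm (\<^bold>\<cdot>) id \<Delta>eq"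
proof -
  interpret applicative henkin_tm "(\<^bold>\<cdot>)" id
  proof
    show "id k \<in> henkin_tm \<rho>" if "is_const k" "has_ty k \<rho>" for k \<rho>
      using that by (cases k) (auto simp: henkin_tm_def)
  qed (auto simp: henkin_tm_def)
  obtain v where "henkin v" using ex_henkin_fresh[of "{}"] by auto
  define e0 where "e0 = (\<lambda>(x :: string, \<rho>). Var v \<rho>)"
  have e0: "typed_env henkin_tm e0"
    using \<open>henkin v\<close> by (simp add: e0_def typed_env_def henkin_tm_def)
  have ax: "hsat e p" if "p \<in> E_PRA" "plain p" "typed_env henkin_tm e" for e p
    using that assms by (intro henkin_sound) (auto intro: derivable.axiom)
  show ?thesis
  proof
    show "\<And>a \<rho> \<sigma>. a \<in> henkin_tm \<rho> \<Longrightarrow> a \<in> henkin_tm \<sigma> \<Longrightarrow> \<rho> = \<sigma>"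
      by (auto simp: henkin_tm_def dest: has_ty_unique)
  next
    fix a assume "a \<in> henkin_tm N"
    then show "\<Delta>eq a a"
      using ax[OF E_PRA.eq_refl, of "e0((''x'', N) := a)"] e0 by (simp add: plain_def)
  next
    fix a b c assume "a \<in> henkin_tm N" "b \<in> henkin_tm N" "c \<in> henkin_tm N" "\<Delta>eq a b" "\<Delta>eq a c"
    then show "\<Delta>eq b c"
      using ax[OF E_PRA.eq_eucl, of "e0((''x'', N) := a, (''y'', N) := b, (''z'', N) := c)"] e0
      by (simp add: plain_def)
  next
    fix f \<sigma> \<tau> a b
    assume *: "f \<in> henkin_tm (\<sigma> \<^bold>\<rightarrow> \<tau>)" "a \<in> henkin_tm \<sigma>" "b \<in> henkin_tm \<sigma>"
      "peq henkin_tm (\<^bold>\<cdot>) \<Delta>eq \<sigma> a b"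
    let ?e = "e0((''x'', \<sigma>) := a, (''y'', \<sigma>) := b, (''z'', \<sigma> \<^bold>\<rightarrow> \<tau>) := f)"
    let ?l = "eq_at \<sigma> (Var ''x'' \<sigma>) (Var ''y'' \<sigma>)"
    let ?r = "eq_at \<tau> (Var ''z'' (\<sigma> \<^bold>\<rightarrow> \<tau>) \<^bold>\<cdot> Var ''x'' \<sigma>) (Var ''z'' (\<sigma> \<^bold>\<rightarrow> \<tau>) \<^bold>\<cdot> Var ''y'' \<sigma>)"
    have "plain ?l" "plain ?r" by (intro plain_eq_at; simp)+
    then have "plain (?l \<^bold>\<longrightarrow> ?r)" by (auto simp: plain_def)
    then have "hsat ?e (?l \<^bold>\<longrightarrow> ?r)"
      using * e0 by (intro ax E_PRA.extensionality) auto
    then show "peq henkin_tm (\<^bold>\<cdot>) \<Delta>eq \<tau> (f \<^bold>\<cdot> a) (f \<^bold>\<cdot> b)"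
      using * by (simp add: sat_eq_at)
  qed
qed

end

text \<open>The Henkin model of the negation of \<open>\<phi>\<close> would contradict
  \<open>model\<close>. Models made of terms suffice because the quotient uses representatives, and
  one environment suffices because \<open>\<phi>\<close> is closed.\<close>

theorem (in henkin_names) completeness:
  assumes "E_PRA \<subseteq> T" "plain \<phi>" "fvars \<phi> = {}"
    and model: "\<And>(D :: ty \<Rightarrow> tm set) ap ct.
      applicative D ap ct \<Longrightarrow> (\<And>\<rho>. D \<rho> \<noteq> {}) \<Longrightarrow>
      (\<And>f g \<sigma> \<tau>. f \<in> D (\<sigma> \<^bold>\<rightarrow> \<tau>) \<Longrightarrow> g \<in> D (\<sigma> \<^bold>\<rightarrow> \<tau>) \<Longrightarrow>
        (\<And>a. a \<in> D \<sigma> \<Longrightarrow> ap f a = ap g a) \<Longrightarrow> f = g) \<Longrightarrow>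
      (\<And>p e. p \<in> T \<Longrightarrow> plain p \<Longrightarrow> typed_env D e \<Longrightarrow> sat D ap ct (=) e p) \<Longrightarrow>
      \<exists>e. typed_env D e \<and> sat D ap ct (=) e \<phi>"
  shows "T \<^bold>\<turnstile> \<phi>"
proof (rule ccontr)
  assume nd: "\<not> (T \<^bold>\<turnstile> \<phi>)"
  have wf: "wf_fm \<phi>" using assms by (simp add: plain_def)
  have "consistent T (\<^bold>\<not> \<phi>)"
    using nd wf derivable.mp[OF derivable.double_neg[OF wf]] unfolding consistent_def by blast
  moreover have hf: "henkin_fm (\<^bold>\<not> \<phi>)" using assms by (auto simp: henkin_fm_def plain_def)
  ultimately interpret henkin_theory henkin T "\<^bold>\<not> \<phi>" by unfold_locales
  interpret weakly_extensional henkin_tm "(\<^bold>\<cdot>)" id \<Delta>eq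
    using assms by (intro henkin_weakly_extensional)
  have ne: "D1 \<rho> \<noteq> {}" for \<rho>
  proof -
    obtain v where "henkin v" using ex_henkin_fresh[of "{}"] by auto
    then have "Var v \<rho> \<in> henkin_tm \<rho>" by (simp add: henkin_tm_def)
    then show ?thesis by (auto simp: D1_def)
  qed
  have "sat D1 ap1 ct1 (=) e p" if "p \<in> T" "plain p" "typed_env D1 e" for e p
  proof -
    have "typed_env henkin_tm e" using that D1_sub by (auto simp: typed_env_def)
    then show ?thesis using that henkin_sound[OF derivable.axiom] by (auto simp: sat_quot plain_def)
  qed
  then have "\<exists>e. typed_env D1 e \<and> sat D1 ap1 ct1 (=) e \<phi>"
    using model[OF quot.applicative_axioms ne] quot_ext by metis
  then obtain e where e: "typed_env D1 e" "hsat e \<phi>" using sat_quot wf by blast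
  have "typed_env henkin_tm e" using e D1_sub by (auto simp: typed_env_def)
  then have "hsat e (\<^bold>\<not> \<phi>)"
    using henkin_truth[of "\<^bold>\<not> \<phi>" e] hf d0_in psub_idle[of \<phi> e] assms
    by (simp add: henkin_fm_def)
  then show False using e by simp
qed

section \<open>Definability in models of the finite-type theory\<close>

text \<open>The axioms in semantic form. Induction is stated for a disjunction of two equations,
  because \<open>num_cases\<close> and \<open>pls_mon_cases\<close> have this shape and must be
  proved before characteristic functions are available.\<close>

locale fin_model = applicative D ap ct
  for D :: "ty \<Rightarrow> 'a set" and ap :: "'a \<Rightarrow> 'a \<Rightarrow> 'a" and ct :: "tm \<Rightarrow> 'a" +
  assumes ext: "f \<in> D (\<sigma> \<^bold>\<rightarrow> \<tau>) \<Longrightarrow> g \<in> D (\<sigma> \<^bold>\<rightarrow> \<tau>) \<Longrightarrow> (\<And>a. a \<in> D \<sigma> \<Longrightarrow> ap f a = ap g a) \<Longrightarrow> f = g"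
    and inhabited: "D \<rho> \<noteq> {}"
    and succ_neq: "a \<in> D N \<Longrightarrow> ap (ct Succ) a \<noteq> ct Zero"
    and succ_inject: "a \<in> D N \<Longrightarrow> b \<in> D N \<Longrightarrow> ap (ct Succ) a = ap (ct Succ) b \<Longrightarrow> a = b"
    and pi_eq: "a \<in> D \<rho> \<Longrightarrow> b \<in> D \<sigma> \<Longrightarrow> ap (ap (ct (KPi \<rho> \<sigma>)) a) b = a"
    and sigma_eq: "f \<in> D (\<rho> \<^bold>\<rightarrow> \<sigma> \<^bold>\<rightarrow> \<tau>) \<Longrightarrow> g \<in> D (\<rho> \<^bold>\<rightarrow> \<sigma>) \<Longrightarrow> a \<in> D \<rho> \<Longrightarrow>
      ap (ap (ap (ct (KSig \<rho> \<sigma> \<tau>)) f) g) a = ap (ap f a) (ap g a)"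
    and rec_zero: "a \<in> D N \<Longrightarrow> f \<in> D Bn \<Longrightarrow> ap (ap (ap (ct Rec) (ct Zero)) a) f = a"
    and rec_succ: "n \<in> D N \<Longrightarrow> a \<in> D N \<Longrightarrow> f \<in> D Bn \<Longrightarrow>
      ap (ap (ap (ct Rec) (ap (ct Succ) n)) a) f = ap (ap f (ap (ap (ap (ct Rec) n) a) f)) n"
    and induct_disj: "f \<in> D Pt \<Longrightarrow> g \<in> D Pt \<Longrightarrow> f' \<in> D Pt \<Longrightarrow> g' \<in> D Pt \<Longrightarrow>
      ap f (ct Zero) = ap g (ct Zero) \<or> ap f' (ct Zero) = ap g' (ct Zero) \<Longrightarrow>
      (\<And>n. n \<in> D N \<Longrightarrow> ap f n = ap g n \<or> ap f' n = ap g' n \<Longrightarrow>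
        ap f (ap (ct Succ) n) = ap g (ap (ct Succ) n) \<or> ap f' (ap (ct Succ) n) = ap g' (ap (ct Succ) n)) \<Longrightarrow>
      n \<in> D N \<Longrightarrow> ap f n = ap g n \<or> ap f' n = ap g' n"
    and search: "\<exists>mu \<in> D (Pt \<^bold>\<rightarrow> N). \<forall>f \<in> D Pt. (\<exists>n \<in> D N. ap f n = ct Zero) \<longrightarrow> ap f (ap mu f) = ct Zero"
begin

abbreviation "zr \<equiv> ct Zero"
abbreviation "sc \<equiv> ap (ct Succ)"

lemma const_type [simp, intro]:
  "ct Zero \<in> D N" "ct Succ \<in> D Pt" "ct (KPi \<rho> \<sigma>) \<in> D (\<rho> \<^bold>\<rightarrow> \<sigma> \<^bold>\<rightarrow> \<rho>)"
  "ct (KSig \<rho> \<sigma> \<tau>) \<in> D ((\<rho> \<^bold>\<rightarrow> \<sigma> \<^bold>\<rightarrow> \<tau>) \<^bold>\<rightarrow> (\<rho> \<^bold>\<rightarrow> \<sigma>) \<^bold>\<rightarrow> \<rho> \<^bold>\<rightarrow> \<tau>)"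
  "ct Rec \<in> D (N \<^bold>\<rightarrow> N \<^bold>\<rightarrow> Bn \<^bold>\<rightarrow> N)"
  by (auto intro!: ct_type)

lemma sc_type [simp, intro]: "a \<in> D N \<Longrightarrow> sc a \<in> D N"
  by (rule ap_type[of _ N]) auto

section \<open>Combinatory completeness\<close>

definition typed :: "ty list \<Rightarrow> (nat \<Rightarrow> 'a) \<Rightarrow> bool" where
  "typed cs e \<longleftrightarrow> (\<forall>i<length cs. e i \<in> D (cs ! i))"

lemma typed_Nil [simp]: "typed [] e"
  by (simp add: typed_def)

lemma typed_Cons [simp]: "typed (\<sigma> # cs) e \<longleftrightarrow> e 0 \<in> D \<sigma> \<and> typed cs (\<lambda>i. e (Suc i))"
  by (auto simp: typed_def nth_Cons split: nat.split)

text \<open>\<open>rep cs \<rho> F\<close>: the open term \<open>F\<close>, with de Bruijn variables of types \<open>cs\<close>, is represented in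
  the model; the innermost variable \<open>e 0\<close> is the last argument of the representing functional.\<close>

primrec rep :: "ty list \<Rightarrow> ty \<Rightarrow> ((nat \<Rightarrow> 'a) \<Rightarrow> 'a) \<Rightarrow> bool" where
  "rep [] \<rho> F \<longleftrightarrow> (\<exists>c\<in>D \<rho>. \<forall>e. F e = c)"
| "rep (\<sigma> # cs) \<rho> F \<longleftrightarrow> (\<exists>F'. rep cs (\<sigma> \<^bold>\<rightarrow> \<rho>) F' \<and>
     (\<forall>e. typed (\<sigma> # cs) e \<longrightarrow> F e = ap (F' (\<lambda>i. e (Suc i))) (e 0)))"

lemma rep_type: "rep cs \<rho> F \<Longrightarrow> typed cs e \<Longrightarrow> F e \<in> D \<rho>"
proof (induction cs arbitrary: \<rho> F e)
  case (Cons \<sigma> cs)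
  then obtain F' where "rep cs (\<sigma> \<^bold>\<rightarrow> \<rho>) F'" "F e = ap (F' (\<lambda>i. e (Suc i))) (e 0)" by auto
  then show ?case using Cons.IH[of "\<sigma> \<^bold>\<rightarrow> \<rho>" F'] Cons.prems(2) by (auto intro: ap_type)
qed auto

lemma rep_const [intro]: "c \<in> D \<rho> \<Longrightarrow> rep cs \<rho> (\<lambda>_. c)"
proof (induction cs arbitrary: \<rho> c)
  case (Cons \<sigma> cs)
  have "ap (ct (KPi \<rho> \<sigma>)) c \<in> D (\<sigma> \<^bold>\<rightarrow> \<rho>)" using Cons.prems by (auto intro: ap_type)
  then show ?case
    using Cons pi_eq by (auto intro!: exI[of _ "\<lambda>_. ap (ct (KPi \<rho> \<sigma>)) c"])
qed auto

lemma rep_cong: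
  assumes "rep cs \<rho> F" "\<And>e. typed cs e \<Longrightarrow> G e = F e" shows "rep cs \<rho> G"
  using assms by (cases cs) auto

text \<open>Distributing application over the innermost variable is the equation of
  \<open>\<Sigma>\<close>; the induction removes the variables one at a time.\<close>

lemma rep_app [intro]: "rep cs (\<sigma> \<^bold>\<rightarrow> \<tau>) F \<Longrightarrow> rep cs \<sigma> G \<Longrightarrow> rep cs \<tau> (\<lambda>e. ap (F e) (G e))"
proof (induction cs arbitrary: \<sigma> \<tau> F G)
  case Nil
  then show ?case by (auto intro: ap_type)
next
  case (Cons \<rho> cs)
  then obtain F' G' where F': "rep cs (\<rho> \<^bold>\<rightarrow> \<sigma> \<^bold>\<rightarrow> \<tau>) F'"
      "\<And>e. typed (\<rho> # cs) e \<Longrightarrow> F e = ap (F' (\<lambda>i. e (Suc i))) (e 0)"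
    and G': "rep cs (\<rho> \<^bold>\<rightarrow> \<sigma>) G'"
      "\<And>e. typed (\<rho> # cs) e \<Longrightarrow> G e = ap (G' (\<lambda>i. e (Suc i))) (e 0)"
    by auto
  have "rep cs (\<rho> \<^bold>\<rightarrow> \<tau>) (\<lambda>e. ap (ap (ct (KSig \<rho> \<sigma> \<tau>)) (F' e)) (G' e))"
    using F'(1) G'(1) by (intro Cons.IH rep_const) auto
  then show ?case
    using F' G' rep_type[OF F'(1)] rep_type[OF G'(1)]
    by (auto simp: sigma_eq intro!: exI[of _ "\<lambda>e. ap (ap (ct (KSig \<rho> \<sigma> \<tau>)) (F' e)) (G' e)"])
qed

lemma rep_lam:
  assumes "rep (\<sigma> # cs) \<rho> F"
  obtains F' where "rep cs (\<sigma> \<^bold>\<rightarrow> \<rho>) F'"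
    "\<And>e a. typed cs e \<Longrightarrow> a \<in> D \<sigma> \<Longrightarrow> ap (F' e) a = F (case_nat a e)"
proof -
  obtain F' where "rep cs (\<sigma> \<^bold>\<rightarrow> \<rho>) F'"
      "\<And>e. typed (\<sigma> # cs) e \<Longrightarrow> F e = ap (F' (\<lambda>i. e (Suc i))) (e 0)"
    using assms by auto
  then show ?thesis using that by fastforce
qed

lemma rep_shift: "rep cs \<rho> F \<Longrightarrow> rep (\<sigma> # cs) \<rho> (\<lambda>e. F (\<lambda>i. e (Suc i)))"
  using rep_app[OF rep_const[of "ct (KPi \<rho> \<sigma>)"], of \<rho> "\<sigma> \<^bold>\<rightarrow> \<rho>" cs F] rep_type[of cs \<rho> F] pi_eq
  by (auto intro!: exI[of _ "\<lambda>e. ap (ct (KPi \<rho> \<sigma>)) (F e)"])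

text \<open>The identity combinator in the form S K K.\<close>

definition "iota \<sigma> = ap (ap (ct (KSig \<sigma> (\<sigma> \<^bold>\<rightarrow> \<sigma>) \<sigma>)) (ct (KPi \<sigma> (\<sigma> \<^bold>\<rightarrow> \<sigma>)))) (ct (KPi \<sigma> \<sigma>))"

lemma iota: "iota \<sigma> \<in> D (\<sigma> \<^bold>\<rightarrow> \<sigma>)" "a \<in> D \<sigma> \<Longrightarrow> ap (iota \<sigma>) a = a"
proof -
  show "iota \<sigma> \<in> D (\<sigma> \<^bold>\<rightarrow> \<sigma>)"
    unfolding iota_def by (rule ap_type[OF ap_type]) auto
  assume a: "a \<in> D \<sigma>"
  have "ap (ct (KPi \<sigma> \<sigma>)) a \<in> D (\<sigma> \<^bold>\<rightarrow> \<sigma>)" using a by (auto intro: ap_type)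
  then show "ap (iota \<sigma>) a = a"
    unfolding iota_def
    using a sigma_eq[of "ct (KPi \<sigma> (\<sigma> \<^bold>\<rightarrow> \<sigma>))" \<sigma> "\<sigma> \<^bold>\<rightarrow> \<sigma>" \<sigma> "ct (KPi \<sigma> \<sigma>)" a] by (auto simp: pi_eq)
qed

lemma rep_var: "i < length cs \<Longrightarrow> \<rho> = cs ! i \<Longrightarrow> rep cs \<rho> (\<lambda>e. e i)"
proof (induction cs arbitrary: i \<rho>)
  case (Cons \<sigma> cs)
  show ?case
  proof (cases i)
    case 0
    then show ?thesis
      using Cons.prems iota by (auto intro!: exI[of _ "\<lambda>_. iota \<sigma>"])
  next
    case (Suc j)
    then have "rep cs \<rho> (\<lambda>e. e j)" using Cons by auto
    from rep_shift[OF this, of \<sigma>] show ?thesis using Suc by simp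
  qed
qed simp

lemma rep_append: "rep cs \<rho> F \<Longrightarrow> rep (cs @ ds) \<rho> F"
proof (induction cs arbitrary: \<rho> F)
  case Nil
  then obtain c where "c \<in> D \<rho>" "F = (\<lambda>_. c)" by auto
  then show ?case by auto
next
  case (Cons \<sigma> cs)
  have "typed (cs @ ds) e \<Longrightarrow> typed cs e" for e by (auto simp: typed_def nth_append split: if_splits)
  then show ?case using Cons by fastforce
qed

lemma rep_subst:
  "rep ds \<rho> F \<Longrightarrow> (\<And>i. i < length ds \<Longrightarrow> rep cs (ds ! i) (t i)) \<Longrightarrow> rep cs \<rho> (\<lambda>e. F (\<lambda>i. t i e))"
proof (induction ds arbitrary: \<rho> F t)
  case Nil
  then obtain c where "c \<in> D \<rho>" "F = (\<lambda>_. c)" by auto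
  then show ?case by auto
next
  case (Cons \<sigma> ds)
  then obtain F' where F': "rep ds (\<sigma> \<^bold>\<rightarrow> \<rho>) F'"
      "\<And>e. typed (\<sigma> # ds) e \<Longrightarrow> F e = ap (F' (\<lambda>i. e (Suc i))) (e 0)"
    by auto
  have t: "rep cs \<sigma> (t 0)" "\<And>i. i < length ds \<Longrightarrow> rep cs (ds ! i) (t (Suc i))"
    using Cons.prems(2)[of 0] Cons.prems(2)[of "Suc _"] by auto
  have "rep cs (\<sigma> \<^bold>\<rightarrow> \<rho>) (\<lambda>e. F' (\<lambda>i. t (Suc i) e))"
    by (rule Cons.IH[OF F'(1)]) (rule t(2))
  then have "rep cs \<rho> (\<lambda>e. ap (F' (\<lambda>i. t (Suc i) e)) (t 0 e))" by (rule rep_app[OF _ t(1)])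
  then show ?case
  proof (rule rep_cong)
    fix e assume e: "typed cs e"
    have "typed (\<sigma> # ds) (\<lambda>i. t i e)"
      using t rep_type[OF _ e] by (auto simp: typed_def nth_Cons split: nat.split)
    then show "F (\<lambda>i. t i e) = ap (F' (\<lambda>i. t (Suc i) e)) (t 0 e)" using F' by simp
  qed
qed

lemma rep_elem:
  assumes "rep [\<sigma>] \<rho> (\<lambda>e. F (e 0))"
  obtains f where "f \<in> D (\<sigma> \<^bold>\<rightarrow> \<rho>)" "\<And>a. a \<in> D \<sigma> \<Longrightarrow> ap f a = F a"
proof -
  obtain F' where F': "rep [] (\<sigma> \<^bold>\<rightarrow> \<rho>) F'" "\<And>e a. typed [] e \<Longrightarrow> a \<in> D \<sigma> \<Longrightarrow> ap (F' e) a = F a"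
    using rep_lam[OF assms] by auto
  then show ?thesis using that by auto
qed

lemma rep_elem2:
  assumes "rep [\<sigma>, \<tau>] \<rho> (\<lambda>e. F (e 1) (e 0))"
  obtains f where "f \<in> D (\<tau> \<^bold>\<rightarrow> \<sigma> \<^bold>\<rightarrow> \<rho>)" "\<And>a b. a \<in> D \<tau> \<Longrightarrow> b \<in> D \<sigma> \<Longrightarrow> ap (ap f a) b = F a b"
proof -
  obtain F' where F': "rep [\<tau>] (\<sigma> \<^bold>\<rightarrow> \<rho>) F'"
      "\<And>e a. typed [\<tau>] e \<Longrightarrow> a \<in> D \<sigma> \<Longrightarrow> ap (F' e) a = F (e 0) a"
    by (rule rep_lam[OF assms]) simp
  obtain F'' where F'': "rep [] (\<tau> \<^bold>\<rightarrow> \<sigma> \<^bold>\<rightarrow> \<rho>) F''"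
      "\<And>e b. b \<in> D \<tau> \<Longrightarrow> ap (F'' e) b = F' (case_nat b e)"
    using rep_lam[OF F'(1)] by auto
  then obtain f where f: "f \<in> D (\<tau> \<^bold>\<rightarrow> \<sigma> \<^bold>\<rightarrow> \<rho>)" "\<And>e. F'' e = f" by auto
  show ?thesis
  proof (rule that[OF f(1)])
    fix a b assume ab: "a \<in> D \<tau>" "b \<in> D \<sigma>"
    have "ap f a = F' (case_nat a undefined)" using F''(2)[OF ab(1), of undefined] f(2) by simp
    then show "ap (ap f a) b = F a b" using F'(2)[of "case_nat a undefined" b] ab by simp
  qed
qed

declare rep.simps [simp del]

lemma induct2:
  assumes "rep [N] N (\<lambda>e. F (e 0))" "rep [N] N (\<lambda>e. G (e 0))"
    "rep [N] N (\<lambda>e. F' (e 0))" "rep [N] N (\<lambda>e. G' (e 0))"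
    and "F zr = G zr \<or> F' zr = G' zr"
    and "\<And>n. n \<in> D N \<Longrightarrow> F n = G n \<or> F' n = G' n \<Longrightarrow> F (sc n) = G (sc n) \<or> F' (sc n) = G' (sc n)"
    and "n \<in> D N"
  shows "F n = G n \<or> F' n = G' n"
proof -
  obtain f where "f \<in> D Pt" "\<And>a. a \<in> D N \<Longrightarrow> ap f a = F a" using rep_elem[OF assms(1)] by blast
  moreover obtain g where "g \<in> D Pt" "\<And>a. a \<in> D N \<Longrightarrow> ap g a = G a"
    using rep_elem[OF assms(2)] by blast
  moreover obtain f' where "f' \<in> D Pt" "\<And>a. a \<in> D N \<Longrightarrow> ap f' a = F' a"
    using rep_elem[OF assms(3)] by blast
  moreover obtain g' where "g' \<in> D Pt" "\<And>a. a \<in> D N \<Longrightarrow> ap g' a = G' a"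
    using rep_elem[OF assms(4)] by blast
  ultimately show ?thesis using induct_disj[of f g f' g' n] assms(5-) by simp
qed

lemma induct_eq:
  assumes "rep [N] N (\<lambda>e. F (e 0))" "rep [N] N (\<lambda>e. G (e 0))" "F zr = G zr"
    and "\<And>n. n \<in> D N \<Longrightarrow> F n = G n \<Longrightarrow> F (sc n) = G (sc n)" and "n \<in> D N"
  shows "F n = G n"
  using induct2[OF assms(1,2,1,2)] assms by blast

section \<open>Addition, multiplication, truncated subtraction and definition by cases\<close>

abbreviation "recr n a f \<equiv> ap (ap (ap (ct Rec) n) a) f"

lemma recr_type [intro]: "n \<in> D N \<Longrightarrow> a \<in> D N \<Longrightarrow> f \<in> D Bn \<Longrightarrow> recr n a f \<in> D N"
  by (intro ap_type[OF ap_type[OF ap_type[OF const_type(5)]]])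

lemma rep_recr: "rep cs N F \<Longrightarrow> rep cs N G \<Longrightarrow> rep cs Bn H \<Longrightarrow> rep cs N (\<lambda>e. recr (F e) (G e) (H e))"
  by (intro rep_app[OF rep_app[OF rep_app[OF rep_const[OF const_type(5)]]]])

definition "succ_fst = ap (ap (ct (KSig N N Pt)) (ap (ct (KPi Bn N)) (ct (KPi N N)))) (ct Succ)"

lemma succ_fst: "succ_fst \<in> D Bn" "a \<in> D N \<Longrightarrow> b \<in> D N \<Longrightarrow> ap (ap succ_fst a) b = sc a"
proof -
  have k: "ap (ct (KPi Bn N)) (ct (KPi N N)) \<in> D (N \<^bold>\<rightarrow> Bn)" by (rule ap_type[OF const_type(3) const_type(3)])
  then show "succ_fst \<in> D Bn" unfolding succ_fst_def
    by (rule ap_type[OF ap_type[OF const_type(4)] const_type(2)])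
  assume a: "a \<in> D N" "b \<in> D N"
  have "ap succ_fst a = ap (ct (KPi N N)) (sc a)"
    unfolding succ_fst_def using sigma_eq[OF k const_type(2) a(1)] pi_eq[OF const_type(3) a(1)] by simp
  then show "ap (ap succ_fst a) b = sc a" using a by (simp add: pi_eq)
qed

definition "pls a b = recr b a succ_fst"

lemma pls_type [intro, simp]: "a \<in> D N \<Longrightarrow> b \<in> D N \<Longrightarrow> pls a b \<in> D N"
  unfolding pls_def using succ_fst(1) by (intro recr_type)

lemma pls_zero: "a \<in> D N \<Longrightarrow> pls a zr = a"
  unfolding pls_def by (simp add: rec_zero succ_fst)

lemma pls_succ: "a \<in> D N \<Longrightarrow> b \<in> D N \<Longrightarrow> pls a (sc b) = sc (pls a b)"
  unfolding pls_def using succ_fst by (simp add: rec_succ recr_type)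

lemma rep_pls: "rep cs N F \<Longrightarrow> rep cs N G \<Longrightarrow> rep cs N (\<lambda>e. pls (F e) (G e))"
  unfolding pls_def using succ_fst(1) by (intro rep_recr rep_const)

lemma rep_sc: "rep cs N F \<Longrightarrow> rep cs N (\<lambda>e. sc (F e))"
  by (rule rep_app[OF rep_const[OF const_type(2)]])

definition "times_step a = ap (ap (ct (KSig N N Pt)) (ap (ct (KPi Bn N)) (ct (KPi N N))))
  (ap (ap (ct (KSig N Bn N)) (ap (ap (ct (KSig N N (Bn \<^bold>\<rightarrow> N))) (ct Rec)) (ap (ct (KPi N N)) a)))
    (ap (ct (KPi Bn N)) succ_fst))"

lemma times_step: 
  assumes a: "a \<in> D N"
  shows "times_step a \<in> D Bn" "b \<in> D N \<Longrightarrow> c \<in> D N \<Longrightarrow> ap (ap (times_step a) b) c = pls a b"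
proof -
  define s where "s = ap (ct (KPi Bn N)) succ_fst"
  define r where "r = ap (ap (ct (KSig N N (Bn \<^bold>\<rightarrow> N))) (ct Rec)) (ap (ct (KPi N N)) a)"
  define u where "u = ap (ap (ct (KSig N Bn N)) r) s"
  define k where "k = ap (ct (KPi Bn N)) (ct (KPi N N))"
  have ka: "ap (ct (KPi N N)) a \<in> D Pt" by (rule ap_type[OF const_type(3) a])
  have s: "s \<in> D (N \<^bold>\<rightarrow> Bn)" unfolding s_def by (rule ap_type[OF const_type(3) succ_fst(1)])
  have "ap (ct (KSig N N (Bn \<^bold>\<rightarrow> N))) (ct Rec) \<in> D (Pt \<^bold>\<rightarrow> N \<^bold>\<rightarrow> Bn \<^bold>\<rightarrow> N)"
    by (rule ap_type[OF const_type(4) const_type(5)])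
  then have r: "r \<in> D (N \<^bold>\<rightarrow> Bn \<^bold>\<rightarrow> N)" unfolding r_def using ka by (rule ap_type)
  have u: "u \<in> D Pt" unfolding u_def by (rule ap_type[OF ap_type[OF const_type(4) r] s])
  have k: "k \<in> D (N \<^bold>\<rightarrow> Bn)" unfolding k_def by (rule ap_type[OF const_type(3) const_type(3)])
  have ts: "times_step a = ap (ap (ct (KSig N N Pt)) k) u"
    unfolding times_step_def u_def r_def s_def k_def ..
  show "times_step a \<in> D Bn" unfolding ts by (rule ap_type[OF ap_type[OF const_type(4) k] u])
  assume b: "b \<in> D N" "c \<in> D N"
  have ub: "ap u b \<in> D N" by (rule ap_type[OF u b(1)])
  have "ap (ap (times_step a) b) c = ap u b"
    unfolding ts sigma_eq[OF k u b(1)] using pi_eq[OF const_type(3) b(1)] ub b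
    by (simp add: k_def pi_eq)
  also have "\<dots> = ap (ap (ap (ct Rec) b) a) succ_fst"
    unfolding u_def sigma_eq[OF r s b(1)] 
    using sigma_eq[OF const_type(5) ka b(1)] a b succ_fst by (simp add: r_def s_def pi_eq)
  finally show "ap (ap (times_step a) b) c = pls a b" by (simp add: pls_def)
qed

definition "tms a b = recr b zr (times_step a)"

lemma tms_type [intro, simp]: "a \<in> D N \<Longrightarrow> b \<in> D N \<Longrightarrow> tms a b \<in> D N"
  unfolding tms_def using times_step(1) by (intro recr_type) auto

lemma tms_zero: "a \<in> D N \<Longrightarrow> tms a zr = zr"
  unfolding tms_def by (simp add: rec_zero times_step)

lemma tms_succ: "a \<in> D N \<Longrightarrow> b \<in> D N \<Longrightarrow> tms a (sc b) = pls a (tms a b)"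
  using tms_type[of a b] unfolding tms_def by (simp add: rec_succ times_step)

lemma val_Plus: "val ap ct e (Plus s t) = pls (val ap ct e s) (val ap ct e t)"
  by (simp add: Plus_def pls_def Succ_fst_def succ_fst_def)

lemma rep_times_step: "rep cs N F \<Longrightarrow> rep cs Bn (\<lambda>e. times_step (F e))"
  unfolding times_step_def
  by (intro rep_app[OF rep_const[OF ap_type[OF const_type(4) ap_type[OF const_type(3) const_type(3)]]]]
      rep_app[OF rep_app[OF rep_const[OF const_type(4)]
          rep_app[OF rep_const[OF ap_type[OF const_type(4) const_type(5)]] rep_app[OF rep_const[OF const_type(3)]]]]
        rep_const[OF ap_type[OF const_type(3) succ_fst(1)]]])

lemma rep_tms: "rep cs N F \<Longrightarrow> rep cs N G \<Longrightarrow> rep cs N (\<lambda>e. tms (F e) (G e))"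
  unfolding tms_def by (intro rep_recr rep_times_step rep_const const_type)

lemma val_Times: "val ap ct e (Times s t) = tms (val ap ct e s) (val ap ct e t)"
  by (simp add: Times_def tms_def times_step_def Succ_fst_def succ_fst_def)

text \<open>The predecessor: the step returns its second argument, the index of the recursion, so
  the value at \<open>sc a\<close> is \<open>a\<close>.\<close>

definition "prd a = recr a zr (ap (ct (KPi Pt N)) (iota N))"

lemma prd_step: "ap (ct (KPi Pt N)) (iota N) \<in> D Bn"
  by (rule ap_type[OF const_type(3) iota(1)])

lemma prd_type: "a \<in> D N \<Longrightarrow> prd a \<in> D N"
  unfolding prd_def using prd_step by (intro recr_type) auto

lemma prd_sc: "a \<in> D N \<Longrightarrow> prd (sc a) = a"
  using prd_type[of a] unfolding prd_def by (simp add: rec_succ prd_step pi_eq iota)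

lemma rep_prd: "rep cs N F \<Longrightarrow> rep cs N (\<lambda>e. prd (F e))"
  unfolding prd_def using prd_step by (intro rep_recr rep_const) auto

lemma rep_num: "i < length cs \<Longrightarrow> cs ! i = N \<Longrightarrow> rep cs N (\<lambda>e. e i)"
  by (rule rep_var) auto

definition "prd_fst = (SOME f. f \<in> D Bn \<and> (\<forall>a\<in>D N. \<forall>b\<in>D N. ap (ap f a) b = prd a))"

lemma prd_fst: "prd_fst \<in> D Bn" "a \<in> D N \<Longrightarrow> b \<in> D N \<Longrightarrow> ap (ap prd_fst a) b = prd a"
proof -
  have "rep [N, N] N (\<lambda>e. prd (e 1))" by (intro rep_prd rep_num) auto
  then obtain f where "f \<in> D Bn" "\<And>a b. a \<in> D N \<Longrightarrow> b \<in> D N \<Longrightarrow> ap (ap f a) b = prd a"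
    using rep_elem2[of N N N "\<lambda>a b. prd a"] by blast
  then have "\<exists>f. f \<in> D Bn \<and> (\<forall>a\<in>D N. \<forall>b\<in>D N. ap (ap f a) b = prd a)" by blast
  from someI_ex[OF this, folded prd_fst_def]
  show "prd_fst \<in> D Bn" "a \<in> D N \<Longrightarrow> b \<in> D N \<Longrightarrow> ap (ap prd_fst a) b = prd a" by blast+
qed

text \<open>Truncated subtraction: the predecessor is applied \<open>b\<close> times to
  \<open>a\<close>. Its purpose is to decide equality.\<close>

definition "mon a b = recr b a prd_fst"

lemma mon_type [intro, simp]: "a \<in> D N \<Longrightarrow> b \<in> D N \<Longrightarrow> mon a b \<in> D N"
  unfolding mon_def using prd_fst(1) by (intro recr_type)

lemma mon_zero: "a \<in> D N \<Longrightarrow> mon a zr = a"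
  unfolding mon_def by (simp add: rec_zero prd_fst)

lemma mon_sc: "a \<in> D N \<Longrightarrow> b \<in> D N \<Longrightarrow> mon a (sc b) = prd (mon a b)"
  using mon_type[of a b] unfolding mon_def by (simp add: rec_succ prd_fst)

lemma rep_mon: "rep cs N F \<Longrightarrow> rep cs N G \<Longrightarrow> rep cs N (\<lambda>e. mon (F e) (G e))"
  unfolding mon_def using prd_fst(1) by (intro rep_recr rep_const)

lemmas rep_arith = rep_pls rep_mon rep_prd rep_sc rep_const const_type rep_num

lemma zero_pls: "a \<in> D N \<Longrightarrow> pls zr a = a"
  by (rule induct_eq[where F = "\<lambda>a. pls zr a" and G = "\<lambda>a. a"])
    (auto intro!: rep_arith simp: pls_zero pls_succ)

lemma sc_pls: "a \<in> D N \<Longrightarrow> b \<in> D N \<Longrightarrow> pls (sc a) b = sc (pls a b)"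
  by (rule induct_eq[where F = "\<lambda>b. pls (sc a) b" and G = "\<lambda>b. sc (pls a b)"])
    (auto intro!: rep_arith simp: pls_zero pls_succ)

lemma mon_sc_sc: "a \<in> D N \<Longrightarrow> b \<in> D N \<Longrightarrow> mon (sc a) (sc b) = mon a b"
  by (rule induct_eq[where F = "\<lambda>b. mon (sc a) (sc b)" and G = "\<lambda>b. mon a b"])
    (auto intro!: rep_arith simp: mon_zero mon_sc prd_sc)

lemma mon_pls: "a \<in> D N \<Longrightarrow> b \<in> D N \<Longrightarrow> mon (pls a b) a = b"
  by (rule induct_eq[where F = "\<lambda>a. mon (pls a b) a" and G = "\<lambda>a. b"])
    (auto intro!: rep_arith simp: mon_zero zero_pls sc_pls mon_sc_sc)

lemma num_cases: "a \<in> D N \<Longrightarrow> a = zr \<or> a = sc (prd a)"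
  by (rule induct2[where F = "\<lambda>a. a" and G = "\<lambda>a. zr" and F' = "\<lambda>a. a" and G' = "\<lambda>a. sc (prd a)"])
    (auto intro!: rep_arith simp: prd_sc)

text \<open>This is linearity of the order expressed without quantifiers, in the shape that
  \<open>induct2\<close> accepts.\<close>

lemma pls_mon_cases:
  assumes b: "b \<in> D N" and "a \<in> D N"
  shows "pls a (mon b a) = b \<or> pls b (mon a b) = a"
proof (rule induct2[where F = "\<lambda>a. pls a (mon b a)" and G = "\<lambda>a. b"
      and F' = "\<lambda>a. pls b (mon a b)" and G' = "\<lambda>a. a"])
  fix n assume n: "n \<in> D N" and *: "pls n (mon b n) = b \<or> pls b (mon n b) = n"
  from * show "pls (sc n) (mon b (sc n)) = b \<or> pls b (mon (sc n) b) = sc n"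
  proof
    assume 1: "pls n (mon b n) = b"
    show ?thesis
    proof (cases "mon b n = zr")
      case True
      \<comment> \<open>Here \<open>n + 1\<close> exceeds \<open>b\<close> by one, so the second
        alternative takes over.\<close>
      then have "b = n" using 1 n by (simp add: pls_zero)
      moreover have "mon (pls b (sc zr)) b = sc zr" using b by (intro mon_pls) auto
      ultimately show ?thesis using b by (simp add: pls_zero pls_succ)
    next
      case False
      then have "mon b n = sc (prd (mon b n))" using num_cases b n by auto
      then have "pls (sc n) (prd (mon b n)) = b"
        using 1 n b prd_type[of "mon b n"] pls_succ[of n "prd (mon b n)"] by (simp add: sc_pls)
      then show ?thesis using b n by (simp add: mon_sc)
    qed
  next
    assume 2: "pls b (mon n b) = n"
    have "mon (pls b (sc (mon n b))) b = sc (mon n b)" using b n by (intro mon_pls) auto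
    moreover have "pls b (sc (mon n b)) = sc n" using 2 b n by (simp add: pls_succ)
    ultimately show ?thesis by simp
  qed
qed (use assms in \<open>auto intro!: rep_arith simp: mon_zero zero_pls\<close>)

text \<open>Equality becomes two tests for zero: if both differences vanish, either alternative of
  \<open>pls_mon_cases\<close> yields \<open>a = b\<close>.\<close>

lemma eq_iff_mon: "a \<in> D N \<Longrightarrow> b \<in> D N \<Longrightarrow> a = b \<longleftrightarrow> mon a b = zr \<and> mon b a = zr"
  using pls_mon_cases[of b a] mon_pls[of a zr] by (auto simp: pls_zero)

text \<open>Definition by cases is a recursion on \<open>F\<close> whose step ignores both arguments
  and returns \<open>H\<close>.\<close>

lemma rep_if_zero:
  assumes "rep cs N F" "rep cs N G" "rep cs N H"
  shows "rep cs N (\<lambda>e. if F e = zr then G e else H e)"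
proof (rule rep_cong)
  let ?k = "\<lambda>c. ap (ct (KPi Pt N)) (ap (ct (KPi N N)) c)"
  show "rep cs N (\<lambda>e. recr (F e) (G e) (?k (H e)))"
    by (rule rep_recr[OF assms(1,2) rep_app[OF rep_const[OF const_type(3)]
            rep_app[OF rep_const[OF const_type(3)] assms(3)]]])
  fix e assume e: "typed cs e"
  have n: "F e \<in> D N" "G e \<in> D N" "H e \<in> D N" using assms e by (auto intro: rep_type)
  have k1: "ap (ct (KPi N N)) (H e) \<in> D Pt" by (rule ap_type[OF const_type(3) n(3)])
  have k: "?k (H e) \<in> D Bn" by (rule ap_type[OF const_type(3) k1])
  have "recr (sc a) (G e) (?k (H e)) = H e" if "a \<in> D N" for a
    using that n k k1 by (simp add: rec_succ pi_eq recr_type)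
  then show "(if F e = zr then G e else H e) = recr (F e) (G e) (?k (H e))"
    using num_cases[OF n(1)] prd_type[OF n(1)] rec_zero[OF n(2) k] by metis
qed

lemma rep_if_eq:
  assumes "rep cs N S" "rep cs N T" "rep cs N G" "rep cs N H"
  shows "rep cs N (\<lambda>e. if S e = T e then G e else H e)"
proof (rule rep_cong)
  show "rep cs N (\<lambda>e. if mon (S e) (T e) = zr then if mon (T e) (S e) = zr then G e else H e else H e)"
    by (intro rep_if_zero rep_mon assms)
  fix e assume e: "typed cs e"
  have "S e \<in> D N" "T e \<in> D N" using assms e by (auto intro: rep_type)
  from eq_iff_mon[OF this] show "(if S e = T e then G e else H e) =
      (if mon (S e) (T e) = zr then if mon (T e) (S e) = zr then G e else H e else H e)"
    by simp
qed

section \<open>Characteristic functions and the search operator\<close>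

abbreviation "on \<equiv> sc zr"

definition repb :: "ty list \<Rightarrow> ((nat \<Rightarrow> 'a) \<Rightarrow> bool) \<Rightarrow> bool" where
  "repb cs P \<longleftrightarrow> rep cs N (\<lambda>e. if P e then on else zr)"

lemma repb_cong: "repb cs P \<Longrightarrow> (\<And>e. typed cs e \<Longrightarrow> Q e = P e) \<Longrightarrow> repb cs Q"
  unfolding repb_def by (erule rep_cong) simp

lemma repb_eq: "rep cs N S \<Longrightarrow> rep cs N T \<Longrightarrow> repb cs (\<lambda>e. S e = T e)"
  unfolding repb_def by (intro rep_if_eq rep_const) auto

lemma rep_if:
  assumes "repb cs P" "rep cs N G" "rep cs N H"
  shows "rep cs N (\<lambda>e. if P e then G e else H e)"
proof (rule rep_cong)
  show "rep cs N (\<lambda>e. if (if P e then on else zr) = zr then H e else G e)"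
    using assms unfolding repb_def by (intro rep_if_zero)
qed (use succ_neq[of zr] in auto)

lemma repb_False: "repb cs (\<lambda>_. False)"
  unfolding repb_def by auto

lemma repb_imp:
  assumes "repb cs P" "repb cs Q" shows "repb cs (\<lambda>e. P e \<longrightarrow> Q e)"
  unfolding repb_def
proof (rule rep_cong)
  show "rep cs N (\<lambda>e. if P e then if Q e then on else zr else on)"
    using assms by (intro rep_if rep_const) auto
qed auto

definition "mu = (SOME m. m \<in> D (Pt \<^bold>\<rightarrow> N) \<and>
  (\<forall>f \<in> D Pt. (\<exists>n \<in> D N. ap f n = zr) \<longrightarrow> ap f (ap m f) = zr))"

lemma mu: "mu \<in> D (Pt \<^bold>\<rightarrow> N)"
  "f \<in> D Pt \<Longrightarrow> n \<in> D N \<Longrightarrow> ap f n = zr \<Longrightarrow> ap f (ap mu f) = zr"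
proof -
  have "\<exists>m. m \<in> D (Pt \<^bold>\<rightarrow> N) \<and> (\<forall>f \<in> D Pt. (\<exists>n \<in> D N. ap f n = zr) \<longrightarrow> ap f (ap m f) = zr)"
    using search by (simp only: Bex_def)
  from someI_ex[OF this, folded mu_def]
  show "mu \<in> D (Pt \<^bold>\<rightarrow> N)" "f \<in> D Pt \<Longrightarrow> n \<in> D N \<Longrightarrow> ap f n = zr \<Longrightarrow> ap f (ap mu f) = zr"
    by blast+
qed

text \<open>\<open>F'\<close> is zero exactly at counterexamples, so its value at the number found
  by \<open>mu\<close> is \<open>on\<close> exactly if there is none. The quantifier becomes an
  application.\<close>

lemma repb_all:
  assumes "repb (N # cs) P" shows "repb cs (\<lambda>e. \<forall>n\<in>D N. P (case_nat n e))"
proof -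
  obtain F' where F': "rep cs Pt F'" "\<And>e a. typed cs e \<Longrightarrow> a \<in> D N \<Longrightarrow>
      ap (F' e) a = (if P (case_nat a e) then on else zr)"
    using rep_lam[OF assms[unfolded repb_def]] by blast
  show ?thesis
    unfolding repb_def
  proof (rule rep_cong)
    show "rep cs N (\<lambda>e. ap (F' e) (ap mu (F' e)))"
      by (rule rep_app[OF F'(1) rep_app[OF rep_const[OF mu(1)] F'(1)]])
    fix e assume e: "typed cs e"
    then have f: "F' e \<in> D Pt" using F'(1) rep_type by blast
    then have m: "ap mu (F' e) \<in> D N" using mu(1) by (auto intro: ap_type)
    show "(if \<forall>n\<in>D N. P (case_nat n e) then on else zr) = ap (F' e) (ap mu (F' e))"
    proof (cases "\<forall>n\<in>D N. P (case_nat n e)")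
      case True
      then show ?thesis using F'(2)[OF e m] m by simp
    next
      case False
      then obtain n where n: "n \<in> D N" "\<not> P (case_nat n e)" by blast
      then have "ap (F' e) (ap mu (F' e)) = zr" using F'(2)[OF e n(1)] mu(2)[OF f n(1)] by simp
      then show ?thesis using False by auto
    qed
  qed
qed

text \<open>Here zero marks the points where \<open>P\<close> holds, so that \<open>mu\<close> finds
  the unique one.\<close>

lemma rep_unique:
  assumes "repb (N # cs) P" "\<And>e. typed cs e \<Longrightarrow> \<exists>!n. n \<in> D N \<and> P (case_nat n e)"
  shows "rep cs N (\<lambda>e. THE n. n \<in> D N \<and> P (case_nat n e))"
proof -
  have "rep (N # cs) N (\<lambda>e. if P e then zr else on)"
    by (intro rep_if assms rep_const) auto
  from rep_lam[OF this] obtain F' where F': "rep cs Pt F'" "\<And>e a. typed cs e \<Longrightarrow> a \<in> D N \<Longrightarrow>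
      ap (F' e) a = (if P (case_nat a e) then zr else on)"
    by metis
  show ?thesis
  proof (rule rep_cong)
    show "rep cs N (\<lambda>e. ap mu (F' e))" by (rule rep_app[OF rep_const[OF mu(1)] F'(1)])
    fix e assume e: "typed cs e"
    then have f: "F' e \<in> D Pt" using F'(1) rep_type by blast
    then have m: "ap mu (F' e) \<in> D N" using mu(1) by (auto intro: ap_type)
    obtain n where n: "n \<in> D N" "P (case_nat n e)" using assms(2)[OF e] by blast
    have "P (case_nat (ap mu (F' e)) e)"
      using F'(2)[OF e m] F'(2)[OF e n(1)] mu(2)[OF f n(1)] n m succ_neq[of zr] by (auto split: if_splits)
    then show "(THE n. n \<in> D N \<and> P (case_nat n e)) = ap mu (F' e)"
      using m assms(2)[OF e] by (intro the1_equality) auto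
  qed
qed

lemma rep_val:
  assumes "has_ty t \<rho>" "\<And>x \<sigma>. (x, \<sigma>) \<in> tvars t \<Longrightarrow> rep cs \<sigma> (\<lambda>e. a e (x, \<sigma>))"
  shows "rep cs \<rho> (\<lambda>e. val ap ct (a e) t)"
  using assms
proof (induction t arbitrary: \<rho>)
  case (App s t)
  then obtain \<sigma> where st: "has_ty s (\<sigma> \<^bold>\<rightarrow> \<rho>)" "has_ty t \<sigma>" by auto
  have "rep cs (\<sigma> \<^bold>\<rightarrow> \<rho>) (\<lambda>e. val ap ct (a e) s)" "rep cs \<sigma> (\<lambda>e. val ap ct (a e) t)"
    using App.IH(1)[OF st(1)] App.IH(2)[OF st(2)] App.prems(2) by auto
  then show ?case unfolding val.simps by (rule rep_app)
qed auto

primrec num_quant :: "fm \<Rightarrow> bool" where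
  "num_quant (s \<^bold>= t) = True"
| "num_quant Fls = True"
| "num_quant (p \<^bold>\<longrightarrow> q) = (num_quant p \<and> num_quant q)"
| "num_quant (Forall x \<rho> p) = (\<rho> = N \<and> num_quant p)"

text \<open>Arithmetical comprehension with parameters of all types: \<open>repb_all\<close> turns
  each number quantifier into a search.\<close>

lemma repb_sat:
  assumes "wf_fm p" "num_quant p" "\<And>x \<sigma>. (x, \<sigma>) \<in> fvars p \<Longrightarrow> rep cs \<sigma> (\<lambda>e. a e (x, \<sigma>))"
  shows "repb cs (\<lambda>e. sat D ap ct (=) (a e) p)"
  using assms
proof (induction p arbitrary: cs a)
  case (Eq s t)
  then show ?case by (auto intro!: repb_eq rep_val)
next
  case (Forall x \<rho> p)
  let ?a = "\<lambda>e. (a (\<lambda>i. e (Suc i)))((x, N) := e 0)"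
  have "repb (N # cs) (\<lambda>e. sat D ap ct (=) (?a e) p)"
  proof (rule Forall.IH)
    fix y \<sigma> assume y: "(y, \<sigma>) \<in> fvars p"
    show "rep (N # cs) \<sigma> (\<lambda>e. ?a e (y, \<sigma>))"
    proof (cases "(y, \<sigma>) = (x, N)")
      case True
      then show ?thesis using rep_var[of 0 "N # cs" N] by simp
    next
      case False
      then have "rep cs \<sigma> (\<lambda>e. a e (y, \<sigma>))" using y Forall.prems by auto
      from rep_shift[OF this, of N] show ?thesis using False by auto
    qed
  qed (use Forall.prems in auto)
  from repb_all[OF this] show ?case using Forall.prems by simp
qed (auto intro: repb_False repb_imp)

end

section \<open>Arithmetic in models\<close>

locale arith_ops =
  fixes zero :: 'n and suc :: "'n \<Rightarrow> 'n" and plus times :: "'n \<Rightarrow> 'n \<Rightarrow> 'n"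
begin

inductive art :: "((nat \<Rightarrow> 'n) \<Rightarrow> 'n) \<Rightarrow> bool" where
  art_var: "art (\<lambda>e. e i)"
| art_const: "art (\<lambda>_. c)"
| art_suc: "art s \<Longrightarrow> art (\<lambda>e. suc (s e))"
| art_plus: "art s \<Longrightarrow> art t \<Longrightarrow> art (\<lambda>e. plus (s e) (t e))"
| art_times: "art s \<Longrightarrow> art t \<Longrightarrow> art (\<lambda>e. times (s e) (t e))"

definition lt :: "'n \<Rightarrow> 'n \<Rightarrow> bool" where
  "lt a b \<longleftrightarrow> (\<exists>d. plus a (suc d) = b)"

text \<open>Unlike Cantor's pairing this needs no halving, so it is a term of the language. It is
  injective because \<open>a\<close> stays below the gap between the square of \<open>a + b\<close>
  and the next square.\<close>

definition pair :: "'n \<Rightarrow> 'n \<Rightarrow> 'n" where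
  "pair a b = plus (times (plus a b) (plus a b)) a"

definition dv :: "'n \<Rightarrow> 'n \<Rightarrow> bool" where
  "dv a b \<longleftrightarrow> (\<exists>c. b = times a c)"

definition modulus :: "'n \<Rightarrow> 'n \<Rightarrow> 'n" where
  "modulus d x = suc (times (suc x) d)"

text \<open>Finite sets are coded as in Goedel's beta function; this makes iteration arithmetical.\<close>

definition mem :: "'n \<Rightarrow> 'n \<Rightarrow> 'n \<Rightarrow> 'n \<Rightarrow> bool" where
  "mem b c d x \<longleftrightarrow> lt x b \<and> dv (modulus d x) c"

lemma art_subst: "art s \<Longrightarrow> (\<And>i. art (t i)) \<Longrightarrow> art (\<lambda>e. s (\<lambda>i. t i e))"
  by (induction rule: art.induct) (auto intro: art.intros)

lemma art_pair: "art s \<Longrightarrow> art t \<Longrightarrow> art (\<lambda>e. pair (s e) (t e))"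
  unfolding pair_def by (intro art.intros)

end

text \<open>\<open>df P\<close> says that \<open>P\<close> is arithmetical in parameters of the model, with de Bruijn variables
  for numbers.\<close>

locale arith_model = arith_ops zero suc plus times
  for zero :: 'n and suc :: "'n \<Rightarrow> 'n" and plus times :: "'n \<Rightarrow> 'n \<Rightarrow> 'n" +
  fixes df :: "((nat \<Rightarrow> 'n) \<Rightarrow> bool) \<Rightarrow> bool"
  assumes suc_neq_zero: "suc a \<noteq> zero"
    and suc_inject: "suc a = suc b \<Longrightarrow> a = b"
    and plus_zero: "plus a zero = a"
    and plus_suc: "plus a (suc b) = suc (plus a b)"
    and times_zero: "times a zero = zero"
    and times_suc: "times a (suc b) = plus a (times a b)"
    and df_eq01: "df (\<lambda>e. e 0 = e 1)"
    and df_False: "df (\<lambda>_. False)"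
    and df_imp: "df P \<Longrightarrow> df Q \<Longrightarrow> df (\<lambda>e. P e \<longrightarrow> Q e)"
    and df_all_case: "df P \<Longrightarrow> df (\<lambda>e. \<forall>n. P (case_nat n e))"
    and df_subst: "df P \<Longrightarrow> (\<And>i. art (t i)) \<Longrightarrow> df (\<lambda>e. P (\<lambda>i. t i e))"
    and df_induct: "df (\<lambda>e. R (e 0)) \<Longrightarrow> R zero \<Longrightarrow> (\<And>n. R n \<Longrightarrow> R (suc n)) \<Longrightarrow> R n"
begin

lemma df_all: 
  assumes "df (\<lambda>e. P (\<lambda>i. e (Suc i)) (e 0))" shows "df (\<lambda>e. \<forall>n. P e n)"
  using df_all_case[OF assms] by simp

lemma df_eq: assumes "art s" "art t" shows "df (\<lambda>e. s e = t e)"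
  using df_subst[OF df_eq01, of "\<lambda>i. if i = 0 then s else t"] assms by simp

lemma df_not: "df P \<Longrightarrow> df (\<lambda>e. \<not> P e)"
  using df_imp[OF _ df_False] by simp

lemma df_or: "df P \<Longrightarrow> df Q \<Longrightarrow> df (\<lambda>e. P e \<or> Q e)"
  using df_imp[OF df_not, of P Q] by (simp add: imp_conv_disj)

lemma df_and: "df P \<Longrightarrow> df Q \<Longrightarrow> df (\<lambda>e. P e \<and> Q e)"
  using df_not[OF df_imp[OF _ df_not], of P Q] by simp

lemma df_iff: "df P \<Longrightarrow> df Q \<Longrightarrow> df (\<lambda>e. P e = Q e)"
  using df_and[OF df_imp[of P Q] df_imp[of Q P]] by (simp add: iff_conv_conj_imp)

lemma df_ex: "df (\<lambda>e. P (\<lambda>i. e (Suc i)) (e 0)) \<Longrightarrow> df (\<lambda>e. \<exists>n. P e n)"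
  using df_not[OF df_all[OF df_not], of P] by simp

lemma df_lt: "art s \<Longrightarrow> art t \<Longrightarrow> df (\<lambda>e. lt (s e) (t e))"
  unfolding lt_def by (intro df_ex df_eq art.intros) (erule art_subst, rule art.intros)+

lemmas art_intros = art.intros art_pair
lemmas df_intros = df_False df_imp df_and df_or df_not df_iff df_all df_ex df_lt df_eq

section \<open>Semiring laws, order, least elements and pairing\<close>

lemma plus_assoc: "plus (plus a b) c = plus a (plus b c)"
  by (rule df_induct[where R = "\<lambda>c. plus (plus a b) c = plus a (plus b c)"])
    (auto intro!: df_intros art_intros simp: plus_zero plus_suc)

lemma zero_plus: "plus zero a = a"
  by (rule df_induct[where R = "\<lambda>a. plus zero a = a"])
    (auto intro!: df_intros art_intros simp: plus_zero plus_suc)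

lemma suc_plus: "plus (suc a) b = suc (plus a b)"
  by (rule df_induct[where R = "\<lambda>b. plus (suc a) b = suc (plus a b)"])
    (auto intro!: df_intros art_intros simp: plus_zero plus_suc)

lemma plus_commute: "plus a b = plus b a"
  by (rule df_induct[where R = "\<lambda>a. plus a b = plus b a"])
    (auto intro!: df_intros art_intros simp: plus_zero plus_suc zero_plus suc_plus)

lemma plus_left_commute: "plus a (plus b c) = plus b (plus a c)"
  by (metis plus_assoc plus_commute)

lemmas plus_ac = plus_assoc plus_commute plus_left_commute

lemma zero_times: "times zero a = zero"
  by (rule df_induct[where R = "\<lambda>a. times zero a = zero"])
    (auto intro!: df_intros art_intros simp: times_zero times_suc zero_plus)

lemma suc_times: "times (suc a) b = plus b (times a b)"
  by (rule df_induct[where R = "\<lambda>b. times (suc a) b = plus b (times a b)"])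
    (auto intro!: df_intros art_intros simp: times_zero times_suc plus_zero suc_plus plus_suc plus_left_commute)

lemma times_commute: "times a b = times b a"
  by (rule df_induct[where R = "\<lambda>a. times a b = times b a"])
    (auto intro!: df_intros art_intros simp: times_zero times_suc zero_times suc_times)

lemma distrib_left: "times a (plus b c) = plus (times a b) (times a c)"
  by (rule df_induct[where R = "\<lambda>a. times a (plus b c) = plus (times a b) (times a c)"])
    (auto intro!: df_intros art_intros simp: zero_times suc_times plus_zero plus_ac)

lemma distrib_right: "times (plus b c) a = plus (times b a) (times c a)"
  by (metis distrib_left times_commute)

lemma times_assoc: "times (times a b) c = times a (times b c)"
  by (rule df_induct[where R = "\<lambda>c. times (times a b) c = times a (times b c)"])
    (auto intro!: df_intros art_intros simp: times_zero times_suc distrib_left)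

lemma times_left_commute: "times a (times b c) = times b (times a c)"
  by (metis times_assoc times_commute)

lemmas times_ac = times_assoc times_commute times_left_commute

lemma plus_left_cancel: "plus a b = plus a c \<longleftrightarrow> b = c"
proof
  show "plus a b = plus a c \<Longrightarrow> b = c"
    by (rule df_induct[where R = "\<lambda>a. plus a b = plus a c \<longrightarrow> b = c", THEN HOL.mp])
      (auto intro!: df_intros art_intros simp: zero_plus suc_plus dest: suc_inject)
qed simp

lemma zero_or_suc: "a = zero \<or> (\<exists>b. a = suc b)"
  by (rule df_induct[where R = "\<lambda>a. a = zero \<or> (\<exists>b. a = suc b)"])
    (auto intro!: df_intros art_intros)

lemma plus_eq_zero: "plus a b = zero \<longleftrightarrow> a = zero \<and> b = zero"
  using zero_or_suc[of b] by (auto simp: plus_zero plus_suc suc_neq_zero suc_neq_zero[symmetric])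

lemma not_lt_zero: "\<not> lt a zero"
  by (auto simp: lt_def plus_suc suc_neq_zero)

lemma lt_suc: "lt a (suc b) \<longleftrightarrow> lt a b \<or> a = b"
proof -
  have "lt a (suc b) \<longleftrightarrow> (\<exists>d. plus a d = b)" by (auto simp: lt_def plus_suc dest: suc_inject)
  also have "\<dots> \<longleftrightarrow> lt a b \<or> a = b"
    unfolding lt_def using zero_or_suc by (metis plus_zero)
  finally show ?thesis .
qed

lemma lt_trans: "lt a b \<Longrightarrow> lt b c \<Longrightarrow> lt a c"
  by (auto simp: lt_def plus_assoc suc_plus)

lemma lt_linear: "lt a b \<or> a = b \<or> lt b a"
proof (rule df_induct[where R = "\<lambda>a. lt a b \<or> a = b \<or> lt b a"])
  show "lt zero b \<or> zero = b \<or> lt b zero"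
    using zero_or_suc[of b] by (auto simp: lt_def zero_plus)
  fix n assume "lt n b \<or> n = b \<or> lt b n"
  then show "lt (suc n) b \<or> suc n = b \<or> lt b (suc n)"
  proof (elim disjE)
    assume "lt n b"
    then obtain d where d: "plus n (suc d) = b" by (auto simp: lt_def)
    then show ?thesis using zero_or_suc[of d] by (auto simp: lt_def plus_suc suc_plus plus_zero)
  qed (auto simp: lt_suc intro: lt_trans)
qed (intro df_intros art_intros)

lemma ex_least:
  assumes df: "df (\<lambda>e. R (e 0))" and R: "R n"
  obtains m where "R m" "\<And>k. lt k m \<Longrightarrow> \<not> R k"
proof -
  have dfR: "art t \<Longrightarrow> df (\<lambda>e. R (t e))" for t using df_subst[OF df, of "\<lambda>_. t"] by simp
  have "\<exists>m. R m \<and> (\<forall>k. lt k m \<longrightarrow> \<not> R k)"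
  proof (rule ccontr)
    assume neg: "\<not> ?thesis"
    have "\<forall>k. lt k n \<longrightarrow> \<not> R k"
      by (rule df_induct[where R = "\<lambda>n. \<forall>k. lt k n \<longrightarrow> \<not> R k"])
        (use neg in \<open>auto intro!: df_intros dfR art_intros simp: not_lt_zero lt_suc\<close>)
    then show False using R neg by blast
  qed
  then show ?thesis using that by blast
qed

text \<open>If \<open>a + b\<close> exceeds \<open>s = c + d\<close>, then \<open>pair a b\<close>
  is at least the square of \<open>s + 1\<close> and hence larger than the square of
  \<open>s\<close> plus \<open>c\<close>. So the sums are equal and their squares cancel.\<close>

lemma pair_inject: "pair a b = pair c d \<longleftrightarrow> a = c \<and> b = d"
proof
  assume eq: "pair a b = pair c d"
  have aux: False if "plus a b = plus (plus c d) (suc k)" "pair a b = pair c d" for a b c d k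
  proof -
    define s where "s = plus c d"
    define r where "r = plus (plus s k) (plus (times s (suc k)) (plus (times k (suc (plus s k))) a))"
    have "times (plus s (suc k)) (plus s (suc k)) = plus (times s s)
      (plus (times s (suc k)) (times (suc k) (plus s (suc k))))"
      by (simp add: distrib_right distrib_left plus_assoc plus_left_commute)
    also have "times (suc k) (plus s (suc k)) = plus (plus s (suc k)) (times k (suc (plus s k)))"
      by (simp add: suc_times plus_suc)
    finally have "pair a b = plus (times s s) (suc r)"
      unfolding pair_def that(1) s_def[symmetric] r_def by (simp add: plus_suc suc_plus plus_ac)
    then have "c = suc r"
      using that(2) unfolding pair_def s_def[symmetric] by (simp add: plus_left_cancel)
    also have "suc r = plus c (suc (plus d (plus k (plus (times s (suc k)) (plus (times k (suc (plus s k))) a)))))"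
      unfolding r_def by (simp add: plus_suc suc_plus plus_assoc s_def)
    finally show False
      using plus_left_cancel[of c zero] by (simp add: plus_zero suc_neq_zero[symmetric])
  qed
  have "plus a b = plus c d"
    using lt_linear[of "plus a b" "plus c d"] aux[of a b c d] aux[of c d a b] eq
    unfolding lt_def by metis
  then show "a = c \<and> b = d"
    using eq unfolding pair_def by (auto simp: plus_left_cancel)
qed simp

section \<open>Divisibility and codes of finite sets\<close>

lemma dv_times: "dv a b \<Longrightarrow> dv a (times b c)" "dv a b \<Longrightarrow> dv a (times c b)" "dv a (times a c)"
  by (auto simp: dv_def times_assoc) (metis times_left_commute)

lemma dv_plus_cancel:
  assumes "dv q u" "dv q (plus u v)" shows "dv q v"
proof -
  obtain x y where xy: "u = times q x" "plus u v = times q y" using assms by (auto simp: dv_def)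
  consider (le) w where "y = plus x w" | (gt) w where "x = plus y (suc w)"
    using lt_linear[of x y] by (auto simp: lt_def) (metis plus_zero)
  then show ?thesis
  proof cases
    case le
    then show ?thesis using xy by (auto simp: distrib_left plus_left_cancel dv_def)
  next
    case gt
    then have "plus (times q y) (plus (times q (suc w)) v) = plus (times q y) zero"
      using xy by (simp add: distrib_left plus_assoc plus_zero)
    then have "v = zero" by (simp add: plus_left_cancel plus_eq_zero)
    then show ?thesis by (auto simp: dv_def intro!: exI[of _ zero] simp: times_zero)
  qed
qed

text \<open>Both moduli are prime to \<open>d\<close>, and a suitable combination of them is their index difference,
  which divides \<open>d\<close>.\<close>

lemma modulus_coprime:
  assumes w: "dv (suc w) d" and xy: "x = plus y (suc w) \<or> y = plus x (suc w)"
    and q: "dv (modulus d y) (times (modulus d x) z)"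
  shows "dv (modulus d y) z"
proof -
  let ?q = "modulus d y" and ?p = "modulus d x"
  have wz: "dv ?q (times (suc w) z)"
    using xy
  proof
    assume x: "x = plus y (suc w)"
    have "times (suc x) (times ?q z) = plus (times (suc y) (times ?p z)) (times (suc w) z)"
    proof -
      have "plus (times (suc y) ?p) (suc w) = times (suc x) ?q"
        unfolding modulus_def x
        by (simp add: times_suc suc_times suc_plus plus_suc distrib_left distrib_right plus_ac times_ac)
      then show ?thesis by (metis distrib_right times_assoc)
    qed
    moreover have "dv ?q (times (suc x) (times ?q z))" "dv ?q (times (suc y) (times ?p z))"
      using q by (auto intro: dv_times)
    ultimately show ?thesis using dv_plus_cancel by metis
  next
    assume y: "y = plus x (suc w)"
    have "times (suc y) (times ?p z) = plus (times (suc x) (times ?q z)) (times (suc w) z)"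
    proof -
      have "plus (times (suc x) ?q) (suc w) = times (suc y) ?p"
        unfolding modulus_def y
        by (simp add: times_suc suc_times suc_plus plus_suc distrib_left distrib_right plus_ac times_ac)
      then show ?thesis by (metis distrib_right times_assoc)
    qed
    moreover have "dv ?q (times (suc x) (times ?q z))" "dv ?q (times (suc y) (times ?p z))"
      using q by (auto intro: dv_times)
    ultimately show ?thesis using dv_plus_cancel by metis
  qed
  obtain c where c: "d = times (suc w) c" using w by (auto simp: dv_def)
  \<comment> \<open>Multiplication by \<open>(suc y) c\<close> turns \<open>suc w\<close> into
    \<open>(suc y) d\<close>. As \<open>modulus d y\<close> is one more than this, subtracting
    leaves \<open>z\<close>.\<close>
  have "times (times (suc y) c) (times (suc w) z) = times (times (suc y) d) z"
    unfolding c by (simp add: times_ac)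
  then have "dv ?q (times (times (suc y) d) z)" using dv_times(2)[OF wz] by metis
  moreover have "plus (times (times (suc y) d) z) z = times ?q z"
    by (simp add: modulus_def suc_times plus_commute)
  ultimately show ?thesis using dv_plus_cancel dv_times(3) by metis
qed

lemma dv_suc_one: "dv q (suc zero) \<Longrightarrow> q = suc zero"
proof -
  assume "dv q (suc zero)"
  then obtain c where c: "suc zero = times q c" by (auto simp: dv_def)
  then obtain c' where c': "c = suc c'"
    using zero_or_suc[of c] by (auto simp: times_zero suc_neq_zero)
  obtain q' where q': "q = suc q'"
    using zero_or_suc[of q] c by (auto simp: zero_times suc_neq_zero)
  have "zero = plus q' (times (suc q') c')"
    using c unfolding c' q' times_suc[of "suc q'"] suc_plus by (rule suc_inject)
  then show "q = suc zero" using q' plus_eq_zero[of q' "times (suc q') c'"] by simp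
qed

lemma df_dv: "art s \<Longrightarrow> art t \<Longrightarrow> df (\<lambda>e. dv (s e) (t e))"
  unfolding dv_def by (intro df_intros art_intros) (erule art_subst, rule art.intros)+

lemma art_modulus: "art s \<Longrightarrow> art t \<Longrightarrow> art (\<lambda>e. modulus (s e) (t e))"
  unfolding modulus_def by (intro art_intros)

text \<open>Such a \<open>d\<close> replaces the factorial in Goedel's beta function; its existence
  is proved by induction, without a function defined by recursion.\<close>

lemma ex_common_multiple: "\<exists>d. d \<noteq> zero \<and> (\<forall>x. lt x b \<longrightarrow> dv (suc x) d)"
proof (rule df_induct[where R = "\<lambda>b. \<exists>d. d \<noteq> zero \<and> (\<forall>x. lt x b \<longrightarrow> dv (suc x) d)"])
  fix b assume "\<exists>d. d \<noteq> zero \<and> (\<forall>x. lt x b \<longrightarrow> dv (suc x) d)"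
  then obtain d where d: "d \<noteq> zero" "\<And>x. lt x b \<Longrightarrow> dv (suc x) d" by blast
  have "times d (suc b) \<noteq> zero" using d by (simp add: times_suc plus_eq_zero)
  then show "\<exists>d. d \<noteq> zero \<and> (\<forall>x. lt x (suc b) \<longrightarrow> dv (suc x) d)"
    using d by (intro exI[of _ "times d (suc b)"]) (auto simp: lt_suc times_commute[of d] intro: dv_times)
next
  show "\<exists>d. d \<noteq> zero \<and> (\<forall>x. lt x zero \<longrightarrow> dv (suc x) d)"
    using suc_neq_zero by (auto simp: not_lt_zero)
qed (intro df_intros df_dv art_intros)

text \<open>In the induction on \<open>n\<close>, \<open>c\<close> becomes the product of the moduli
  of those elements of \<open>S\<close> that lie below \<open>n\<close> and \<open>b\<close>.
  Coprimality ensures that a new factor puts no other index into the coded set.\<close>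

lemma ex_code:
  assumes df: "df (\<lambda>e. S (e 0))"
  obtains c d where "\<And>x. mem b c d x \<longleftrightarrow> lt x b \<and> S x"
proof -
  have dfS: "art t \<Longrightarrow> df (\<lambda>e. S (t e))" for t using df_subst[OF df, of "\<lambda>_. t"] by simp
  obtain d where d: "d \<noteq> zero" "\<And>x. lt x b \<Longrightarrow> dv (suc x) d" using ex_common_multiple by blast
  have cop: "dv (modulus d y) z"
    if "lt x b" "lt y b" "x \<noteq> y" "dv (modulus d y) (times (modulus d x) z)" for x y z
  proof -
    obtain w where w: "x = plus y (suc w) \<or> y = plus x (suc w)"
      using lt_linear[of x y] \<open>x \<noteq> y\<close> unfolding lt_def by metis
    \<comment> \<open>\<open>w\<close> lies below the larger of the two indices, so \<open>d\<close>
      was chosen divisible by \<open>suc w\<close>.\<close>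
    have "lt w b"
    proof -
      have "lt w (plus v (suc w))" for v by (auto simp: lt_def plus_suc plus_commute)
      then show ?thesis using w that lt_trans by metis
    qed
    then show ?thesis using modulus_coprime[OF d(2) w] that by blast
  qed
  have "\<exists>c. \<forall>x. lt x b \<longrightarrow> (dv (modulus d x) c \<longleftrightarrow> lt x n \<and> S x)" for n
  proof (rule df_induct[where R = "\<lambda>n. \<exists>c. \<forall>x. lt x b \<longrightarrow> (dv (modulus d x) c \<longleftrightarrow> lt x n \<and> S x)"])
    \<comment> \<open>The empty set is coded by 1. As \<open>d\<close> is not zero, every modulus
      differs from 1 and does not divide it.\<close>
    have "\<not> dv (modulus d x) (suc zero)" for x
    proof
      assume "dv (modulus d x) (suc zero)"
      then have "times (suc x) d = zero" using dv_suc_one suc_inject unfolding modulus_def by blast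
      then show False using d by (simp add: suc_times plus_eq_zero)
    qed
    then show "\<exists>c. \<forall>x. lt x b \<longrightarrow> (dv (modulus d x) c \<longleftrightarrow> lt x zero \<and> S x)"
      by (auto simp: not_lt_zero)
  next
    fix n assume "\<exists>c. \<forall>x. lt x b \<longrightarrow> (dv (modulus d x) c \<longleftrightarrow> lt x n \<and> S x)"
    then obtain c where c: "\<And>x. lt x b \<Longrightarrow> dv (modulus d x) c \<longleftrightarrow> lt x n \<and> S x" by blast
    show "\<exists>c. \<forall>x. lt x b \<longrightarrow> (dv (modulus d x) c \<longleftrightarrow> lt x (suc n) \<and> S x)"
    proof (cases "S n \<and> lt n b")
      case True
      have "dv (modulus d x) (times (modulus d n) c) \<longleftrightarrow> lt x (suc n) \<and> S x" if "lt x b" for x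
        using True c[OF that] cop[of n x c] that dv_times(3) dv_times(2)[of "modulus d x" c]
        by (auto simp: lt_suc)
      then show ?thesis by blast
    next
      case False
      then show ?thesis using c by (intro exI[of _ c]) (auto simp: lt_suc)
    qed
  qed (intro df_intros df_dv dfS art_modulus art_intros)
  then obtain c where "\<And>x. lt x b \<Longrightarrow> dv (modulus d x) c \<longleftrightarrow> lt x b \<and> S x" by blast
  then show ?thesis using that[of c d] by (auto simp: mem_def)
qed

lemma df_mem: "art s \<Longrightarrow> art t \<Longrightarrow> art u \<Longrightarrow> art v \<Longrightarrow> df (\<lambda>e. mem (s e) (t e) (u e) (v e))"
  unfolding mem_def by (intro df_intros df_dv art_modulus art_intros)

end

section \<open>Descending paths and approximations to the hierarchy\<close>

context arith_ops
begin

text \<open>Least in the order of numbers, not in \<open>L\<close>: this is the device for choosing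
  an element definably.\<close>

definition "start S y \<longleftrightarrow> S y \<and> (\<forall>z. lt z y \<longrightarrow> \<not> S z)"

definition "next_below S L x y \<longleftrightarrow> start (\<lambda>z. S z \<and> L z x) y"

text \<open>A code is a finite set of pairs \<open>(j, x)\<close>, meaning that the path is at
  \<open>x\<close> after \<open>j\<close> steps. Every entry is justified by an entry one step
  earlier, so new entries can be added at the end.\<close>

definition "path_code S L b c d \<longleftrightarrow> (\<forall>j x. mem b c d (pair j x) \<longrightarrow>
     j = zero \<and> start S x \<or> (\<exists>i y. j = suc i \<and> mem b c d (pair i y) \<and> next_below S L y x))"

definition "path S L k m \<longleftrightarrow> (\<exists>b c d. path_code S L b c d \<and> mem b c d (pair k m))"

text \<open>The default zero makes this a total function of \<open>k\<close> even where the path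
  ends.\<close>

definition "path_value S L k m \<longleftrightarrow> path S L k m \<or> (\<forall>n. \<not> path S L k n) \<and> m = zero"

definition "bad A L Gm g a \<longleftrightarrow> A a \<and> (\<exists>n. g (pair a n) \<noteq> Gm n (\<lambda>b m. g (pair b m) \<and> L b a))"

text \<open>Every minimal bad point is considered, since \<open>L\<close> is arbitrary at this
  stage; a total order has at most one. Without minimal bad points every number is a bound.\<close>

definition "bound A L Gm g m \<longleftrightarrow> (\<forall>a. bad A L Gm g a \<and> (\<forall>c. L c a \<longrightarrow> \<not> bad A L Gm g c) \<longrightarrow>
     (\<exists>n. lt (pair a n) m \<and> g (pair a n) \<noteq> Gm n (\<lambda>b m. g (pair b m) \<and> L b a)))"

text \<open>The second alternative keeps \<open>G\<close> total: for an arbitrary \<open>L\<close>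
  there may be infinitely many minimal bad points and hence no bound.\<close>

definition "least_bound A L Gm g m \<longleftrightarrow> start (bound A L Gm g) m \<or> (\<forall>k. \<not> bound A L Gm g k) \<and> m = zero"

text \<open>No index is selected: unless \<open>bottomless\<close> has an element, all indices that
  qualify compute the same row.\<close>

definition "glued A L Gm l gs b m \<longleftrightarrow> A b \<and> (\<exists>i. lt i l \<and> (\<forall>c. L c b \<longrightarrow> \<not> bad A L Gm (gs i) c) \<and>
     Gm m (\<lambda>b' m'. gs i (pair b' m') \<and> L b' b))"

text \<open>Each contributed set provides smaller elements of itself, and so does the union. Hence
  no particular index or pair of indices has to be singled out.\<close>

definition "bottomless A L Gm l gs x \<longleftrightarrow> A x \<and> (\<exists>i. lt i l \<and>
     (bad A L Gm (gs i) x \<and> (\<forall>y. bad A L Gm (gs i) y \<longrightarrow> (\<exists>z. L z y \<and> bad A L Gm (gs i) z)) \<or>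
      (\<exists>j. lt j l \<and> (\<exists>n. gs i (pair x n) \<noteq> gs j (pair x n)) \<and>
        (\<forall>c. c = x \<or> L c x \<longrightarrow> \<not> bad A L Gm (gs i) c \<and> \<not> bad A L Gm (gs j) c))))"

end

section \<open>Uniqueness and existence of descending paths\<close>

context arith_model
begin

lemma df_at: "df (\<lambda>e. P (e 0)) \<Longrightarrow> art t \<Longrightarrow> df (\<lambda>e. P (t e))"
  using df_subst[of "\<lambda>e. P (e 0)" "\<lambda>_. t"] by simp

lemma df_at2: "df (\<lambda>e. P (e 1) (e 0)) \<Longrightarrow> art s \<Longrightarrow> art t \<Longrightarrow> df (\<lambda>e. P (s e) (t e))"
  using df_subst[of "\<lambda>e. P (e 1) (e 0)" "\<lambda>i. if i = 0 then t else s"] by simp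

lemma start_unique: "start S x \<Longrightarrow> start S y \<Longrightarrow> x = y"
  unfolding start_def using lt_linear by blast

text \<open>Both runs are compared step by step; \<open>start\<close> and \<open>next_below\<close>
  determine at most one number each. The induction formula mentions the two codes but neither
  \<open>S\<close> nor \<open>L\<close>, so it is definable.\<close>

lemma path_unique:
  assumes "path S L k m" "path S L k n" shows "m = n"
proof -
  obtain b c d where 1: "path_code S L b c d" "mem b c d (pair k m)"
    using assms(1) by (auto simp: path_def)
  obtain b' c' d' where 2: "path_code S L b' c' d'" "mem b' c' d' (pair k n)"
    using assms(2) by (auto simp: path_def)
  have "\<forall>m n. mem b c d (pair k m) \<longrightarrow> mem b' c' d' (pair k n) \<longrightarrow> m = n"
  proof (rule df_induct[where R = "\<lambda>k. \<forall>m n. mem b c d (pair k m) \<longrightarrow> mem b' c' d' (pair k n) \<longrightarrow> m = n"])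
    show "\<forall>m n. mem b c d (pair zero m) \<longrightarrow> mem b' c' d' (pair zero n) \<longrightarrow> m = n"
    proof (intro allI impI)
      fix m n assume "mem b c d (pair zero m)" "mem b' c' d' (pair zero n)"
      then have "start S m" "start S n"
        using 1(1) 2(1) suc_neq_zero unfolding path_code_def by metis+
      then show "m = n" by (rule start_unique)
    qed
  next
    fix k assume IH: "\<forall>m n. mem b c d (pair k m) \<longrightarrow> mem b' c' d' (pair k n) \<longrightarrow> m = n"
    show "\<forall>m n. mem b c d (pair (suc k) m) \<longrightarrow> mem b' c' d' (pair (suc k) n) \<longrightarrow> m = n"
    proof (intro allI impI)
      fix m n assume "mem b c d (pair (suc k) m)" "mem b' c' d' (pair (suc k) n)"
      then obtain x y where "mem b c d (pair k x)" "next_below S L x m"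
          "mem b' c' d' (pair k y)" "next_below S L y n"
        using 1(1) 2(1) suc_neq_zero suc_inject unfolding path_code_def by metis
      then show "m = n" using IH start_unique unfolding next_below_def by metis
    qed
  qed (intro df_intros df_mem art_intros)
  then show ?thesis using 1 2 by blast
qed

lemma path_mem: assumes "path S L k m" shows "S m"
proof -
  have "start S m \<or> (\<exists>y. next_below S L y m)"
    using assms unfolding path_def path_code_def by metis
  then show ?thesis unfolding next_below_def start_def by blast
qed

lemma path_value_unique: "\<exists>!m. path_value S L k m"
  unfolding path_value_def using path_unique by metis

context
  fixes S :: "'n \<Rightarrow> bool" and L :: "'n \<Rightarrow> 'n \<Rightarrow> bool"
  assumes dfS': "df (\<lambda>e. S (e 0))" and dfL': "df (\<lambda>e. L (e 1) (e 0))"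
begin

lemmas dfS = df_at[OF dfS'] and dfL = df_at2[OF dfL']

lemma df_start: "art t \<Longrightarrow> df (\<lambda>e. start S (t e))"
  by (rule df_at) (auto simp: start_def intro!: df_intros dfS art_intros)

lemma df_next: "art s \<Longrightarrow> art t \<Longrightarrow> df (\<lambda>e. next_below S L (s e) (t e))"
  by (rule df_at2) (unfold next_below_def start_def, intro df_intros dfS dfL art_intros)

lemma df_path: "df (\<lambda>e. path S L (e 1) (e 0))"
  unfolding path_def path_code_def by (intro df_intros df_mem df_start df_next art_intros)

lemma df_path_value: "df (\<lambda>e. path_value S L (e 1) (e 0))"
  unfolding path_value_def by (intro df_intros df_at2[OF df_path] art_intros)

lemma path_step:
  assumes "path S L k m" "next_below S L m n" shows "path S L (suc k) n"
proof -
  obtain b c d where 1: "path_code S L b c d" "mem b c d (pair k m)"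
    using assms(1) by (auto simp: path_def)
  \<comment> \<open>This exceeds both \<open>b\<close>, below which the old entries lie, and the new
    entry.\<close>
  define B where "B = suc (plus b (pair (suc k) n))"
  define T where "T x \<longleftrightarrow> mem b c d x \<or> x = pair (suc k) n" for x
  have "df (\<lambda>e. T (e 0))" unfolding T_def by (intro df_intros df_mem art_intros)
  then obtain c' d' where "\<And>x. mem B c' d' x \<longleftrightarrow> lt x B \<and> T x" using ex_code by blast
  moreover have "lt x B" if "T x" for x
  proof -
    have "lt b B" unfolding B_def by (auto simp: lt_def plus_suc)
    moreover have "lt (pair (suc k) n) B" unfolding B_def lt_def
      by (intro exI[of _ b]) (simp add: plus_suc suc_plus plus_commute)
    ultimately show ?thesis using that lt_trans unfolding T_def mem_def by blast
  qed
  ultimately have code: "\<And>x. mem B c' d' x \<longleftrightarrow> T x" by blast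
  have "path_code S L B c' d'"
    using 1 assms(2) unfolding path_code_def code T_def pair_inject by blast
  then show ?thesis unfolding path_def using code T_def by blast
qed

lemma path_zero:
  assumes "start S m" shows "path S L zero m"
proof -
  define B where "B = suc (pair zero m)"
  define T where "T x \<longleftrightarrow> x = pair zero m" for x
  have "df (\<lambda>e. T (e 0))" unfolding T_def by (intro df_intros art_intros)
  then obtain c d where code: "\<And>x. mem B c d x \<longleftrightarrow> lt x B \<and> T x" using ex_code by blast
  have "lt (pair zero m) B" unfolding B_def by (simp add: lt_suc)
  then have "mem B c d x \<longleftrightarrow> x = pair zero m" for x using code T_def by blast
  then show ?thesis using assms unfolding path_def path_code_def by (metis pair_inject)
qed

text \<open>That some path has \<open>k\<close> steps is a definable statement, because paths are
  coded by numbers. So induction on \<open>k\<close> replaces a recursive construction of the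
  sequence.\<close>

lemma path_descends:
  assumes S: "S x" and no_least: "\<And>x. S x \<Longrightarrow> \<exists>y. S y \<and> L y x"
    and h: "\<And>k. path_value S L k (h k)"
  shows "S (h k) \<and> L (h (suc k)) (h k)"
proof -
  have nxt: "\<exists>y. next_below S L x y" if "S x" for x
  proof -
    from no_least[OF that] obtain y where y: "S y \<and> L y x" by blast
    have "df (\<lambda>e. S (e 0) \<and> L (e 0) x)" by (intro df_intros dfS dfL art_intros)
    then show ?thesis using ex_least[of "\<lambda>y. S y \<and> L y x"] y unfolding next_below_def start_def by metis
  qed
  have all: "\<exists>m. path S L k m" for k
  proof (rule df_induct[where R = "\<lambda>k. \<exists>m. path S L k m"])
    show "\<exists>m. path S L zero m" using ex_least[OF dfS' S] path_zero unfolding start_def by metis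
    show "\<exists>m. path S L k m \<Longrightarrow> \<exists>m. path S L (suc k) m" for k
      using path_mem nxt path_step by metis
  qed (rule df_ex, rule df_at2[OF df_path], (rule art_intros)+)
  then have hp: "path S L k (h k)" for k using h unfolding path_value_def by blast
  then obtain y where y: "next_below S L (h k) y" using nxt path_mem by blast
  have "h (suc k) = y" by (rule path_unique[OF hp path_step[OF hp y]])
  then show ?thesis using y path_mem[OF hp] unfolding next_below_def start_def by blast
qed

end

end

text \<open>\<open>Gm\<close> is an abstract operator on relations. The assumption
  \<open>dfG\<close>, that it preserves definability, is what remains of \<open>\<Gamma>\<close>
  being arithmetical.\<close>

locale hier_setting = arith_model zero suc plus times df
  for zero :: 'n and suc :: "'n \<Rightarrow> 'n" and plus times :: "'n \<Rightarrow> 'n \<Rightarrow> 'n"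
    and df :: "((nat \<Rightarrow> 'n) \<Rightarrow> bool) \<Rightarrow> bool" +
  fixes A :: "'n \<Rightarrow> bool" and L :: "'n \<Rightarrow> 'n \<Rightarrow> bool"
    and Gm :: "'n \<Rightarrow> ('n \<Rightarrow> 'n \<Rightarrow> bool) \<Rightarrow> bool" and gs :: "'n \<Rightarrow> 'n \<Rightarrow> bool"
  assumes dfA: "art t \<Longrightarrow> df (\<lambda>e. A (t e))"
    and dfL: "art s \<Longrightarrow> art t \<Longrightarrow> df (\<lambda>e. L (s e) (t e))"
    and dfg: "art s \<Longrightarrow> art t \<Longrightarrow> df (\<lambda>e. gs (s e) (t e))"
    and dfG: "art t \<Longrightarrow> df (\<lambda>e. R (\<lambda>i. e (Suc (Suc i))) (e (Suc 0)) (e 0)) \<Longrightarrow>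
      df (\<lambda>e. Gm (t e) (\<lambda>b m. R e b m))"
begin

abbreviation "bd i a \<equiv> bad A L Gm (gs i) a"
abbreviation "rel i a \<equiv> (\<lambda>b m. gs i (pair b m) \<and> L b a)"
abbreviation "DD l \<equiv> bottomless A L Gm l gs"
abbreviation "YY l \<equiv> glued A L Gm l gs"

lemma df_rel: "art s \<Longrightarrow> art t \<Longrightarrow> art u \<Longrightarrow> df (\<lambda>e. Gm (s e) (rel (t e) (u e)))"
proof -
  assume *: "art s" "art t" "art u"
  have "df (\<lambda>e. Gm (e 0) (rel (e 1) (e 2)))" by (intro dfG df_and dfg dfL art_intros)
  from df_subst[OF this, of "\<lambda>i. if i = 0 then s else if i = 1 then t else u"] * show ?thesis by simp
qed

lemma df_bad: "art s \<Longrightarrow> art t \<Longrightarrow> df (\<lambda>e. bd (s e) (t e))"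
  by (rule df_at2) (unfold bad_def, intro df_intros dfA dfg df_rel art_intros)

lemma df_bound: "df (\<lambda>e. bound A L Gm (gs i) (e 0))"
  unfolding bound_def by (intro df_intros dfL dfg df_rel df_bad art_intros)

lemma df_YY: "df (\<lambda>e. YY l (e 1) (e 0))"
  unfolding glued_def by (intro df_intros dfA dfL df_rel df_bad art_intros)

lemma df_DD: "df (\<lambda>e. DD l (e 0))"
  unfolding bottomless_def by (intro df_intros dfA dfL dfg df_bad art_intros)

lemma least_bound_unique: "\<exists>!m. least_bound A L Gm (gs i) m"
proof (cases "\<exists>k. bound A L Gm (gs i) k")
  case True
  then obtain m where "start (bound A L Gm (gs i)) m"
    using ex_least[OF df_bound[of i]] unfolding start_def by metis
  then show ?thesis using True start_unique unfolding least_bound_def by metis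
qed (auto simp: least_bound_def start_def)

section \<open>The dichotomy for total orders\<close>

context
  assumes L_sub: "\<And>a b. L a b \<Longrightarrow> A a \<and> A b"
    and L_irrefl: "\<And>a. \<not> L a a"
    and L_trans: "\<And>a b c. L a b \<Longrightarrow> L b c \<Longrightarrow> L a c"
    and L_total: "\<And>a b. A a \<Longrightarrow> A b \<Longrightarrow> a = b \<or> L a b \<or> L b a"
begin

lemma DD_differ:
  assumes "A x" "lt i l" "lt j l" "gs i (pair x n) \<noteq> gs j (pair x n)"
    and "\<And>c. c = x \<or> L c x \<Longrightarrow> \<not> bd i c" "\<And>c. c = x \<or> L c x \<Longrightarrow> \<not> bd j c"
  shows "DD l x"
proof -
  have "lt j l \<and> (\<exists>n. gs i (pair x n) \<noteq> gs j (pair x n)) \<and>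
      (\<forall>c. c = x \<or> L c x \<longrightarrow> \<not> bd i c \<and> \<not> bd j c)"
    using assms by blast
  then show ?thesis unfolding bottomless_def using assms(1,2) by blast
qed

text \<open>Bad points without a minimum are immediate. At a disagreement both rows are values of
  \<open>Gm\<close>, so the arguments of \<open>Gm\<close> differ, which yields a disagreement at
  some \<open>b\<close> below \<open>x\<close>. What lies below \<open>b\<close> lies below
  \<open>x\<close>, so both codes are still free of bad points there.\<close>

lemma DD_no_least:
  assumes "DD l x" shows "\<exists>y. DD l y \<and> L y x"
proof -
  obtain i where i: "A x" "lt i l" and
    c: "bd i x \<and> (\<forall>y. bd i y \<longrightarrow> (\<exists>z. L z y \<and> bd i z)) \<or>
      (\<exists>j. lt j l \<and> (\<exists>n. gs i (pair x n) \<noteq> gs j (pair x n)) \<and> (\<forall>c. c = x \<or> L c x \<longrightarrow> \<not> bd i c \<and> \<not> bd j c))"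
    using assms unfolding bottomless_def by blast
  from c show ?thesis
  proof
    assume *: "bd i x \<and> (\<forall>y. bd i y \<longrightarrow> (\<exists>z. L z y \<and> bd i z))"
    then obtain z where "L z x" "bd i z" by blast
    then show ?thesis using * i L_sub unfolding bottomless_def by blast
  next
    assume "\<exists>j. lt j l \<and> (\<exists>n. gs i (pair x n) \<noteq> gs j (pair x n)) \<and> (\<forall>c. c = x \<or> L c x \<longrightarrow> \<not> bd i c \<and> \<not> bd j c)"
    then obtain j n where j: "lt j l" "gs i (pair x n) \<noteq> gs j (pair x n)"
      "\<And>c. c = x \<or> L c x \<Longrightarrow> \<not> bd i c \<and> \<not> bd j c" by blast
    have "gs i (pair x n) = Gm n (rel i x)" "gs j (pair x n) = Gm n (rel j x)"
      using j(3)[of x] i(1) unfolding bad_def by blast+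
    then have "rel i x \<noteq> rel j x" using j(2) arg_cong[of "rel i x" "rel j x" "Gm n"] by argo
    then obtain b m where b: "L b x" "gs i (pair b m) \<noteq> gs j (pair b m)" by blast
    have "DD l b"
    proof (rule DD_differ[OF _ i(2) j(1) b(2)])
      show "A b" using b(1) L_sub by blast
      fix c assume "c = b \<or> L c b"
      then have "L c x" using b(1) L_trans by blast
      then show "\<not> bd i c" "\<not> bd j c" using j(3) by auto
    qed
    then show ?thesis using b by blast
  qed
qed

lemma hierarchy_if_no_DD:
  assumes no: "\<And>x. \<not> DD l x" and F: "\<And>i. least_bound A L Gm (gs i) (F i)"
    and cov: "\<And>f. df (\<lambda>e. f (e 0)) \<Longrightarrow> \<exists>i. lt i l \<and> (\<forall>k. lt k (F i) \<longrightarrow> f k = gs i k)"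
    and a: "A a"
  shows "YY l a n = Gm n (\<lambda>b m. YY l b m \<and> L b a)"
proof -
  have agree: "gs i (pair c n) = gs j (pair c n)"
    if "lt i l" "lt j l" "L c b" "\<And>c. L c b \<Longrightarrow> \<not> bd i c" "\<And>c. L c b \<Longrightarrow> \<not> bd j c" for i j b c n
  proof (rule ccontr)
    assume ne: "gs i (pair c n) \<noteq> gs j (pair c n)"
    have "DD l c"
    proof (rule DD_differ[OF _ that(1,2) ne])
      show "A c" using that(3) L_sub by blast
      fix c' assume "c' = c \<or> L c' c"
      then have "L c' b" using that(3) L_trans by blast
      then show "\<not> bd i c'" "\<not> bd j c'" using that(4,5) by auto
    qed
    then show False using no by blast
  qed
  \<comment> \<open>By \<open>agree\<close>, all indices without bad points below \<open>b\<close>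
    have the same rows below \<open>b\<close>, so each of them computes row \<open>b\<close> of
    \<open>Y\<close>.\<close>
  have YY_eq: "YY l b m = Gm m (rel i b)" if i: "lt i l" "A b" "\<And>c. L c b \<Longrightarrow> \<not> bd i c" for i b m
  proof -
    have R: "rel j b = rel i b" if "lt j l" "\<And>c. L c b \<Longrightarrow> \<not> bd j c" for j
    proof (intro ext)
      fix c m
      show "rel j b c m = rel i b c m" 
      proof (cases "L c b")
        case True
        have "gs j (pair c m) = gs i (pair c m)"
          by (rule agree[OF that(1) i(1) True that(2) i(3)])
        then show ?thesis by simp
      qed simp
    qed
    show ?thesis
    proof
      assume "YY l b m"
      then obtain j where j: "lt j l" "\<And>c. L c b \<Longrightarrow> \<not> bd j c" "Gm m (rel j b)"
        unfolding glued_def by blast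
      then show "Gm m (rel i b)" using R[OF j(1,2)] by simp
    qed (unfold glued_def, use i in blast)
  qed
  \<comment> \<open>The element of Cantor space that codes the glued relation; it is false at
    numbers that are no pairs.\<close>
  define f where "f k \<longleftrightarrow> (\<exists>b m. k = pair b m \<and> YY l b m)" for k
  have f_pair: "f (pair b m) = YY l b m" for b m
    unfolding f_def pair_inject by blast
  have "df (\<lambda>e. f (e 0))"
    unfolding f_def by (intro df_intros df_at2[OF df_YY] art_intros)
  then obtain i where i: "lt i l" "\<And>k. lt k (F i) \<Longrightarrow> f k = gs i k" using cov by blast
  have good: "\<not> bd i x" for x
  proof
    assume bx: "bd i x"
    \<comment> \<open>Otherwise \<open>x\<close> would belong to \<open>DD l\<close>, which is
      empty.\<close>
    then have "\<not> (\<forall>y. bd i y \<longrightarrow> (\<exists>z. L z y \<and> bd i z))"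
      using no[of x] i(1) unfolding bottomless_def bad_def by blast
    then obtain y where y: "bd i y" "\<And>z. L z y \<Longrightarrow> \<not> bd i z" by blast
    then obtain n where n: "A y" "gs i (pair y n) \<noteq> Gm n (rel i y)" unfolding bad_def by blast
    \<comment> \<open>By totality \<open>y\<close> is the only minimal bad point, so the single
      error at \<open>pair y n\<close> provides a bound; the successor is there because bounds are
      strict.\<close>
    have "y' = y" if "bd i y'" "\<And>z. L z y' \<Longrightarrow> \<not> bd i z" for y'
      using L_total[of y y'] that y unfolding bad_def by blast
    then have "bound A L Gm (gs i) (suc (pair y n))"
      using n(2) unfolding bound_def by (auto simp: lt_suc)
    then have "bound A L Gm (gs i) (F i)"
      using F[of i] unfolding least_bound_def start_def by blast
    \<comment> \<open>The least bound may come from another error in row \<open>y\<close>. So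
      \<open>n\<close> is chosen anew, now with \<open>pair y n\<close> below \<open>F i\<close>,
      where \<open>f\<close> and \<open>gs i\<close> agree.\<close>
    then obtain n where n: "lt (pair y n) (F i)" "gs i (pair y n) \<noteq> Gm n (rel i y)"
      using y unfolding bound_def by blast
    have "f (pair y n) = gs i (pair y n)" using i(2)[OF n(1)] .
    moreover have "f (pair y n) = Gm n (rel i y)"
      unfolding f_pair by (rule YY_eq[OF i(1) \<open>A y\<close> y(2)])
    ultimately show False using n(2) by simp
  qed
  have Y: "YY l b m = gs i (pair b m)" if "A b" for b m
    using YY_eq[OF i(1) that, of m] good that unfolding bad_def by blast
  have "(\<lambda>b m. YY l b m \<and> L b a) = rel i a"
    by (intro ext) (use Y L_sub in blast)
  then show ?thesis using YY_eq[OF i(1) a] good by simp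
qed

theorem hierarchy_or_descending:
  assumes F: "\<And>i. least_bound A L Gm (gs i) (F i)"
    and cov: "\<And>f. df (\<lambda>e. f (e 0)) \<Longrightarrow> \<exists>i. lt i l \<and> (\<forall>k. lt k (F i) \<longrightarrow> f k = gs i k)"
    and h: "\<And>k. path_value (DD l) L k (h k)"
  shows "(\<forall>a n. A a \<longrightarrow> YY l a n = Gm n (\<lambda>b m. YY l b m \<and> L b a))
    \<or> (\<forall>k. A (h k) \<and> L (h (suc k)) (h k))"
proof (cases "\<exists>x. DD l x")
  case True
  then obtain x where "DD l x" by blast
  then have "DD l (h k) \<and> L (h (suc k)) (h k)" for k
    using path_descends[OF df_DD[of l] dfL[OF art_var[of 1] art_var[of 0]] _ DD_no_least h] by blast
  then show ?thesis unfolding bottomless_def by blast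
next
  case False
  then show ?thesis using hierarchy_if_no_DD[OF _ F cov] by blast
qed

end

end

section \<open>The defining formulas\<close>

context arith_ops
begin

primrec gval :: "(string \<Rightarrow> 'n) \<Rightarrow> aterm \<Rightarrow> 'n" where
  "gval e (AVar x) = e x"
| "gval e AZero = zero"
| "gval e (ASuc t) = suc (gval e t)"
| "gval e (APlus s t) = plus (gval e s) (gval e t)"
| "gval e (ATimes s t) = times (gval e s) (gval e t)"

primrec gsat :: "(string \<Rightarrow> 'n) \<Rightarrow> (string \<Rightarrow> 'n \<Rightarrow> bool) \<Rightarrow> (string \<Rightarrow> 'n \<Rightarrow> 'n \<Rightarrow> bool) \<Rightarrow> afm \<Rightarrow> bool" where
  "gsat e U B (AEq s t) = (gval e s = gval e t)"
| "gsat e U B (ALess s t) = lt (gval e s) (gval e t)"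
| "gsat e U B (AMem t X) = U X (gval e t)"
| "gsat e U B (ARel s t X) = B X (gval e s) (gval e t)"
| "gsat e U B AFls = False"
| "gsat e U B (AImp p q) = (gsat e U B p \<longrightarrow> gsat e U B q)"
| "gsat e U B (AAll x p) = (\<forall>n. gsat (e(x := n)) U B p)"

lemma gval_cong: "(\<And>x. x \<in> atvars t \<Longrightarrow> e x = e' x) \<Longrightarrow> gval e t = gval e' t"
  by (induction t) auto

lemma gsat_cong:
  assumes "\<And>x. x \<in> afree_num p \<Longrightarrow> e x = e' x" "\<And>X. X \<in> afree_set p \<Longrightarrow> U X = U' X"
    "\<And>X. X \<in> afree_rel p \<Longrightarrow> B X = B' X"
  shows "gsat e U B p = gsat e' U' B' p"
  using assms
proof (induction p arbitrary: e e')
  case (AAll x p)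
  have "gsat (e(x := n)) U B p = gsat (e'(x := n)) U' B' p" for n
    using AAll.prems by (intro AAll.IH) auto
  then show ?case by simp
next
  case (AImp p q)
  have "gsat e U B p = gsat e' U' B' p" "gsat e U B q = gsat e' U' B' q"
    by (rule AImp.IH; use AImp.prems in auto)+
  then show ?case by simp
qed (auto cong: gval_cong simp: gval_cong[of _ e e'])

end

section \<open>Derived connectives and substitution for the relation variable\<close>

lemma arith_in_simps [simp]:
  "arith_in V U B (AEq s t) \<longleftrightarrow> atvars s \<subseteq> V \<and> atvars t \<subseteq> V"
  "arith_in V U B (ALess s t) \<longleftrightarrow> atvars s \<subseteq> V \<and> atvars t \<subseteq> V"
  "arith_in V U B (AMem t X) \<longleftrightarrow> atvars t \<subseteq> V \<and> X \<in> U"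
  "arith_in V U B (ARel s t X) \<longleftrightarrow> atvars s \<subseteq> V \<and> atvars t \<subseteq> V \<and> X \<in> B"
  "arith_in V U B AFls"
  "arith_in V U B (AImp p q) \<longleftrightarrow> arith_in V U B p \<and> arith_in V U B q"
  "arith_in V U B (AAll x p) \<longleftrightarrow> arith_in (insert x V) U B p"
  by (auto simp: arith_in_def)

definition "ANot p = AImp p AFls"
definition "AAnd p q = ANot (AImp p (ANot q))"
definition "AOr p q = AImp (ANot p) q"
definition "AIff p q = AAnd (AImp p q) (AImp q p)"
definition "AEx x p = ANot (AAll x (ANot p))"
definition "apair s t = APlus (ATimes (APlus s t) (APlus s t)) s"

lemmas connective_defs = ANot_def AAnd_def AOr_def AIff_def AEx_def

lemma arith_in_connectives [simp]:
  "arith_in V U B (ANot p) \<longleftrightarrow> arith_in V U B p"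
  "arith_in V U B (AAnd p q) \<longleftrightarrow> arith_in V U B p \<and> arith_in V U B q"
  "arith_in V U B (AOr p q) \<longleftrightarrow> arith_in V U B p \<and> arith_in V U B q"
  "arith_in V U B (AIff p q) \<longleftrightarrow> arith_in V U B p \<and> arith_in V U B q"
  "arith_in V U B (AEx x p) \<longleftrightarrow> arith_in (insert x V) U B p"
  by (auto simp: connective_defs)

lemma atvars_apair [simp]: "atvars (apair s t) = atvars s \<union> atvars t"
  by (auto simp: apair_def)

text \<open>The number variables of \<open>\<Gamma>\<close> are renamed by a prefix v, so that a formula
  defining its relation argument can be substituted without capture.\<close>

definition vname :: "string \<Rightarrow> string" where "vname x = CHR ''v'' # x"

definition is_v :: "string \<Rightarrow> bool" where "is_v x \<longleftrightarrow> (\<exists>y. x = vname y)"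

lemma is_v_simps [simp]: "is_v (vname x)" "is_v (c # x) \<longleftrightarrow> c = CHR ''v''" "\<not> is_v []"
  by (auto simp: is_v_def vname_def)

primrec rename_tm :: "aterm \<Rightarrow> aterm" where
  "rename_tm (AVar x) = AVar (vname x)"
| "rename_tm AZero = AZero"
| "rename_tm (ASuc t) = ASuc (rename_tm t)"
| "rename_tm (APlus s t) = APlus (rename_tm s) (rename_tm t)"
| "rename_tm (ATimes s t) = ATimes (rename_tm s) (rename_tm t)"

primrec plug :: "(aterm \<Rightarrow> aterm \<Rightarrow> afm) \<Rightarrow> afm \<Rightarrow> afm" where
  "plug \<Phi> (AEq s t) = AEq (rename_tm s) (rename_tm t)"
| "plug \<Phi> (ALess s t) = ALess (rename_tm s) (rename_tm t)"
| "plug \<Phi> (AMem t X) = AMem (rename_tm t) X"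
| "plug \<Phi> (ARel s t X) = \<Phi> (rename_tm s) (rename_tm t)"
| "plug \<Phi> AFls = AFls"
| "plug \<Phi> (AImp p q) = AImp (plug \<Phi> p) (plug \<Phi> q)"
| "plug \<Phi> (AAll x p) = AAll (vname x) (plug \<Phi> p)"

lemma atvars_rename: "atvars (rename_tm t) = vname ` atvars t"
  by (induction t) auto

lemma arith_in_plug:
  assumes "arith_in V0 U B0 p" "vname ` V0 \<subseteq> V"
    and "\<And>s t V'. V \<subseteq> V' \<Longrightarrow> atvars s \<subseteq> V' \<Longrightarrow> atvars t \<subseteq> V' \<Longrightarrow> arith_in V' U B (\<Phi> s t)"
  shows "arith_in V U B (plug \<Phi> p)"
  using assms
proof (induction p arbitrary: V0 V)
  case (AAll x p)
  then have "arith_in (insert (vname x) V) U B (plug \<Phi> p)"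
    by (intro AAll.IH[of "insert x V0"]) auto
  then show ?case by simp
next
  case (ARel s t X)
  have "atvars (rename_tm s) \<subseteq> V" "atvars (rename_tm t) \<subseteq> V"
    using ARel.prems(1,2) by (auto simp: atvars_rename)
  then show ?case using ARel.prems(3)[OF order_refl] by simp
next
  case (AImp p q)
  have "arith_in V U B (plug \<Phi> p)" "arith_in V U B (plug \<Phi> q)"
    using AImp.prems by (auto intro: AImp.IH)
  then show ?case by simp
qed (fastforce simp: atvars_rename)+

context arith_ops
begin

lemma gsat_connectives [simp]:
  "gsat e U B (ANot p) = (\<not> gsat e U B p)"
  "gsat e U B (AAnd p q) = (gsat e U B p \<and> gsat e U B q)"
  "gsat e U B (AOr p q) = (gsat e U B p \<or> gsat e U B q)"
  "gsat e U B (AIff p q) = (gsat e U B p = gsat e U B q)"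
  "gsat e U B (AEx x p) = (\<exists>n. gsat (e(x := n)) U B p)"
  by (auto simp: connective_defs)

lemma gval_apair [simp]: "gval e (apair s t) = pair (gval e s) (gval e t)"
  by (simp add: apair_def pair_def)

lemma gval_rename: "gval e (rename_tm t) = gval (\<lambda>x. e (vname x)) t"
  by (induction t) auto

text \<open>The hypothesis covers all environments that agree with \<open>e\<close> on unprefixed
  names, because the binders of \<open>\<Gamma>\<close> above an occurrence of \<open>\<Phi>\<close>
  change prefixed names only.\<close>

lemma gsat_plug:
  assumes "\<And>e' s t. (\<And>x. \<not> is_v x \<Longrightarrow> e' x = e x) \<Longrightarrow>
    gsat e' U B (\<Phi> s t) = R (gval e' s) (gval e' t)"
  shows "gsat e U B (plug \<Phi> p) = gsat (\<lambda>x. e (vname x)) U (\<lambda>_. R) p"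
  using assms
proof (induction p arbitrary: e)
  case (AAll x p)
  have "gsat (e(vname x := n)) U B (plug \<Phi> p) = gsat (\<lambda>y. (e(vname x := n)) (vname y)) U (\<lambda>_. R) p" for n
    by (rule AAll.IH, rule AAll.prems) auto
  moreover have "(\<lambda>y. (e(vname x := n)) (vname y)) = (\<lambda>y. e (vname y))(x := n)" for n
    by (auto simp: vname_def)
  ultimately show ?case by simp
qed (auto simp: gval_rename)

definition Gam :: "afm \<Rightarrow> ('n \<Rightarrow> bool) \<Rightarrow> 'n \<Rightarrow> ('n \<Rightarrow> 'n \<Rightarrow> bool) \<Rightarrow> bool" where
  "Gam \<Gamma> Z n R = gsat ((\<lambda>_. zero)(''n'' := n)) ((\<lambda>_ _. False)(''Z'' := Z)) ((\<lambda>_ _ _. False)(''X'' := R)) \<Gamma>"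

lemma gsat_Gam:
  assumes "arith_in {''n''} {''Z''} {''X''} \<Gamma>"
  shows "gsat e U B \<Gamma> = Gam \<Gamma> (U ''Z'') (e ''n'') (B ''X'')"
  unfolding Gam_def using assms by (intro gsat_cong) (auto simp: arith_in_def)

end

lemma (in arith_ops) art_gval: "(\<And>x. art (\<lambda>e. E e x)) \<Longrightarrow> art (\<lambda>e. gval (E e) t)"
  by (induction t) (auto intro: art.intros)

text \<open>The relation variables may depend on the environment \<open>e\<close>, i.e. stand for
  relations defined with further number parameters. This allows \<open>Gam\<close> to be applied to
  the definable rows below a point.\<close>

lemma (in arith_model) df_gsat:
  assumes "\<And>x. art (\<lambda>e. E e x)" "\<And>X t. art t \<Longrightarrow> df (\<lambda>e. U X (t e))"
    "\<And>X. df (\<lambda>e. B X (\<lambda>i. e (Suc (Suc i))) (e 1) (e 0))"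
  shows "df (\<lambda>e. gsat (E e) U (\<lambda>X. B X e) p)"
  using assms(1,3)
proof (induction p arbitrary: E B)
  case (AAll x p)
  have "df (\<lambda>e. gsat ((E (\<lambda>i. e (Suc i)))(x := e 0)) U (\<lambda>X. B X (\<lambda>i. e (Suc i))) p)"
  proof (rule AAll.IH)
    show "art (\<lambda>e. ((E (\<lambda>i. e (Suc i)))(x := e 0)) y)" for y
      using art_subst[OF AAll.prems(1)[of y], of "\<lambda>i e. e (Suc i)"]
      by (cases "y = x") (simp_all add: art_var)
    show "df (\<lambda>e. B X (\<lambda>i. e (Suc (Suc (Suc i)))) (e 1) (e 0))" for X
    proof -
      \<comment> \<open>Positions 0 and 1 are the arguments of the relation. Position 2 holds the
        number bound by the quantifier; \<open>B\<close> does not depend on it, so it is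
        skipped.\<close>
      have "art (\<lambda>e. if i < 2 then e i else e (Suc i))" for i
        by (cases "i < 2") (simp_all add: art_var)
      from df_subst[OF AAll.prems(2)[of X], of "\<lambda>i e. if i < 2 then e i else e (Suc i)", OF this]
      show ?thesis by simp
    qed
  qed
  from df_all[of "\<lambda>e n. gsat ((E e)(x := n)) U (\<lambda>X. B X e) p", OF this] show ?case by simp
next
  case (ARel s t X)
  have "df (\<lambda>e. B X (\<lambda>i. e i) (gval (E e) s) (gval (E e) t))"
  proof -
    have "art (\<lambda>e. if i = 0 then gval (E e) t else if i = 1 then gval (E e) s else e (i - 2))" for i
      using art_gval[OF ARel.prems(1)] by (cases "i = 0"; cases "i = 1") (simp_all add: art_var)
    from df_subst[OF ARel.prems(2)[of X],
        of "\<lambda>i e. if i = 0 then gval (E e) t else if i = 1 then gval (E e) s else e (i - 2)", OF this]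
    show ?thesis by simp
  qed
  then show ?case by simp
next
  case (AMem t X)
  then show ?case using assms(2) art_gval by simp
next
  case (AEq s t)
  then show ?case using art_gval by (simp add: df_eq)
next
  case (ALess s t)
  then show ?case using art_gval by (simp add: df_lt)
qed (auto intro: df_imp df_False)

lemma (in arith_model) df_Gam:
  assumes "\<And>t. art t \<Longrightarrow> df (\<lambda>e. Z (t e))" "art t"
    "df (\<lambda>e. R (\<lambda>i. e (Suc (Suc i))) (e (Suc 0)) (e 0))"
  shows "df (\<lambda>e. Gam \<Gamma> Z (t e) (R e))"
proof -
  have "df (\<lambda>e. gsat ((\<lambda>_. zero)(''n'' := t e)) ((\<lambda>_ _. False)(''Z'' := Z))
      (\<lambda>X. (if X = ''X'' then R else (\<lambda>_ _ _. False)) e) \<Gamma>)"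
  proof (rule df_gsat)
    show "art (\<lambda>e. ((\<lambda>_. zero)(''n'' := t e)) x)" for x
      using assms(2) by (cases "x = ''n''") (simp_all add: art_const)
  qed (use assms in \<open>auto intro: df_False\<close>)
  moreover have "(\<lambda>X. (if X = ''X'' then R else (\<lambda>_ _ _. False)) e) = (\<lambda>_ _ _. False)(''X'' := R e)" for e
    by auto
  ultimately show ?thesis unfolding Gam_def by simp
qed

text \<open>\<open>M t\<close> says that \<open>t\<close> belongs to the coded set. The number
  argument of \<open>\<Gamma>\<close> is read from its renamed variable \<open>vname ''n''\<close>,
  which remains free.\<close>

definition "in_hat \<Gamma> M a = plug (\<lambda>s t. AAnd (M (apair s t)) (ARel s (AVar a) ''L'')) \<Gamma>"

definition "differs \<Gamma> M a = ANot (AIff (M (apair (AVar a) (AVar (vname ''n'')))) (in_hat \<Gamma> M a))"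

definition "bad_fm \<Gamma> M a = AAnd (AMem (AVar a) ''A'') (AEx (vname ''n'') (differs \<Gamma> M a))"

definition "minimal_bad_fm \<Gamma> M a =
  AAnd (bad_fm \<Gamma> M a) (AAll ''c'' (AImp (ARel (AVar ''c'') (AVar a) ''L'') (ANot (bad_fm \<Gamma> M ''c''))))"

definition "bound_fm \<Gamma> M m = AAll ''a'' (AImp (minimal_bad_fm \<Gamma> M ''a'')
  (AEx (vname ''n'') (AAnd (ALess (apair (AVar ''a'') (AVar (vname ''n''))) (AVar m)) (differs \<Gamma> M ''a''))))"

definition "start_fm P y =
  AAnd (P y) (AAll ''s'' (AImp (ALess (AVar ''s'') (AVar y)) (ANot (P ''s''))))"

definition "G_formula \<Gamma> = (let M = (\<lambda>t. AMem t ''g'') in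
  AOr (start_fm (bound_fm \<Gamma> M) ''m'')
    (AAnd (AAll ''k'' (ANot (bound_fm \<Gamma> M ''k''))) (AEq (AVar ''m'') AZero)))"

definition "row i = (\<lambda>t. ARel (AVar i) t ''gs'')"

text \<open>\<open>in_hat\<close> reads its argument from \<open>vname ''n''\<close>; the
  existential quantifier with the equation passes \<open>k\<close> to it.\<close>

definition "Y_formula \<Gamma> = AAnd (AMem (AVar ''j'') ''A'') (AEx ''i'' (AAnd (ALess (AVar ''i'') (AVar ''l''))
  (AAnd (AAll ''c'' (AImp (ARel (AVar ''c'') (AVar ''j'') ''L'') (ANot (bad_fm \<Gamma> (row ''i'') ''c''))))
    (AEx (vname ''n'') (AAnd (AEq (AVar (vname ''n'')) (AVar ''k'')) (in_hat \<Gamma> (row ''i'') ''j''))))))"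

definition "bottomless_fm \<Gamma> x = AAnd (AMem (AVar x) ''A'') (AEx ''i'' (AAnd (ALess (AVar ''i'') (AVar ''l''))
  (AOr
    (AAnd (bad_fm \<Gamma> (row ''i'') x)
      (AAll ''y'' (AImp (bad_fm \<Gamma> (row ''i'') ''y'')
        (AEx ''z'' (AAnd (ARel (AVar ''z'') (AVar ''y'') ''L'') (bad_fm \<Gamma> (row ''i'') ''z''))))))
    (AEx ''j'' (AAnd (ALess (AVar ''j'') (AVar ''l''))
      (AAnd (AEx ''n'' (ANot (AIff (row ''i'' (apair (AVar x) (AVar ''n''))) (row ''j'' (apair (AVar x) (AVar ''n''))))))
        (AAll ''c'' (AImp (AOr (AEq (AVar ''c'') (AVar x)) (ARel (AVar ''c'') (AVar x) ''L''))
          (AAnd (ANot (bad_fm \<Gamma> (row ''i'') ''c'')) (ANot (bad_fm \<Gamma> (row ''j'') ''c'')))))))))))"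

definition "next_fm P x y = start_fm (\<lambda>z. AAnd (P z) (ARel (AVar z) (AVar x) ''L'')) y"

definition "mem_fm t = AAnd (ALess t (AVar ''pb''))
  (AEx ''w'' (AEq (AVar ''pc'') (ATimes (ASuc (ATimes (ASuc t) (AVar ''pd''))) (AVar ''w''))))"

definition "path_code_fm P = AAll ''q'' (AAll ''x'' (AImp (mem_fm (apair (AVar ''q'') (AVar ''x'')))
  (AOr (AAnd (AEq (AVar ''q'') AZero) (start_fm P ''x''))
    (AEx ''r'' (AAnd (AEq (AVar ''q'') (ASuc (AVar ''r'')))
      (AEx ''u'' (AAnd (mem_fm (apair (AVar ''r'') (AVar ''u''))) (next_fm P ''u'' ''x''))))))))"

definition "path_fm P k m = AEx ''pb'' (AEx ''pc'' (AEx ''pd''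
  (AAnd (path_code_fm P) (mem_fm (apair (AVar k) (AVar m))))))"

definition "h_formula \<Gamma> = (let P = bottomless_fm \<Gamma> in
  AOr (path_fm P ''k'' ''m'')
    (AAnd (AAll ''t'' (ANot (path_fm P ''k'' ''t''))) (AEq (AVar ''m'') AZero)))"

section \<open>Free variables of the defining formulas\<close>

context
  fixes \<Gamma> :: afm
  assumes \<Gamma>: "arith_in {''n''} {''Z''} {''X''} \<Gamma>"
begin

lemma arith_in_hat:
  assumes "\<And>t V'. V \<subseteq> V' \<Longrightarrow> atvars t \<subseteq> V' \<Longrightarrow> arith_in V' U B (M t)"
    "vname ''n'' \<in> V" "a \<in> V" "''Z'' \<in> U" "''L'' \<in> B"
  shows "arith_in V U B (in_hat \<Gamma> M a)"
  unfolding in_hat_def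
proof (rule arith_in_plug)
  show "arith_in {''n''} U {''X''} \<Gamma>" using \<Gamma> assms by (auto simp: arith_in_def)
qed (use assms in auto)

lemma arith_in_bad:
  assumes "\<And>t V'. V \<subseteq> V' \<Longrightarrow> atvars t \<subseteq> V' \<Longrightarrow> arith_in V' U B (M t)"
    "a \<in> V" "''Z'' \<in> U" "''A'' \<in> U" "''L'' \<in> B"
  shows "arith_in V U B (bad_fm \<Gamma> M a)"
  using assms(2-) unfolding bad_fm_def differs_def by (auto intro!: arith_in_hat assms(1))

lemma arith_in_bound:
  assumes "\<And>t V'. V \<subseteq> V' \<Longrightarrow> atvars t \<subseteq> V' \<Longrightarrow> arith_in V' U B (M t)"
    "m \<in> V" "''Z'' \<in> U" "''A'' \<in> U" "''L'' \<in> B"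
  shows "arith_in V U B (bound_fm \<Gamma> M m)"
  using assms(2-) unfolding bound_fm_def minimal_bad_fm_def differs_def
  by (auto intro!: arith_in_bad arith_in_hat assms(1))

lemma arith_in_G: "arith_in {''m''} {''g'', ''A'', ''Z''} {''L''} (G_formula \<Gamma>)"
  unfolding G_formula_def Let_def start_fm_def by (auto intro!: arith_in_bound)

lemma arith_in_row: "arith_in V U B (row i t) \<longleftrightarrow> i \<in> V \<and> atvars t \<subseteq> V \<and> ''gs'' \<in> B"
  by (simp add: row_def)

lemma arith_in_bad_row:
  assumes "i \<in> V" "a \<in> V" "''Z'' \<in> U" "''A'' \<in> U" "''L'' \<in> B" "''gs'' \<in> B"
  shows "arith_in V U B (bad_fm \<Gamma> (row i) a)"
  by (rule arith_in_bad) (use assms in \<open>auto simp: arith_in_row\<close>)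

lemma arith_in_hat_row:
  assumes "i \<in> V" "a \<in> V" "vname ''n'' \<in> V" "''Z'' \<in> U" "''L'' \<in> B" "''gs'' \<in> B"
  shows "arith_in V U B (in_hat \<Gamma> (row i) a)"
  by (rule arith_in_hat) (use assms in \<open>auto simp: arith_in_row\<close>)

lemma arith_in_Y: "arith_in {''j'', ''k'', ''l''} {''A'', ''Z''} {''L'', ''gs''} (Y_formula \<Gamma>)"
  unfolding Y_formula_def by (simp add: arith_in_bad_row arith_in_hat_row)

lemma arith_in_bottomless:
  assumes "x \<in> V" "''l'' \<in> V" "{''A'', ''Z''} \<subseteq> U" "{''L'', ''gs''} \<subseteq> B"
  shows "arith_in V U B (bottomless_fm \<Gamma> x)"
  using assms unfolding bottomless_fm_def by (simp add: arith_in_bad_row arith_in_row)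

lemma arith_in_path:
  assumes "k \<in> V" "m \<in> V" "''l'' \<in> V"
  shows "arith_in V {''A'', ''Z''} {''L'', ''gs''} (path_fm (bottomless_fm \<Gamma>) k m)"
  using assms unfolding path_fm_def path_code_fm_def mem_fm_def next_fm_def start_fm_def
  by (auto intro!: arith_in_bottomless)

lemma arith_in_h: "arith_in {''k'', ''m'', ''l''} {''A'', ''Z''} {''L'', ''gs''} (h_formula \<Gamma>)"
  unfolding h_formula_def Let_def by (auto intro!: arith_in_path)

end

section \<open>Meaning of the defining formulas\<close>

locale arith_formula = arith_ops zero suc plus times
  for zero :: 'n and suc :: "'n \<Rightarrow> 'n" and plus times :: "'n \<Rightarrow> 'n \<Rightarrow> 'n" +
  fixes \<Gamma> :: afm and U :: "string \<Rightarrow> 'n \<Rightarrow> bool" and B :: "string \<Rightarrow> 'n \<Rightarrow> 'n \<Rightarrow> bool"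
  assumes \<Gamma>: "arith_in {''n''} {''Z''} {''X''} \<Gamma>"
begin

abbreviation "A \<equiv> U ''A''"
abbreviation "L \<equiv> B ''L''"
abbreviation "Gm \<equiv> Gam \<Gamma> (U ''Z'')"
abbreviation "sat_at e \<equiv> gsat e U B"

text \<open>\<open>M\<close> represents \<open>g\<close> not only at \<open>e\<close> but also after
  prefixed variables have been changed, as happens at its occurrences under the binders of
  \<open>\<Gamma>\<close>.\<close>

definition "pnt_at M g e \<longleftrightarrow> (\<forall>e' t. (\<forall>x. \<not> is_v x \<longrightarrow> e' x = e x) \<longrightarrow> sat_at e' (M t) = g (gval e' t))"

lemma pnt_atD: "pnt_at M g e \<Longrightarrow> sat_at e (M t) = g (gval e t)"
  by (simp add: pnt_at_def)

lemma pnt_at_upd: "pnt_at M g e \<Longrightarrow> is_v x \<Longrightarrow> pnt_at M g (e(x := n))"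
  by (auto simp: pnt_at_def)

lemma sat_in_hat:
  assumes "pnt_at M g e" "\<not> is_v a"
  shows "sat_at e (in_hat \<Gamma> M a) = Gm (e (vname ''n'')) (\<lambda>b m. g (pair b m) \<and> L b (e a))"
proof -
  have "sat_at e (in_hat \<Gamma> M a)
      = gsat (\<lambda>x. e (vname x)) U (\<lambda>_ b m. g (pair b m) \<and> L b (e a)) \<Gamma>"
    unfolding in_hat_def using assms by (intro gsat_plug) (auto simp: pnt_at_def)
  then show ?thesis by (simp add: gsat_Gam[OF \<Gamma>])
qed

lemma sat_differs:
  assumes "pnt_at M g e" "\<not> is_v a"
  shows "sat_at e (differs \<Gamma> M a) \<longleftrightarrow> g (pair (e a) (e (vname ''n''))) \<noteq>
    Gm (e (vname ''n'')) (\<lambda>b m. g (pair b m) \<and> L b (e a))"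
  using assms by (simp add: differs_def sat_in_hat pnt_atD)

lemma sat_bad:
  assumes "pnt_at M g e" "\<not> is_v a"
  shows "sat_at e (bad_fm \<Gamma> M a) = bad A L Gm g (e a)"
proof -
  have "a \<noteq> vname ''n''" using assms(2) by auto
  then show ?thesis
    using assms by (simp add: bad_fm_def bad_def sat_differs[OF pnt_at_upd[OF assms(1)]])
qed

lemma sat_bound:
  assumes M: "\<And>e. pnt_at M g e" and m: "\<not> is_v m" "m \<noteq> ''a''"
  shows "sat_at e (bound_fm \<Gamma> M m) = bound A L Gm g (e m)"
proof -
  have "m \<noteq> vname ''n''" using m(1) by auto
  then show ?thesis
    using m by (simp add: bound_fm_def minimal_bad_fm_def bound_def sat_bad[OF M] sat_differs[OF M] vname_def)
qed

lemma sat_start: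
  assumes "\<And>n. sat_at (e(''s'' := n)) (P ''s'') = S n" "sat_at e (P y) = S (e y)" "y \<noteq> ''s''"
  shows "sat_at e (start_fm P y) = start S (e y)"
  using assms by (simp add: start_fm_def start_def)

lemma sat_G: "sat_at e (G_formula \<Gamma>) = least_bound A L Gm (U ''g'') (e ''m'')"
proof -
  have M: "pnt_at (\<lambda>t. AMem t ''g'') (U ''g'') e" for e by (simp add: pnt_at_def)
  have "sat_at e (start_fm (bound_fm \<Gamma> (\<lambda>t. AMem t ''g'')) ''m'')
      = start (bound A L Gm (U ''g'')) (e ''m'')"
    by (rule sat_start) (simp_all add: sat_bound[OF M])
  then show ?thesis by (simp add: G_formula_def Let_def least_bound_def sat_bound[OF M])
qed

lemma pnt_at_row: "\<not> is_v i \<Longrightarrow> pnt_at (row i) (B ''gs'' (e i)) e"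
  by (simp add: pnt_at_def row_def)

lemma sat_row: "sat_at e (row i t) = B ''gs'' (e i) (gval e t)"
  by (simp add: row_def)

lemma sat_bad_row:
  "\<not> is_v i \<Longrightarrow> \<not> is_v a \<Longrightarrow> sat_at e (bad_fm \<Gamma> (row i) a) = bad A L Gm (B ''gs'' (e i)) (e a)"
  by (rule sat_bad[OF pnt_at_row])

lemma sat_in_hat_row:
  "\<not> is_v i \<Longrightarrow> \<not> is_v a \<Longrightarrow> sat_at e (in_hat \<Gamma> (row i) a) =
    Gm (e (vname ''n'')) (\<lambda>b m. B ''gs'' (e i) (pair b m) \<and> L b (e a))"
  by (rule sat_in_hat[OF pnt_at_row])

lemma sat_Y: "sat_at e (Y_formula \<Gamma>) = glued A L Gm (e ''l'') (B ''gs'') (e ''j'') (e ''k'')"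
  by (simp add: Y_formula_def glued_def sat_bad_row sat_in_hat_row vname_def)

abbreviation "DD l \<equiv> bottomless A L Gm l (B ''gs'')"

lemma sat_bottomless:
  assumes "\<not> is_v x" "x \<notin> {''i'', ''j'', ''y'', ''z'', ''n'', ''c''}"
  shows "sat_at e (bottomless_fm \<Gamma> x) = DD (e ''l'') (e x)"
  using assms by (simp add: bottomless_fm_def bottomless_def sat_bad_row sat_row)

lemma sat_mem:
  assumes "''w'' \<notin> atvars t"
  shows "sat_at e (mem_fm t) = mem (e ''pb'') (e ''pc'') (e ''pd'') (gval e t)"
proof -
  have "gval (e(''w'' := n)) t = gval e t" for n using assms by (intro gval_cong) auto
  then show ?thesis by (simp add: mem_fm_def mem_def dv_def modulus_def)
qed

lemma sat_next:
  assumes "y \<notin> {''i'', ''j'', ''y'', ''z'', ''n'', ''c'', ''s''}" "\<not> is_v y" "x \<noteq> ''s''"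
  shows "sat_at e (next_fm (bottomless_fm \<Gamma>) x y) = next_below (DD (e ''l'')) L (e x) (e y)"
  unfolding next_fm_def next_below_def
  by (rule sat_start) (use assms in \<open>simp_all add: sat_bottomless\<close>)

lemma sat_start_bottomless:
  assumes "y \<notin> {''i'', ''j'', ''y'', ''z'', ''n'', ''c'', ''s''}" "\<not> is_v y"
  shows "sat_at e (start_fm (bottomless_fm \<Gamma>) y) = start (DD (e ''l'')) (e y)"
  by (rule sat_start) (use assms in \<open>simp_all add: sat_bottomless\<close>)

lemma sat_path_code:
  "sat_at e (path_code_fm (bottomless_fm \<Gamma>)) = path_code (DD (e ''l'')) L (e ''pb'') (e ''pc'') (e ''pd'')"
  by (simp add: path_code_fm_def path_code_def sat_mem sat_next sat_start_bottomless)

lemma sat_path: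
  assumes "k \<notin> {''pb'', ''pc'', ''pd'', ''w''}" "m \<notin> {''pb'', ''pc'', ''pd'', ''w''}"
  shows "sat_at e (path_fm (bottomless_fm \<Gamma>) k m) = path (DD (e ''l'')) L (e k) (e m)"
proof -
  have "''w'' \<noteq> k" "''w'' \<noteq> m" using assms by auto
  then show ?thesis using assms by (simp add: path_fm_def path_def sat_path_code sat_mem)
qed

lemma sat_h: "sat_at e (h_formula \<Gamma>) = path_value (DD (e ''l'')) L (e ''k'') (e ''m'')"
  by (simp add: h_formula_def Let_def path_value_def sat_path)

end

section \<open>The standard model\<close>

text \<open>Induction holds for all predicates here, so each of them may count as definable. The
  covering condition of the abstract argument then ranges over the whole Cantor space.\<close>

interpretation std: arith_model "0 :: nat" Suc "(+)" "(*)" "\<lambda>_. True"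
  by standard (auto elim: nat.induct)

lemma std_lt: "std.lt a b \<longleftrightarrow> a < b"
  unfolding std.lt_def by (auto simp: less_iff_Suc_add)

lemma aval_gval: "aval e t = std.gval e t"
  by (induction t) auto

lemma asat_gsat: "asat e U B p = std.gsat e (\<lambda>X k. k \<in> U X) (\<lambda>X j k. (j, k) \<in> B X) p"
  by (induction p arbitrary: e) (auto simp: aval_gval std_lt)

abbreviation std_Gam :: "afm \<Rightarrow> nat set \<Rightarrow> nat \<Rightarrow> (nat \<Rightarrow> nat \<Rightarrow> bool) \<Rightarrow> bool" where
  "std_Gam \<Gamma> Z \<equiv> std.Gam \<Gamma> (\<lambda>k. k \<in> Z)"

definition std_G :: "afm \<Rightarrow> cantor \<Rightarrow> nat set \<Rightarrow> (nat \<times> nat) set \<Rightarrow> nat set \<Rightarrow> nat" where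
  "std_G \<Gamma> g A L Z = (THE m. std.least_bound (\<lambda>a. a \<in> A) (\<lambda>a b. (a, b) \<in> L) (std_Gam \<Gamma> Z) g m)"

definition std_Y :: "afm \<Rightarrow> nat set \<Rightarrow> nat set \<Rightarrow> (nat \<times> nat) set \<Rightarrow> cantor list \<Rightarrow> (nat \<times> nat) set" where
  "std_Y \<Gamma> Z A L gs = {(j, k). std.glued (\<lambda>a. a \<in> A) (\<lambda>a b. (a, b) \<in> L) (std_Gam \<Gamma> Z)
     (length gs) (\<lambda>i k. (i, k) \<in> seq_rel gs) j k}"

definition std_h :: "afm \<Rightarrow> nat set \<Rightarrow> nat set \<Rightarrow> (nat \<times> nat) set \<Rightarrow> cantor list \<Rightarrow> nat \<Rightarrow> nat" where
  "std_h \<Gamma> Z A L gs k = (THE m. std.path_value (std.bottomless (\<lambda>a. a \<in> A) (\<lambda>a b. (a, b) \<in> L) (std_Gam \<Gamma> Z)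
     (length gs) (\<lambda>i k. (i, k) \<in> seq_rel gs)) (\<lambda>a b. (a, b) \<in> L) k m)"

lemma std_setting: "hier_setting 0 Suc (+) (*) (\<lambda>_. True) A L Gm gs"
  by standard auto

lemma std_G_iff:
  "std_G \<Gamma> g A L Z = m \<longleftrightarrow> std.least_bound (\<lambda>a. a \<in> A) (\<lambda>a b. (a, b) \<in> L) (std_Gam \<Gamma> Z) g m"
  unfolding std_G_def
  using hier_setting.least_bound_unique[OF std_setting, of "\<lambda>a. a \<in> A" "\<lambda>a b. (a, b) \<in> L" "std_Gam \<Gamma> Z" "\<lambda>_. g"]
  by (metis (mono_tags, lifting) the_equality)

lemma std_h_iff:
  "std_h \<Gamma> Z A L gs k = m \<longleftrightarrow> std.path_value (std.bottomless (\<lambda>a. a \<in> A) (\<lambda>a b. (a, b) \<in> L) (std_Gam \<Gamma> Z)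
     (length gs) (\<lambda>i k. (i, k) \<in> seq_rel gs)) (\<lambda>a b. (a, b) \<in> L) k m"
  unfolding std_h_def using std.path_value_unique by (metis (mono_tags, lifting) the_equality)

context
  fixes \<Gamma> :: afm
  assumes \<Gamma>: "arith_in {''n''} {''Z''} {''X''} \<Gamma>"
begin

lemma std_formula: "arith_formula \<Gamma>"
  by standard (rule \<Gamma>)

lemma defines_std_G: "defines_G (G_formula \<Gamma>) (std_G \<Gamma>)"
  unfolding defines_G_def asat_gsat arith_formula.sat_G[OF std_formula] std_G_iff
  using arith_in_G[OF \<Gamma>] by simp

lemma defines_std_Y: "defines_Y (Y_formula \<Gamma>) (std_Y \<Gamma>)"
  unfolding defines_Y_def asat_gsat arith_formula.sat_Y[OF std_formula] std_Y_def
  using arith_in_Y[OF \<Gamma>] by simp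

lemma defines_std_h: "defines_h (h_formula \<Gamma>) (std_h \<Gamma>)"
  unfolding defines_h_def asat_gsat arith_formula.sat_h[OF std_formula] std_h_iff
  using arith_in_h[OF \<Gamma>] by simp

end

lemma Gamma_hat_Gam: "n \<in> Gamma_hat \<Gamma> X Z \<longleftrightarrow> std_Gam \<Gamma> Z n (\<lambda>j k. (j, k) \<in> X)"
proof -
  have "(\<lambda>Y k. k \<in> ((\<lambda>_. {})(''Z'' := Z)) Y) = (\<lambda>_ _. False)(''Z'' := \<lambda>k. k \<in> Z)"
    "(\<lambda>Y j k. (j, k) \<in> ((\<lambda>_. {})(''X'' := X)) Y) = (\<lambda>_ _ _. False)(''X'' := \<lambda>j k. (j, k) \<in> X)"
    by (intro ext, simp)+
  then show ?thesis by (simp add: Gamma_hat_def asat_gsat std.Gam_def)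
qed

lemma std_hierarchy_or_descending:
  assumes "total_ordering A L"
    and cov: "UNIV \<subseteq> (\<Union>g\<in>set gs. cylinder (initial g (std_G \<Gamma> g A L Z)))"
  shows "hierarchy \<Gamma> A L (std_Y \<Gamma> Z A L gs) Z \<or> descending_in A L (std_h \<Gamma> Z A L gs)"
proof -
  let ?A = "\<lambda>a. a \<in> A" and ?L = "\<lambda>a b. (a, b) \<in> L" and ?g = "\<lambda>i k. (i, k) \<in> seq_rel gs"
  interpret hier_setting 0 Suc "(+)" "(*)" "\<lambda>_. True" ?A ?L "std_Gam \<Gamma> Z" ?g
    by (rule std_setting)
  have ord: "L \<subseteq> A \<times> A" "trans L" "irrefl L" "total_on A L"
    using assms(1) by (auto simp: total_ordering_def strict_linear_order_on_def)
  have row: "?g i = gs ! i" if "i < length gs" for i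
    using that by (auto simp: seq_rel_def)
  have "(\<forall>a n. ?A a \<longrightarrow> YY (length gs) a n = std_Gam \<Gamma> Z n (\<lambda>b m. YY (length gs) b m \<and> ?L b a))
    \<or> (\<forall>k. ?A (std_h \<Gamma> Z A L gs k) \<and> ?L (std_h \<Gamma> Z A L gs (Suc k)) (std_h \<Gamma> Z A L gs k))"
  proof (rule hierarchy_or_descending)
    show "?L a b \<Longrightarrow> ?A a \<and> ?A b" for a b using ord by auto
    show "\<not> ?L a a" for a using ord by (auto simp: irrefl_def)
    show "?L a b \<Longrightarrow> ?L b c \<Longrightarrow> ?L a c" for a b c using ord by (meson transD)
    show "?A a \<Longrightarrow> ?A b \<Longrightarrow> a = b \<or> ?L a b \<or> ?L b a" for a b using ord by (auto simp: total_on_def)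
    show "std.least_bound ?A ?L (std_Gam \<Gamma> Z) (?g i) (std_G \<Gamma> (?g i) A L Z)" for i
      using std_G_iff by blast
    show "std.path_value (DD (length gs)) ?L k (std_h \<Gamma> Z A L gs k)" for k
      using std_h_iff by blast
    fix f :: cantor
    obtain g where g: "g \<in> set gs" "f \<in> cylinder (initial g (std_G \<Gamma> g A L Z))"
      using cov by blast
    then obtain i where i: "i < length gs" "g = gs ! i" by (auto simp: in_set_conv_nth)
    have "\<forall>k < std_G \<Gamma> (?g i) A L Z. f k = (gs ! i) k"
      using g(2) i row[OF i(1)] by (simp add: cylinder_def initial_def)
    then have "\<forall>k < std_G \<Gamma> (?g i) A L Z. f k = ?g i k"
      using fun_cong[OF row[OF i(1)]] by simp
    then show "\<exists>i. std.lt i (length gs) \<and> (\<forall>k. std.lt k (std_G \<Gamma> (?g i) A L Z) \<longrightarrow> f k = ?g i k)"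
      using i(1) std_lt by blast
  qed
  then show ?thesis
    by (auto simp: hierarchy_def descending_in_def Gamma_hat_Gam std_Y_def below_def set_eq_iff)
qed

section \<open>Arithmetical comprehension in models\<close>

lemma wf_tr_tm: "has_ty (tr_tm t) N"
  by (induction t) (auto simp: Plus_def Times_def Succ_fst_def)

lemma wf_tr: "wf_fm (tr p)"
  by (induction p) (auto simp: Less_def Mem_def Mem2_def wf_tr_tm Plus_def Succ_fst_def)

locale coded_model = fin_model D ap ct
  for D :: "ty \<Rightarrow> 'a set" and ap :: "'a \<Rightarrow> 'a \<Rightarrow> 'a" and ct :: "tm \<Rightarrow> 'a" +
  fixes nb :: "nat \<Rightarrow> 'a"
  assumes bij: "bij_betw nb UNIV (D N)"
begin

definition "bi = inv_into UNIV nb"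

lemma D_N: "D N = range nb"
  using bij by (simp add: bij_betw_def)

lemma bi_nb [simp]: "bi (nb n) = n"
  using bij by (simp add: bi_def bij_betw_def)

lemma nb_bi [simp]: "a \<in> D N \<Longrightarrow> nb (bi a) = a"
  unfolding D_N by auto

lemma nb_type [simp, intro]: "nb n \<in> D N"
  by (simp add: D_N)

lemma bi_inject: "a \<in> D N \<Longrightarrow> b \<in> D N \<Longrightarrow> bi a = bi b \<longleftrightarrow> a = b"
  using nb_bi by metis

definition "zero' = bi zr"
definition "suc' n = bi (sc (nb n))"
definition "plus' m n = bi (pls (nb m) (nb n))"
definition "times' m n = bi (tms (nb m) (nb n))"

lemma nb_ops:
  "nb zero' = zr" "nb (suc' n) = sc (nb n)"
  "nb (plus' m n) = pls (nb m) (nb n)" "nb (times' m n) = tms (nb m) (nb n)"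
  unfolding zero'_def suc'_def plus'_def times'_def by simp_all

lemma nb_inject: "nb m = nb n \<longleftrightarrow> m = n"
  using bi_nb by metis

text \<open>\<open>P\<close> is given on infinite environments but depends on finitely many
  variables; the representing functional has \<open>k\<close> number arguments.\<close>

definition df :: "((nat \<Rightarrow> nat) \<Rightarrow> bool) \<Rightarrow> bool" where
  "df P \<longleftrightarrow> (\<exists>k. repb (replicate k N) (\<lambda>e. P (\<lambda>i. bi (e i))))"

lemma rep_more:
  assumes "rep (replicate k N) \<rho> F" "k \<le> m" shows "rep (replicate m N) \<rho> F"
  using rep_append[OF assms(1), of "replicate (m - k) N"] assms(2)
  by (simp add: replicate_add[symmetric])

lemma rep_common:
  assumes "rep (replicate k N) \<rho> F" "rep (replicate m N) \<sigma> G"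
  shows "\<exists>n. rep (replicate n N) \<rho> F \<and> rep (replicate n N) \<sigma> G"
  using rep_more[OF assms(1), of "max k m"] rep_more[OF assms(2), of "max k m"] by auto

sublocale arith_ops zero' suc' plus' times' .

lemma art_rep:
  "art t \<Longrightarrow> \<exists>k. rep (replicate k N) N (\<lambda>e. nb (t (\<lambda>i. bi (e i))))"
proof (induction rule: art.induct)
  case (art_var i)
  have "rep (replicate (Suc i) N) N (\<lambda>e. e i)" by (rule rep_num) (simp_all del: replicate_Suc)
  then have "rep (replicate (Suc i) N) N (\<lambda>e. nb (bi (e i)))"
    by (rule rep_cong) (simp add: typed_def del: replicate_Suc typed_Cons)
  then show ?case by blast
next
  case (art_const c)
  then show ?case by (auto intro: rep_const)
next
  case (art_suc s)
  then show ?case unfolding nb_ops by (auto intro: rep_sc)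
next
  case (art_plus s t)
  then obtain k where "rep (replicate k N) N (\<lambda>e. nb (s (\<lambda>i. bi (e i))))"
    "rep (replicate k N) N (\<lambda>e. nb (t (\<lambda>i. bi (e i))))" using rep_common by blast
  then show ?case unfolding nb_ops by (auto intro: rep_pls)
next
  case (art_times s t)
  then obtain k where "rep (replicate k N) N (\<lambda>e. nb (s (\<lambda>i. bi (e i))))"
    "rep (replicate k N) N (\<lambda>e. nb (t (\<lambda>i. bi (e i))))" using rep_common by blast
  then show ?case unfolding nb_ops by (auto intro: rep_tms)
qed

text \<open>The number of variables hidden in \<open>df\<close> is unknown. Setting those from
  \<open>k\<close> on to zero yields a representation in the variables that are read.\<close>

lemma df_vars:
  assumes "df P" "\<And>i. i < k \<Longrightarrow> cs ! i = N" "k \<le> length cs"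
  shows "repb cs (\<lambda>e. P (\<lambda>i. if i < k then bi (e i) else zero'))"
proof -
  obtain m where m: "repb (replicate m N) (\<lambda>e. P (\<lambda>i. bi (e i)))" using assms(1) df_def by blast
  have "repb cs (\<lambda>e. P (\<lambda>i. bi ((if i < k then e i else zr))))"
    unfolding repb_def
  proof (rule rep_subst[OF m[unfolded repb_def], where t = "\<lambda>i e. if i < k then e i else zr"])
    fix i assume "i < length (replicate m N)"
    then show "rep cs (replicate m N ! i) (\<lambda>e. if i < k then e i else zr)"
      using assms(2,3) by (cases "i < k") (auto intro: rep_num)
  qed
  moreover have "bi (if i < k then a else zr) = (if i < k then bi a else zero')" for i a
    by (simp add: zero'_def)
  ultimately show ?thesis by simp
qed

sublocale arith_model zero' suc' plus' times' df
proof
  show "suc' a \<noteq> zero'" for a using succ_neq[of "nb a"] nb_ops by (metis nb_type)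
  show "suc' a = suc' b \<Longrightarrow> a = b" for a b
    using succ_inject[of "nb a" "nb b"] nb_ops(2) nb_inject by (metis nb_type)
  show "plus' a zero' = a" for a by (simp add: nb_inject[symmetric] nb_ops pls_zero)
  show "plus' a (suc' b) = suc' (plus' a b)" for a b
    by (simp add: nb_inject[symmetric] nb_ops pls_succ)
  show "times' a zero' = zero'" for a by (simp add: nb_inject[symmetric] nb_ops tms_zero)
  show "times' a (suc' b) = plus' a (times' a b)" for a b
    by (simp add: nb_inject[symmetric] nb_ops tms_succ)
  have "repb [N, N] (\<lambda>e. e 0 = e 1)" by (intro repb_eq rep_num) auto
  then have "repb [N, N] (\<lambda>e. bi (e 0) = bi (e 1))"
    by (rule repb_cong) (simp add: bi_inject)
  then have "repb (replicate 2 N) (\<lambda>e. bi (e 0) = bi (e 1))" by (simp add: numeral_2_eq_2)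
  then show "df (\<lambda>e. e 0 = e 1)" unfolding df_def by blast
  show "df (\<lambda>_. False)" unfolding df_def by (blast intro: repb_False)
next
  fix P Q assume "df P" "df Q"
  then obtain k where "repb (replicate k N) (\<lambda>e. P (\<lambda>i. bi (e i)))"
    "repb (replicate k N) (\<lambda>e. Q (\<lambda>i. bi (e i)))"
    unfolding df_def repb_def using rep_common by blast
  from repb_imp[OF this] show "df (\<lambda>e. P e \<longrightarrow> Q e)" unfolding df_def by blast
next
  fix P assume "df P"
  then obtain k where "repb (replicate k N) (\<lambda>e. P (\<lambda>i. bi (e i)))" unfolding df_def by blast
  then have "repb (replicate (Suc k) N) (\<lambda>e. P (\<lambda>i. bi (e i)))"
    unfolding repb_def by (rule rep_more) simp
  then have "repb (N # replicate k N) (\<lambda>e. P (\<lambda>i. bi (e i)))" by simp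
  from repb_all[OF this]
  have "repb (replicate k N) (\<lambda>e. \<forall>n. P (\<lambda>i. bi (case_nat (nb n) e i)))" by (simp add: D_N)
  moreover have "(\<lambda>i. bi (case_nat (nb n) e i)) = case_nat n (\<lambda>i. bi (e i))" for n e
    by (auto split: nat.split)
  ultimately show "df (\<lambda>e. \<forall>n. P (case_nat n e))" unfolding df_def by auto
next
  fix P :: "(nat \<Rightarrow> nat) \<Rightarrow> bool" and t :: "nat \<Rightarrow> (nat \<Rightarrow> nat) \<Rightarrow> nat"
  assume "df P" and t: "\<And>i. art (t i)"
  then obtain k where k: "repb (replicate k N) (\<lambda>e. P (\<lambda>i. bi (e i)))" unfolding df_def by blast
  obtain f where f: "\<And>i. rep (replicate (f i) N) N (\<lambda>e. nb (t i (\<lambda>j. bi (e j))))"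
    using art_rep[OF t] by metis
  define m where "m = Max (insert 0 (f ` {..<k}))"
  have "rep (replicate m N) N (\<lambda>e. nb (t i (\<lambda>j. bi (e j))))" if "i < k" for i
    by (rule rep_more[OF f[of i]]) (use that in \<open>simp add: m_def\<close>)
  then have "repb (replicate m N) (\<lambda>e. P (\<lambda>i. bi (nb (t i (\<lambda>j. bi (e j))))))"
    unfolding repb_def
    by (intro rep_subst[OF k[unfolded repb_def], where t = "\<lambda>i e. nb (t i (\<lambda>j. bi (e j)))"]) auto
  then show "df (\<lambda>e. P (\<lambda>i. t i e))" unfolding df_def by auto
next
  fix R :: "nat \<Rightarrow> bool" and n assume d: "df (\<lambda>e. R (e 0))"
    and z: "R zero'" and s: "\<And>n. R n \<Longrightarrow> R (suc' n)"
  \<comment> \<open>That the characteristic function of \<open>R\<close> is constantly 1 is an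
    equation, so quantifier-free induction covers every definable \<open>R\<close>.\<close>
  have "repb [N] (\<lambda>e. R (bi (e 0)))" using df_vars[OF d, of 1 "[N]"] by simp
  then have "(if R (bi (nb n)) then on else zr) = on"
    unfolding repb_def
  proof (rule induct_eq[where F = "\<lambda>a. if R (bi a) then on else zr" and G = "\<lambda>_. on"])
    show "(if R (bi zr) then on else zr) = on" using z by (simp add: zero'_def)
    fix a assume a: "a \<in> D N" "(if R (bi a) then on else zr) = on"
    then have "R (bi a)" using succ_neq[of zr] by (auto split: if_splits)
    from s[OF this] show "(if R (bi (sc a)) then on else zr) = on" using a by (simp add: suc'_def)
  qed auto
  then show "R n" using succ_neq[of zr] by (auto split: if_splits)
qed

section \<open>Sets, relations and comprehension in a model\<close>

definition "st f = (\<lambda>n. ap f (nb n) = on)"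
definition "rl f = (\<lambda>m n. ap (ap f (nb m)) (nb n) = on)"

definition "nenv e = (\<lambda>x. bi (e (x, N)))"
definition "senv e = (\<lambda>X. st (e (X, Pt)))"
definition "renv e = (\<lambda>X. rl (e (X, Bn)))"

abbreviation "ssat \<equiv> sat D ap ct (=)"

lemma val_tr_tm: "typed_env D e \<Longrightarrow> val ap ct e (tr_tm t) = nb (gval (nenv e) t)"
  by (induction t) (auto simp: nenv_def typed_env_def val_Plus val_Times nb_ops)

lemma env_upd:
  "nenv (e((x, N) := nb n)) = (nenv e)(x := n)"
  "senv (e((x, N) := a)) = senv e" "renv (e((x, N) := a)) = renv e"
  by (auto simp: nenv_def senv_def renv_def)

lemma sat_Less:
  assumes "val ap ct e s = nb m" "val ap ct e t = nb n"
  shows "ssat e (s \<^bold>< t) \<longleftrightarrow> lt m n"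
proof -
  have "val ap ct (e((fresh s t, N) := a)) s = nb m" "val ap ct (e((fresh s t, N) := a)) t = nb n" for a
    using assms by (simp_all add: val_fresh width_fresh)
  then show ?thesis
    by (simp add: Less_def D_N val_Plus lt_def nb_ops[symmetric] nb_inject)
qed

lemma sat_tr: "typed_env D e \<Longrightarrow> ssat e (tr p) \<longleftrightarrow> gsat (nenv e) (senv e) (renv e) p"
proof (induction p arbitrary: e)
  case (ALess s t)
  then show ?case using sat_Less[OF val_tr_tm val_tr_tm] by simp
next
  case (AAll x p)
  have "ssat (e((x, N) := nb n)) (tr p) \<longleftrightarrow> gsat ((nenv e)(x := n)) (senv e) (renv e) p" for n
    using AAll.IH[of "e((x, N) := nb n)"] AAll.prems by (simp add: env_upd del: fun_upd_apply)
  then show ?case by (simp add: D_N)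
qed (auto simp: val_tr_tm nb_inject Mem_def Mem2_def senv_def st_def renv_def rl_def)

lemma df_st: "f \<in> D Pt \<Longrightarrow> art t \<Longrightarrow> df (\<lambda>e. st f (t e))"
proof (rule df_at)
  assume f: "f \<in> D Pt"
  have "repb [N] (\<lambda>e. ap f (e 0) = on)"
    by (rule repb_eq[OF rep_app[OF rep_const[OF f] rep_num] rep_const]) auto
  then have "repb [N] (\<lambda>e. st f (bi (e 0)))" by (rule repb_cong) (simp add: st_def)
  then have "repb (replicate 1 N) (\<lambda>e. st f (bi (e 0)))" by simp
  then show "df (\<lambda>e. st f (e 0))" unfolding df_def by blast
qed

lemma df_rl: "f \<in> D Bn \<Longrightarrow> art s \<Longrightarrow> art t \<Longrightarrow> df (\<lambda>e. rl f (s e) (t e))"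
proof (rule df_at2)
  assume f: "f \<in> D Bn"
  have "repb [N, N] (\<lambda>e. ap (ap f (e 1)) (e 0) = on)"
    by (rule repb_eq[OF rep_app[OF rep_app[OF rep_const[OF f] rep_num] rep_num] rep_const]) auto
  then have "repb [N, N] (\<lambda>e. rl f (bi (e 1)) (bi (e 0)))" by (rule repb_cong) (simp add: rl_def)
  then have "repb (replicate 2 N) (\<lambda>e. rl f (bi (e 1)) (bi (e 0)))" by (simp add: numeral_2_eq_2)
  then show "df (\<lambda>e. rl f (e 1) (e 0))" unfolding df_def by blast
qed

lemma comprehension:
  assumes "df (\<lambda>e. P (e 0))"
  obtains f where "f \<in> D Pt" "\<And>n. ap f (nb n) = (if P n then on else zr)"
proof -
  have "repb [N] (\<lambda>e. P (bi (e 0)))" using df_vars[OF assms, of 1 "[N]"] by simp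
  then obtain f where "f \<in> D Pt" "\<And>a. a \<in> D N \<Longrightarrow> ap f a = (if P (bi a) then on else zr)"
    unfolding repb_def using rep_elem[of N N "\<lambda>a. if P (bi a) then on else zr"] by blast
  then show ?thesis using that by simp
qed

lemma comprehension2:
  assumes "df (\<lambda>e. P (e 1) (e 0))"
  obtains f where "f \<in> D Bn" "\<And>m n. ap (ap f (nb m)) (nb n) = (if P m n then on else zr)"
proof -
  have "cs ! i = N" if "i < 2" "cs = [N, N]" for i cs using that by (auto simp: less_2_cases_iff)
  then have "repb [N, N] (\<lambda>e. P (bi (e 1)) (bi (e 0)))"
    using df_vars[OF assms, of 2 "[N, N]"] by simp
  then obtain f where "f \<in> D Bn"
      "\<And>a b. a \<in> D N \<Longrightarrow> b \<in> D N \<Longrightarrow> ap (ap f a) b = (if P (bi a) (bi b) then on else zr)"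
    unfolding repb_def using rep_elem2[of N N N "\<lambda>a b. if P (bi a) (bi b) then on else zr"] by blast
  then show ?thesis using that by simp
qed

lemma function_comprehension:
  assumes "df (\<lambda>e. P (e 1) (e 0))" "\<And>m. \<exists>!n. P m n"
  obtains f where "f \<in> D Pt" "\<And>m. P m (bi (ap f (nb m)))"
proof -
  have "cs ! i = N" if "i < 2" "cs = [N, N]" for i cs using that by (auto simp: less_2_cases_iff)
  then have "repb [N, N] (\<lambda>e. P (bi (e 1)) (bi (e 0)))"
    using df_vars[OF assms(1), of 2 "[N, N]"] by simp
  moreover have ex1: "\<exists>!n. n \<in> D N \<and> P m (bi n)" for m
    using assms(2)[of m] unfolding D_N by (metis bi_nb rangeE rangeI)
  ultimately have "rep [N] N (\<lambda>e. THE n. n \<in> D N \<and> P (bi (case_nat n e 1)) (bi (case_nat n e 0)))"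
    by (intro rep_unique) auto
  then have "rep [N] N (\<lambda>e. THE n. n \<in> D N \<and> P (bi (e 0)) (bi n))" by simp
  then obtain f where f: "f \<in> D Pt" "\<And>a. a \<in> D N \<Longrightarrow> ap f a = (THE n. n \<in> D N \<and> P (bi a) (bi n))"
    using rep_elem[of N N "\<lambda>a. THE n. n \<in> D N \<and> P (bi a) (bi n)"] by blast
  have "P m (bi (ap f (nb m)))" for m
    using theI'[OF ex1[of m]] f(2)[of "nb m"] by simp
  then show ?thesis using f that by blast
qed

lemma num_quant_tr: "num_quant (tr p)"
  by (induction p) (auto simp: Less_def Mem_def Mem2_def)

lemma ex_env: "\<exists>e. typed_env D e"
proof -
  have "typed_env D (\<lambda>(x, \<rho>). SOME a. a \<in> D \<rho>)"
    using inhabited by (auto simp: typed_env_def some_in_eq)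
  then show ?thesis by blast
qed

lemma setting:
  assumes "a \<in> D Pt" "r \<in> D Bn" "z \<in> D Pt" "\<And>s t. art s \<Longrightarrow> art t \<Longrightarrow> df (\<lambda>e. gs (s e) (t e))"
  shows "hier_setting zero' suc' plus' times' df (st a) (rl r) (Gam \<Gamma> (st z)) gs"
  by standard (use assms df_st df_rl df_Gam in auto)

context
  fixes \<Gamma> :: afm
  assumes \<Gamma>: "arith_in {''n''} {''Z''} {''X''} \<Gamma>"
begin

lemma formula: "arith_formula \<Gamma>"
  by standard (rule \<Gamma>)

text \<open>\<open>df\<close> has number variables only, while \<open>G\<close> takes sets and a
  relation. So the context is mixed: \<open>rep_unique\<close> finds the value with these arguments
  as variables, and \<open>rep_lam\<close> abstracts them one at a time.\<close>

lemma ex_G: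
  obtains G where "G \<in> D GTy"
    "\<And>g a r z m. g \<in> D Pt \<Longrightarrow> a \<in> D Pt \<Longrightarrow> r \<in> D Bn \<Longrightarrow> z \<in> D Pt \<Longrightarrow> 
      ap (ap (ap (ap G g) a) r) z = nb m \<longleftrightarrow> least_bound (st a) (rl r) (Gam \<Gamma> (st z)) (st g) m"
proof -
  obtain e0 where e0: "typed_env D e0" using ex_env by blast
  \<comment> \<open>The context lists the innermost variable first: \<open>e 0\<close> is the value
    sought, and \<open>e 4\<close> is \<open>g\<close>, which is abstracted last and hence becomes
    the first argument of \<open>G\<close>.\<close>
  define asg where "asg = (\<lambda>e :: nat \<Rightarrow> 'a. e0((''m'', N) := e 0, (''Z'', Pt) := e 1, (''L'', Bn) := e 2,
    (''A'', Pt) := e 3, (''g'', Pt) := e 4))"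
  let ?cs = "[Pt, Bn, Pt, Pt]"
  define P where "P e = ssat (asg e) (tr (G_formula \<Gamma>))" for e :: "nat \<Rightarrow> 'a"
  have P: "P e \<longleftrightarrow> least_bound (st (e 3)) (rl (e 2)) (Gam \<Gamma> (st (e 1))) (st (e 4)) (bi (e 0))"
    if "typed (N # ?cs) e" for e
  proof -
    have "typed_env D (asg e)"
      using that e0 unfolding asg_def by (auto simp: numeral_eq_Suc intro!: typed_env_upd)
    then have "P e \<longleftrightarrow> gsat (nenv (asg e)) (senv (asg e)) (renv (asg e)) (G_formula \<Gamma>)"
      unfolding P_def by (rule sat_tr)
    then show ?thesis
      unfolding arith_formula.sat_G[OF formula] by (simp add: nenv_def senv_def renv_def asg_def)
  qed
  have rep: "repb (N # ?cs) P"
    unfolding P_def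
  proof (rule repb_sat[OF wf_tr num_quant_tr])
    have v: "rep (N # ?cs) \<rho> (\<lambda>e. e i)" if "i < 5" "\<rho> = (N # ?cs) ! i" for i \<rho>
      using that by (intro rep_var) auto
    show "rep (N # ?cs) \<sigma> (\<lambda>e. asg e (x, \<sigma>))" for x \<sigma>
      using e0 unfolding asg_def
      by (cases "(x, \<sigma>) \<in> {(''m'', N), (''Z'', Pt), (''L'', Bn), (''A'', Pt), (''g'', Pt)}")
        (auto intro!: v rep_const simp: typed_env_def simp del: rep.simps)
  qed
  have ex1: "\<exists>!n. n \<in> D N \<and> P (case_nat n e)" if e: "typed ?cs e" for e
  proof -
    have t: "e 0 \<in> D Pt" "e 1 \<in> D Bn" "e 2 \<in> D Pt" "e 3 \<in> D Pt"
      using e by (auto simp: numeral_eq_Suc)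
    interpret hier_setting zero' suc' plus' times' df "st (e 2)" "rl (e 1)" "Gam \<Gamma> (st (e 0))" "\<lambda>_. st (e 3)"
      by (rule setting) (use t df_st in auto)
    have *: "P (case_nat (nb n) e) \<longleftrightarrow> least_bound (st (e 2)) (rl (e 1)) (Gam \<Gamma> (st (e 0))) (st (e 3)) n" for n
      using e by (subst P) (auto simp: numeral_eq_Suc)
    obtain n where n: "least_bound (st (e 2)) (rl (e 1)) (Gam \<Gamma> (st (e 0))) (st (e 3)) n"
      "\<And>m. least_bound (st (e 2)) (rl (e 1)) (Gam \<Gamma> (st (e 0))) (st (e 3)) m \<Longrightarrow> m = n"
      using least_bound_unique by blast
    show ?thesis
    proof (rule ex1I)
      show "nb n \<in> D N \<and> P (case_nat (nb n) e)" using * n by blast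
      fix x assume x: "x \<in> D N \<and> P (case_nat x e)"
      then have "P (case_nat (nb (bi x)) e)" by simp
      then have "bi x = n" using * n(2) by blast
      then show "x = nb n" using x by auto
    qed
  qed
  let ?F = "\<lambda>e. THE n. n \<in> D N \<and> P (case_nat n e)"
  have F: "rep ?cs N ?F" by (rule rep_unique[OF rep ex1])
  obtain F1 where F1: "rep [Bn, Pt, Pt] (Pt \<^bold>\<rightarrow> N) F1"
    "\<And>e x. typed [Bn, Pt, Pt] e \<Longrightarrow> x \<in> D Pt \<Longrightarrow> ap (F1 e) x = ?F (case_nat x e)"
    using rep_lam[OF F] by blast
  obtain F2 where F2: "rep [Pt, Pt] (Bn \<^bold>\<rightarrow> Pt \<^bold>\<rightarrow> N) F2"
    "\<And>e x. typed [Pt, Pt] e \<Longrightarrow> x \<in> D Bn \<Longrightarrow> ap (F2 e) x = F1 (case_nat x e)"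
    using rep_lam[OF F1(1)] by blast
  obtain F3 where F3: "rep [Pt] (Pt \<^bold>\<rightarrow> Bn \<^bold>\<rightarrow> Pt \<^bold>\<rightarrow> N) F3"
    "\<And>e x. typed [Pt] e \<Longrightarrow> x \<in> D Pt \<Longrightarrow> ap (F3 e) x = F2 (case_nat x e)"
    using rep_lam[OF F2(1)] by blast
  obtain F4 where F4: "rep [] GTy F4"
    "\<And>e x. typed [] e \<Longrightarrow> x \<in> D Pt \<Longrightarrow> ap (F4 e) x = F3 (case_nat x e)"
    using rep_lam[OF F3(1)] by blast
  define G where "G = F4 undefined"
  have G: "G \<in> D GTy" using rep_type[OF F4(1)] by (simp add: G_def)
  have "ap (ap (ap (ap G g) a) r) z = nb m \<longleftrightarrow> least_bound (st a) (rl r) (Gam \<Gamma> (st z)) (st g) m"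
    if t: "g \<in> D Pt" "a \<in> D Pt" "r \<in> D Bn" "z \<in> D Pt" for g a r z m
  proof -
    define e where "e = case_nat z (case_nat r (case_nat a (case_nat g undefined)))"
    have e: "typed ?cs e" using t by (simp add: e_def)
    have "ap (ap (ap (ap G g) a) r) z = ?F e"
      unfolding G_def e_def using t by (simp add: F4(2) F3(2) F2(2) F1(2))
    moreover have "?F e = nb m \<longleftrightarrow> P (case_nat (nb m) e)"
      using theI'[OF ex1[OF e]] ex1[OF e] by (metis nb_type)
    moreover have "P (case_nat (nb m) e) \<longleftrightarrow> least_bound (st a) (rl r) (Gam \<Gamma> (st z)) (st g) m"
      using e t by (subst P) (auto simp: e_def numeral_eq_Suc)
    ultimately show ?thesis by simp
  qed
  then show ?thesis using that G by blast
qed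

end

end

section \<open>From the axioms to the properties of their models\<close>

lemma (in applicative) peq_imp_eq:
  assumes "\<And>f g \<sigma> \<tau>. f \<in> D (\<sigma> \<^bold>\<rightarrow> \<tau>) \<Longrightarrow> g \<in> D (\<sigma> \<^bold>\<rightarrow> \<tau>) \<Longrightarrow>
        (\<And>a. a \<in> D \<sigma> \<Longrightarrow> ap f a = ap g a) \<Longrightarrow> f = g"
  shows "a \<in> D \<rho> \<Longrightarrow> b \<in> D \<rho> \<Longrightarrow> peq D ap (=) \<rho> a b \<Longrightarrow> a = b"
proof (induction \<rho> arbitrary: a b)
  case (Fun \<sigma> \<tau>)
  show ?case
    by (rule assms[OF Fun.prems(1,2)]) (use Fun ap_type in auto)
qed simp

lemma sat_inductionD:
  assumes "sat D ap ct Q e (p \<^bold>\<and> Forall x N (q \<^bold>\<longrightarrow> r) \<^bold>\<longrightarrow> Forall x N q)" "sat D ap ct Q e p"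
    and "\<And>b. b \<in> D N \<Longrightarrow> sat D ap ct Q (e((x, N) := b)) q \<Longrightarrow> sat D ap ct Q (e((x, N) := b)) r"
    and "a \<in> D N"
  shows "sat D ap ct Q (e((x, N) := a)) q"
  using assms by simp

lemma (in henkin_names) model_of_ACA0_omega:
  assumes "applicative D ap ct" and ne: "\<And>\<rho>. D \<rho> \<noteq> {}"
    and ext: "\<And>f g \<sigma> \<tau>. f \<in> D (\<sigma> \<^bold>\<rightarrow> \<tau>) \<Longrightarrow> g \<in> D (\<sigma> \<^bold>\<rightarrow> \<tau>) \<Longrightarrow>
        (\<And>a. a \<in> D \<sigma> \<Longrightarrow> ap f a = ap g a) \<Longrightarrow> f = g"
    and sat: "\<And>p e. p \<in> ACA0_omega \<Longrightarrow> plain p \<Longrightarrow> typed_env D e \<Longrightarrow> sat D ap ct (=) e p"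
  shows "fin_model D ap ct"
proof -
  interpret applicative D ap ct by fact
  have ax: "sat D ap ct (=) e p" if "p \<in> E_PRA" "plain p" "typed_env D e" for p e
    using sat that by (simp add: ACA0_omega_def RCA0_omega_def)
  have "typed_env D (\<lambda>(x, \<rho>). SOME a. a \<in> D \<rho>)"
    using ne by (auto simp: typed_env_def some_in_eq)
  then obtain e0 where e0: "typed_env D e0" by blast
  have ct: "ct Zero \<in> D N" "ct Succ \<in> D Pt" "ct (KPi \<rho> \<sigma>) \<in> D (\<rho> \<^bold>\<rightarrow> \<sigma> \<^bold>\<rightarrow> \<rho>)"
    "ct (KSig \<rho> \<sigma> \<tau>) \<in> D ((\<rho> \<^bold>\<rightarrow> \<sigma> \<^bold>\<rightarrow> \<tau>) \<^bold>\<rightarrow> (\<rho> \<^bold>\<rightarrow> \<sigma>) \<^bold>\<rightarrow> \<rho> \<^bold>\<rightarrow> \<tau>)" for \<rho> \<sigma> \<tau>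
    by (auto intro!: ct_type)
  show ?thesis
  proof
    show "f = g" if "f \<in> D (\<sigma> \<^bold>\<rightarrow> \<tau>)" "g \<in> D (\<sigma> \<^bold>\<rightarrow> \<tau>)" "\<And>a. a \<in> D \<sigma> \<Longrightarrow> ap f a = ap g a"
      for f g \<sigma> \<tau> using that by (rule ext)
    show "D \<rho> \<noteq> {}" for \<rho> by (rule ne)
  next
    fix a assume "a \<in> D N"
    then show "ap (ct Succ) a \<noteq> ct Zero"
      using ax[OF E_PRA.succ_zero, of "e0((''x'', N) := a)"] e0 by (simp add: plain_def)
  next
    fix a b assume "a \<in> D N" "b \<in> D N" "ap (ct Succ) a = ap (ct Succ) b"
    then show "a = b"
      using ax[OF E_PRA.succ_inj, of "e0((''x'', N) := a, (''y'', N) := b)"] e0 by (simp add: plain_def)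
  next
    fix a b \<rho> \<sigma> assume ab: "a \<in> D \<rho>" "b \<in> D \<sigma>"
    have "sat D ap ct (=) (e0((''x'', \<rho>) := a, (''y'', \<sigma>) := b))
        (eq_at \<rho> (KPi \<rho> \<sigma> \<^bold>\<cdot> Var ''x'' \<rho> \<^bold>\<cdot> Var ''y'' \<sigma>) (Var ''x'' \<rho>))"
      by (rule ax[OF E_PRA.pi plain_eq_at]) (use ab e0 in simp_all)
    then have "peq D ap (=) \<rho> (ap (ap (ct (KPi \<rho> \<sigma>)) a) b) a" by (simp add: sat_eq_at)
    then show "ap (ap (ct (KPi \<rho> \<sigma>)) a) b = a"
      by (rule peq_imp_eq[OF ext, rotated -1]) (use ab ap_type[OF ap_type[OF ct(3)]] in blast)+
  next
    fix f g a \<rho> \<sigma> \<tau>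
    assume f: "f \<in> D (\<rho> \<^bold>\<rightarrow> \<sigma> \<^bold>\<rightarrow> \<tau>)" and g: "g \<in> D (\<rho> \<^bold>\<rightarrow> \<sigma>)" and a: "a \<in> D \<rho>"
    have "sat D ap ct (=) (e0((''x'', \<rho> \<^bold>\<rightarrow> \<sigma> \<^bold>\<rightarrow> \<tau>) := f, (''y'', \<rho> \<^bold>\<rightarrow> \<sigma>) := g, (''z'', \<rho>) := a))
        (eq_at \<tau>
       (KSig \<rho> \<sigma> \<tau> \<^bold>\<cdot> Var ''x'' (\<rho> \<^bold>\<rightarrow> \<sigma> \<^bold>\<rightarrow> \<tau>) \<^bold>\<cdot> Var ''y'' (\<rho> \<^bold>\<rightarrow> \<sigma>) \<^bold>\<cdot> Var ''z'' \<rho>)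
       (Var ''x'' (\<rho> \<^bold>\<rightarrow> \<sigma> \<^bold>\<rightarrow> \<tau>) \<^bold>\<cdot> Var ''z'' \<rho> \<^bold>\<cdot> (Var ''y'' (\<rho> \<^bold>\<rightarrow> \<sigma>) \<^bold>\<cdot> Var ''z'' \<rho>)))"
      by (rule ax[OF E_PRA.sigma plain_eq_at]) (use f g a e0 in simp_all)
    then have "peq D ap (=) \<tau> (ap (ap (ap (ct (KSig \<rho> \<sigma> \<tau>)) f) g) a) (ap (ap f a) (ap g a))"
      by (simp add: sat_eq_at)
    then show "ap (ap (ap (ct (KSig \<rho> \<sigma> \<tau>)) f) g) a = ap (ap f a) (ap g a)"
      by (rule peq_imp_eq[OF ext, rotated -1])
        (use ap_type[OF ap_type[OF ap_type[OF ct(4) f] g] a] ap_type[OF ap_type[OF f a] ap_type[OF g a]] in blast)+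
  next
    fix a f assume "a \<in> D N" "f \<in> D Bn"
    then show "ap (ap (ap (ct Rec) (ct Zero)) a) f = a"
      using ax[OF E_PRA.rec_zero, of "e0((''y'', N) := a, (''z'', Bn) := f)"] e0 by (simp add: plain_def)
  next
    fix n a f assume "n \<in> D N" "a \<in> D N" "f \<in> D Bn"
    then show "ap (ap (ap (ct Rec) (ap (ct Succ) n)) a) f = ap (ap f (ap (ap (ap (ct Rec) n) a) f)) n"
      using ax[OF E_PRA.rec_succ, of "e0((''x'', N) := n, (''y'', N) := a, (''z'', Bn) := f)"] e0
      by (simp add: plain_def)
  next
    fix f g f' g' n
    assume *: "f \<in> D Pt" "g \<in> D Pt" "f' \<in> D Pt" "g' \<in> D Pt" and n: "n \<in> D N"
      and z: "ap f (ct Zero) = ap g (ct Zero) \<or> ap f' (ct Zero) = ap g' (ct Zero)"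
      and s: "\<And>n. n \<in> D N \<Longrightarrow> ap f n = ap g n \<or> ap f' n = ap g' n \<Longrightarrow>
        ap f (ap (ct Succ) n) = ap g (ap (ct Succ) n) \<or> ap f' (ap (ct Succ) n) = ap g' (ap (ct Succ) n)"
    \<comment> \<open>A disjunction of two equations between values of four function variables is
      quantifier-free, so it is an admissible induction formula.\<close>
    let ?p = "(pnt ''f'' \<^bold>\<cdot> num ''x'' \<^bold>= pnt ''g'' \<^bold>\<cdot> num ''x'')
      \<^bold>\<or> (pnt ''h'' \<^bold>\<cdot> num ''x'' \<^bold>= pnt ''k'' \<^bold>\<cdot> num ''x'')"
    let ?e = "e0((''f'', Pt) := f, (''g'', Pt) := g, (''h'', Pt) := f', (''k'', Pt) := g')"
    have ind: "sat D ap ct (=) ?e (subst ''x'' N Zero ?p \<^bold>\<and>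
        Forall ''x'' N (?p \<^bold>\<longrightarrow> subst ''x'' N (Succ \<^bold>\<cdot> num ''x'') ?p) \<^bold>\<longrightarrow> Forall ''x'' N ?p)"
    proof (rule ax[OF E_PRA.qf_induction])
      show "typed_env D ?e" using e0 * by simp
    qed (simp_all add: plain_def insert_Diff_if)
    define R where "R n \<longleftrightarrow> ap f n = ap g n \<or> ap f' n = ap g' n" for n
    have R: "sat D ap ct (=) ?e (subst ''x'' N Zero ?p) = R (ct Zero)"
      "\<And>a. sat D ap ct (=) (?e((''x'', N) := a)) ?p = R a"
      "\<And>a. sat D ap ct (=) (?e((''x'', N) := a)) (subst ''x'' N (Succ \<^bold>\<cdot> num ''x'') ?p) = R (ap (ct Succ) a)"
      by (simp_all add: R_def disj_imp)
    have "R n"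
      using sat_inductionD[OF ind _ _ n] z s unfolding R R_def by blast
    then show "ap f n = ap g n \<or> ap f' n = ap g' n" by (simp add: R_def)
  next
    have "sat D ap ct (=) e0 mu_axiom"
      by (rule sat[OF _ _ e0]) (simp_all add: ACA0_omega_def plain_def mu_axiom_def insert_Diff_if)
    then show "\<exists>mu \<in> D (Pt \<^bold>\<rightarrow> N). \<forall>f \<in> D Pt. (\<exists>n \<in> D N. ap f n = ct Zero) \<longrightarrow> ap f (ap mu f) = ct Zero"
      by (simp add: mu_axiom_def) blast
  qed
qed

section \<open>Truth of the formalised theorem in a model\<close>

context applicative
begin

lemma sat_exI: "a \<in> D \<rho> \<Longrightarrow> sat D ap ct (=) (e((x, \<rho>) := a)) p \<Longrightarrow> sat D ap ct (=) e (Exists x \<rho> p)"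
  by auto

lemma sat_allI: "(\<And>a. a \<in> D \<rho> \<Longrightarrow> sat D ap ct (=) (e((x, \<rho>) := a)) p) \<Longrightarrow> sat D ap ct (=) e (Forall x \<rho> p)"
  by auto

lemma sat_conjI: "sat D ap ct (=) e p \<Longrightarrow> sat D ap ct (=) e q \<Longrightarrow> sat D ap ct (=) e (p \<^bold>\<and> q)"
  by simp

lemma sat_disjI: "sat D ap ct (=) e p \<or> sat D ap ct (=) e q \<Longrightarrow> sat D ap ct (=) e (p \<^bold>\<or> q)"
  by auto

lemma sat_impI: "(sat D ap ct (=) e p \<Longrightarrow> sat D ap ct (=) e q) \<Longrightarrow> sat D ap ct (=) e (p \<^bold>\<longrightarrow> q)"
  by simp

lemma sat_iffI: "sat D ap ct (=) e p = sat D ap ct (=) e q \<Longrightarrow> sat D ap ct (=) e (p \<^bold>\<longleftrightarrow> q)"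
  by simp

end

text \<open>The successor is injective and misses zero, which is impossible on a finite set.
  Infinity turns the countable set \<open>D N\<close> into a bijective copy of
  \<open>nat\<close>.\<close>

lemma (in fin_model) infinite_num: "infinite (D N)"
proof
  assume fin: "finite (D N)"
  have "sc ` D N \<subseteq> D N" "inj_on sc (D N)" by (auto simp: inj_on_def succ_inject)
  then have "sc ` D N = D N" using fin by (simp add: endo_inj_surj)
  then obtain a where "a \<in> D N" "zr = sc a" using const_type(1) by (metis imageE)
  then show False using succ_neq by metis
qed

context coded_model
begin

lemma ball_N: "(\<forall>a\<in>D N. P a) \<longleftrightarrow> (\<forall>n. P (nb n))"
  by (simp add: D_N)

lemma sat_Less_typed:
  assumes "has_ty s N" "has_ty t N" "typed_env D e"
  shows "ssat e (s \<^bold>< t) \<longleftrightarrow> lt (bi (val ap ct e s)) (bi (val ap ct e t))"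
  using sat_Less[of e s _ t] val_type[OF assms(1,3)] val_type[OF assms(2,3)] by simp

lemma sat_is_bin: "f \<in> D Bn \<Longrightarrow> (\<And>m n. ap (ap f (nb m)) (nb n) = zr \<or> ap (ap f (nb m)) (nb n) = on) \<Longrightarrow>
    e (X, Bn) = f \<Longrightarrow> ssat e (is_bin X)"
  by (simp add: is_bin_def ball_N) blast

lemma sat_is_pnt: "ssat e (is_pnt X) \<longleftrightarrow>
    (\<forall>n. ap (e (X, Pt)) (nb n) = zr \<or> ap (e (X, Pt)) (nb n) = on)"
  by (auto simp: is_pnt_def D_N)

lemma sat_total_ordering:
  assumes "ssat e total_ordering_fm"
  defines "A \<equiv> st (e (''A'', Pt))" and "L \<equiv> rl (e (''L'', Bn))"
  shows "L a b \<Longrightarrow> A a \<and> A b" "\<not> L a a" "L a b \<Longrightarrow> L b c \<Longrightarrow> L a c"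
    "A a \<Longrightarrow> A b \<Longrightarrow> a = b \<or> L a b \<or> L b a"
proof -
  have *: "(\<forall>a b. L a b \<longrightarrow> A a \<and> A b) \<and> (\<forall>a. \<not> L a a) \<and> (\<forall>a b c. L a b \<longrightarrow> L b c \<longrightarrow> L a c) \<and>
      (\<forall>a b. A a \<longrightarrow> A b \<longrightarrow> a = b \<or> L a b \<or> L b a)"
    using assms(1) unfolding A_def L_def
    by (simp add: total_ordering_fm_def Mem_def Mem2_def D_N st_def rl_def nb_inject)
  show "L a b \<Longrightarrow> A a \<and> A b" using * by simp
  show "\<not> L a a" using * by simp
  show "L a b \<Longrightarrow> L b c \<Longrightarrow> L a c" using * by blast
  show "A a \<Longrightarrow> A b \<Longrightarrow> a = b \<or> L a b \<or> L b a" using * by blast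
qed

lemma env_simps:
  "typed_env D e \<Longrightarrow> e (X, Pt) \<in> D Pt" "typed_env D e \<Longrightarrow> e (X, Bn) \<in> D Bn"
  "typed_env D e \<Longrightarrow> e (X, N) \<in> D N" "typed_env D e \<Longrightarrow> e (X, GTy) \<in> D GTy"
  by (auto simp: typed_env_def)

text \<open>\<open>covers_fm\<close> speaks about 0-1-valued functions of the model, and
  \<open>comprehension\<close> supplies the definable predicates in this form.\<close>

lemma sat_covers:
  assumes e: "typed_env D e" and cov: "ssat e covers_fm"
    and f: "f \<in> D Pt" "\<And>n. ap f (nb n) = zr \<or> ap f (nb n) = on"
  defines "F \<equiv> \<lambda>i. bi (ap (ap (ap (ap (e (''G'', GTy)) (ap (e (''gs'', Bn)) (nb i))) (e (''A'', Pt)))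
      (e (''L'', Bn))) (e (''Z'', Pt)))"
  shows "\<exists>i. lt i (bi (e (''l'', N))) \<and> (\<forall>k. lt k (F i) \<longrightarrow> st f k = rl (e (''gs'', Bn)) i k)"
proof -
  let ?e = "e((''f'', Pt) := f)"
  have fe: "typed_env D ?e" using e f by simp
  have "ssat ?e (is_pnt ''f'')" using f by (simp add: sat_is_pnt)
  then have "ssat ?e (Exists ''i'' N (num ''i'' \<^bold>< num ''l'' \<^bold>\<and>
         Forall ''k'' N (num ''k'' \<^bold>< G_app (bin ''gs'' \<^bold>\<cdot> num ''i'') \<^bold>\<longrightarrow>
           pnt ''f'' \<^bold>\<cdot> num ''k'' \<^bold>= bin ''gs'' \<^bold>\<cdot> num ''i'' \<^bold>\<cdot> num ''k'')))"
    using cov f(1) unfolding covers_fm_def by simp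
  then obtain i where i: "ssat (?e((''i'', N) := nb i)) (num ''i'' \<^bold>< num ''l'')"
      "\<And>k. ssat (?e((''i'', N) := nb i, (''k'', N) := nb k)) (num ''k'' \<^bold>< G_app (bin ''gs'' \<^bold>\<cdot> num ''i'')) \<Longrightarrow>
        ap f (nb k) = ap (ap (e (''gs'', Bn)) (nb i)) (nb k)"
    by (auto simp: D_N)
  have ti: "typed_env D (?e((''i'', N) := nb i))" by (rule typed_env_upd[OF fe nb_type])
  have tk: "typed_env D (?e((''i'', N) := nb i, (''k'', N) := nb k))" for k
    by (rule typed_env_upd[OF ti nb_type])
  have "lt i (bi (e (''l'', N)))"
    using i(1) sat_Less_typed[OF _ _ ti, of "num ''i''" "num ''l''"] by simp
  moreover have "st f k = rl (e (''gs'', Bn)) i k" if "lt k (F i)" for k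
    using i(2)[of k] sat_Less_typed[OF _ _ tk, of "num ''k''" "G_app (bin ''gs'' \<^bold>\<cdot> num ''i'')" k] that
    by (simp add: F_def G_app_def st_def rl_def)
  ultimately show ?thesis by blast
qed

lemma sat_descending:
  assumes "\<And>k. st (e (''A'', Pt)) (bi (ap h (nb k))) \<and> rl (e (''L'', Bn)) (bi (ap h (nb (suc' k)))) (bi (ap h (nb k)))"
    and "e (''h'', Pt) = h" "h \<in> D Pt"
  shows "ssat e descending_fm"
  using assms ap_type[OF assms(3)]
  by (simp add: descending_fm_def Mem_def Mem2_def ball_N st_def rl_def nb_ops)

context
  fixes \<Gamma> :: afm
  assumes \<Gamma>: "arith_in {''n''} {''Z''} {''X''} \<Gamma>"
begin

lemma sat_hierarchy:
  assumes e: "typed_env D e"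
    and H: "\<And>a n. st (e (''A'', Pt)) a \<Longrightarrow> rl (e (''Y'', Bn)) a n =
      Gam \<Gamma> (st (e (''Z'', Pt))) n (\<lambda>b m. rl (e (''Y'', Bn)) b m \<and> rl (e (''L'', Bn)) b a)"
  shows "ssat e (hierarchy_fm \<Gamma>)"
  unfolding hierarchy_fm_def
proof (rule sat_allI, rule sat_impI)
  fix a' assume "a' \<in> D N" and A: "ssat (e((''a'', N) := a')) (num ''a'' \<^bold>\<in> pnt ''A'')"
  then obtain a where a: "a' = nb a" by (auto simp: D_N)
  \<comment> \<open>\<open>hierarchy_fm\<close> quantifies over a relation \<open>X\<close> for the
    part of \<open>Y\<close> below \<open>a\<close>; comprehension supplies it, with
    \<open>a\<close> as a parameter.\<close>
  have "df (\<lambda>e'. rl (e (''Y'', Bn)) (e' 1) (e' 0) \<and> rl (e (''L'', Bn)) (e' 1) a)"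
    using env_simps(2)[OF e] by (intro df_and df_rl art.intros)
  from comprehension2[OF this] obtain X where X: "X \<in> D Bn" "\<And>b m. ap (ap X (nb b)) (nb m) =
      (if rl (e (''Y'', Bn)) b m \<and> rl (e (''L'', Bn)) b a then on else zr)" by blast
  have rX: "rl X = (\<lambda>b m. rl (e (''Y'', Bn)) b m \<and> rl (e (''L'', Bn)) b a)"
    using X(2) succ_neq[of zr] by (auto simp: rl_def intro!: ext)
  have sA: "st (e (''A'', Pt)) a" using A by (simp add: a Mem_def st_def)
  let ?e = "e((''a'', N) := a', (''X'', Bn) := X)"
  have te: "typed_env D ?e" using e X \<open>a' \<in> D N\<close> by (intro typed_env_upd)
  show "ssat (e((''a'', N) := a')) (Exists ''X'' Bn
         (is_bin ''X'' \<^bold>\<and>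
          Forall ''b'' N (Forall ''m'' N
            (Mem2 (num ''b'') (num ''m'') (bin ''X'') \<^bold>\<longleftrightarrow>
             Mem2 (num ''b'') (num ''m'') (bin ''Y'') \<^bold>\<and>
             Mem2 (num ''b'') (num ''a'') (bin ''L''))) \<^bold>\<and>
          Forall ''n'' N (Mem2 (num ''a'') (num ''n'') (bin ''Y'') \<^bold>\<longleftrightarrow> tr \<Gamma>)))"
  proof (rule sat_exI[OF X(1)], rule sat_conjI[OF _ sat_conjI])
    show "ssat ?e (is_bin ''X'')" using X by (intro sat_is_bin[OF X(1)]) auto
    show "ssat ?e (Forall ''b'' N (Forall ''m'' N
            (Mem2 (num ''b'') (num ''m'') (bin ''X'') \<^bold>\<longleftrightarrow>
             Mem2 (num ''b'') (num ''m'') (bin ''Y'') \<^bold>\<and>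
             Mem2 (num ''b'') (num ''a'') (bin ''L''))))"
    proof -
      have "on \<noteq> zr" "zr \<noteq> on" using succ_neq[of zr] by auto
      then show ?thesis by (simp add: ball_N Mem2_def X(2) a rl_def)
    qed
    show "ssat ?e (Forall ''n'' N (Mem2 (num ''a'') (num ''n'') (bin ''Y'') \<^bold>\<longleftrightarrow> tr \<Gamma>))"
    proof (rule sat_allI, rule sat_iffI)
      fix n' assume n': "n' \<in> D N"
      then obtain n where n: "n' = nb n" by (auto simp: D_N)
      let ?e' = "?e((''n'', N) := n')"
      have te': "typed_env D ?e'" using te n' by (rule typed_env_upd)
      have "ssat ?e' (tr \<Gamma>) \<longleftrightarrow> Gam \<Gamma> (st (e (''Z'', Pt))) n (rl X)"
        unfolding sat_tr[OF te'] gsat_Gam[OF \<Gamma>] by (simp add: nenv_def senv_def renv_def n)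
      moreover have "ssat ?e' (Mem2 (num ''a'') (num ''n'') (bin ''Y'')) = rl (e (''Y'', Bn)) a n"
        by (simp add: Mem2_def rl_def a n)
      ultimately show "ssat ?e' (Mem2 (num ''a'') (num ''n'') (bin ''Y'')) = ssat ?e' (tr \<Gamma>)"
        using H[OF sA, of n] unfolding rX by blast
    qed
  qed
qed

lemma sat_G_fm:
  assumes e: "typed_env D e"
    and G: "\<And>g a r z m. g \<in> D Pt \<Longrightarrow> a \<in> D Pt \<Longrightarrow> r \<in> D Bn \<Longrightarrow> z \<in> D Pt \<Longrightarrow> 
      ap (ap (ap (ap (e (''G'', GTy)) g) a) r) z = nb m \<longleftrightarrow> least_bound (st a) (rl r) (Gam \<Gamma> (st z)) (st g) m"
  shows "ssat e (G_fm (G_formula \<Gamma>))"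
  unfolding G_fm_def
proof (intro sat_allI, rule sat_impI, rule sat_allI, rule sat_iffI)
  fix g a r z m' assume t: "g \<in> D Pt" "a \<in> D Pt" "r \<in> D Bn" "z \<in> D Pt" "m' \<in> D N"
  let ?e = "e((''g'', Pt) := g, (''A'', Pt) := a, (''L'', Bn) := r, (''Z'', Pt) := z, (''m'', N) := m')"
  have te: "typed_env D ?e" using e t by (intro typed_env_upd)
  obtain m where m: "m' = nb m" using t by (auto simp: D_N)
  have "ssat ?e (tr (G_formula \<Gamma>)) \<longleftrightarrow> least_bound (st a) (rl r) (Gam \<Gamma> (st z)) (st g) m"
    unfolding sat_tr[OF te] arith_formula.sat_G[OF formula[OF \<Gamma>]]
    by (simp add: nenv_def senv_def renv_def m)
  then show "ssat ?e (G_app (pnt ''g'') \<^bold>= num ''m'') = ssat ?e (tr (G_formula \<Gamma>))"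
    using G[OF t(1-4)] by (simp add: G_app_def m)
qed

theorem sat_theorem:
  assumes e: "typed_env D e"
  shows "ssat e (theorem_fm \<Gamma> (G_formula \<Gamma>) (Y_formula \<Gamma>) (h_formula \<Gamma>))"
proof -
  obtain G where G: "G \<in> D GTy" "\<And>g a r z m. g \<in> D Pt \<Longrightarrow> a \<in> D Pt \<Longrightarrow> r \<in> D Bn \<Longrightarrow> z \<in> D Pt \<Longrightarrow> 
      ap (ap (ap (ap G g) a) r) z = nb m \<longleftrightarrow> least_bound (st a) (rl r) (Gam \<Gamma> (st z)) (st g) m"
    using ex_G[OF \<Gamma>] by blast
  show ?thesis
    unfolding theorem_fm_def
  proof (rule sat_exI[OF G(1)], rule sat_conjI, goal_cases)
    case 1
    show ?case using e G by (intro sat_G_fm typed_env_upd) auto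
  next
    case 2
    show ?case
    proof (intro sat_allI, rule sat_impI, intro sat_allI, rule sat_impI, goal_cases)
      case (1 a r z l gs)
      let ?e1 = "e((''G'', GTy) := G, (''A'', Pt) := a, (''L'', Bn) := r, (''Z'', Pt) := z)"
      let ?e2 = "?e1((''l'', N) := l, (''gs'', Bn) := gs)"
      have te1: "typed_env D ?e1" using e G 1 by (intro typed_env_upd)
      then have te2: "typed_env D ?e2" by (rule typed_env_upd[OF typed_env_upd]) (use 1 in auto)
      have ord: "ssat ?e1 total_ordering_fm" and cov: "ssat ?e2 covers_fm"
        using 1(4,7) by auto
      \<comment> \<open>\<open>l'\<close> may be nonstandard: the sequence is a single relation of
        the model, not a list.\<close>
      obtain l' where l': "l = nb l'" using 1 by (auto simp: D_N)
      let ?A = "st a" and ?L = "rl r" and ?Gm = "Gam \<Gamma> (st z)" and ?g = "rl gs"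
      interpret hs: hier_setting zero' suc' plus' times' df ?A ?L ?Gm ?g
        using 1 by (intro setting df_rl)
      define F where "F i = bi (ap (ap (ap (ap G (ap gs (nb i))) a) r) z)" for i
      have F: "least_bound ?A ?L ?Gm (?g i) (F i)" for i
      proof -
        have "ap gs (nb i) \<in> D Pt" using 1 by (auto intro: ap_type)
        then have "ap (ap (ap (ap G (ap gs (nb i))) a) r) z \<in> D N"
          using 1 G(1) by (auto intro!: ap_type)
        then show ?thesis
          using G(2)[OF \<open>ap gs (nb i) \<in> D Pt\<close>, of a r z "F i"] 1 by (simp add: F_def st_def rl_def)
      qed
      obtain Y where Y: "Y \<in> D Bn" "\<And>m n. ap (ap Y (nb m)) (nb n) = (if hs.YY l' m n then on else zr)"
        using comprehension2[OF hs.df_YY] by blast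
      obtain h where h: "h \<in> D Pt" "\<And>k. path_value (hs.DD l') ?L k (bi (ap h (nb k)))"
        using function_comprehension[OF df_path_value[OF hs.df_DD[of l']
              hs.dfL[OF art_var[of 1] art_var[of 0]]] path_value_unique] by blast
      have rY: "rl Y = hs.YY l'" using Y(2) succ_neq[of zr] by (auto simp: rl_def intro!: ext)
      have main: "(\<forall>a n. ?A a \<longrightarrow> hs.YY l' a n = ?Gm n (\<lambda>b m. hs.YY l' b m \<and> ?L b a))
          \<or> (\<forall>k. ?A (bi (ap h (nb k))) \<and> ?L (bi (ap h (nb (suc' k)))) (bi (ap h (nb k))))"
      proof (rule hs.hierarchy_or_descending[OF _ _ _ _ F _ h(2)])
        note o = sat_total_ordering[OF ord, simplified]
        show "?L a b \<Longrightarrow> ?A a \<and> ?A b" "\<not> ?L a a" "?L a b \<Longrightarrow> ?L b c \<Longrightarrow> ?L a c"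
          "?A a \<Longrightarrow> ?A b \<Longrightarrow> a = b \<or> ?L a b \<or> ?L b a" for a b c
          using o by blast+
        fix f assume "df (\<lambda>e. f (e 0))"
        then obtain f' where f': "f' \<in> D Pt" "\<And>n. ap f' (nb n) = (if f n then on else zr)"
          using comprehension by blast
        have sf: "st f' = f" using f'(2) succ_neq[of zr] by (auto simp: st_def intro!: ext)
        show "\<exists>i. lt i l' \<and> (\<forall>k. lt k (F i) \<longrightarrow> f k = ?g i k)"
          using sat_covers[OF te2 cov f'(1)] f'(2) by (simp add: sf l' F_def)
      qed
      let ?e3 = "?e2((''Y'', Bn) := Y, (''h'', Pt) := h)"
      have te3: "typed_env D ?e3" 
        by (rule typed_env_upd[OF typed_env_upd[OF te2 Y(1)] h(1)])
      show ?case
      proof (rule sat_exI[OF Y(1)], rule sat_exI[OF h(1)], rule sat_conjI[OF _ sat_conjI[OF _ sat_conjI]])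
        show "ssat ?e3 (is_bin ''Y'')" using Y by (intro sat_is_bin[OF Y(1)]) auto
        show "ssat ?e3 (Forall ''j'' N (Forall ''k'' N
                  (Mem2 (num ''j'') (num ''k'') (bin ''Y'') \<^bold>\<longleftrightarrow> tr (Y_formula \<Gamma>))))"
        proof (intro sat_allI, rule sat_iffI)
          fix j' k' assume jk: "j' \<in> D N" "k' \<in> D N"
          then obtain j k where jk': "j' = nb j" "k' = nb k" by (auto simp: D_N)
          let ?e4 = "?e3((''j'', N) := j', (''k'', N) := k')"
          have te4: "typed_env D ?e4" 
            by (rule typed_env_upd[OF typed_env_upd[OF te3 jk(1)] jk(2)])
          have "ssat ?e4 (tr (Y_formula \<Gamma>)) \<longleftrightarrow> hs.YY l' j k"
            unfolding sat_tr[OF te4] arith_formula.sat_Y[OF formula[OF \<Gamma>]]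
            by (simp add: nenv_def senv_def renv_def jk' l')
          then show "ssat ?e4 (Mem2 (num ''j'') (num ''k'') (bin ''Y'')) = ssat ?e4 (tr (Y_formula \<Gamma>))"
            unfolding rY[symmetric] by (simp add: Mem2_def rl_def jk')
        qed
        show "ssat ?e3 (Forall ''k'' N (Forall ''m'' N
                  (pnt ''h'' \<^bold>\<cdot> num ''k'' \<^bold>= num ''m'' \<^bold>\<longleftrightarrow> tr (h_formula \<Gamma>))))"
        proof (intro sat_allI, rule sat_iffI)
          fix k' m' assume km: "k' \<in> D N" "m' \<in> D N"
          then obtain k m where km': "k' = nb k" "m' = nb m" by (auto simp: D_N)
          let ?e4 = "?e3((''k'', N) := k', (''m'', N) := m')"
          have te4: "typed_env D ?e4" 
            by (rule typed_env_upd[OF typed_env_upd[OF te3 km(1)] km(2)])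
          have "ssat ?e4 (tr (h_formula \<Gamma>)) \<longleftrightarrow> path_value (hs.DD l') ?L k m"
            unfolding sat_tr[OF te4] arith_formula.sat_h[OF formula[OF \<Gamma>]]
            by (simp add: nenv_def senv_def renv_def km' l')
          also have "\<dots> \<longleftrightarrow> bi (ap h (nb k)) = m" using h(2) path_value_unique by metis
          also have "\<dots> \<longleftrightarrow> ap h (nb k) = nb m" using ap_type[OF h(1) nb_type] by auto
          finally show "ssat ?e4 (pnt ''h'' \<^bold>\<cdot> num ''k'' \<^bold>= num ''m'') = ssat ?e4 (tr (h_formula \<Gamma>))"
            by (simp add: km')
        qed
        have "ssat ?e3 (hierarchy_fm \<Gamma>) \<or> ssat ?e3 descending_fm"
          using main
        proof
          assume H: "\<forall>a n. ?A a \<longrightarrow> hs.YY l' a n = ?Gm n (\<lambda>b m. hs.YY l' b m \<and> ?L b a)"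
          have "ssat ?e3 (hierarchy_fm \<Gamma>)" by (rule sat_hierarchy[OF te3]) (use H in \<open>simp add: rY\<close>)
          then show ?thesis ..
        next
          assume d: "\<forall>k. ?A (bi (ap h (nb k))) \<and> ?L (bi (ap h (nb (suc' k)))) (bi (ap h (nb k)))"
          have "ssat ?e3 descending_fm" by (rule sat_descending[of _ h]) (use d h in simp_all)
          then show ?thesis ..
        qed
        then show "ssat ?e3 (hierarchy_fm \<Gamma> \<^bold>\<or> descending_fm)" by (rule sat_disjI)
      qed
    qed
  qed
qed

end

end

section \<open>Derivability\<close>

lemma tvars_tr_tm: "tvars (tr_tm t) = atvars t \<times> {N}"
  by (induction t) (auto simp: Plus_def Times_def Succ_fst_def)

lemma fvars_tr:
  "arith_in V U B p \<Longrightarrow> fvars (tr p) \<subseteq> V \<times> {N} \<union> U \<times> {Pt} \<union> B \<times> {Bn}"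
proof (induction p arbitrary: V)
  case (AAll x p)
  then have "fvars (tr p) \<subseteq> insert x V \<times> {N} \<union> U \<times> {Pt} \<union> B \<times> {Bn}" by auto
  then show ?case by auto
next
  case (AImp p q)
  then show ?case by simp
qed (auto simp: tvars_tr_tm Less_def Mem_def Mem2_def Plus_def Succ_fst_def)

section \<open>Names bound in the formulas, and closedness of the theorem\<close>

primrec abound :: "afm \<Rightarrow> string set" where
  "abound (AEq s t) = {}"
| "abound (ALess s t) = {}"
| "abound (AMem t X) = {}"
| "abound (ARel s t X) = {}"
| "abound AFls = {}"
| "abound (AImp p q) = abound p \<union> abound q"
| "abound (AAll x p) = insert x (abound p)"

lemma finite_abound: "finite (abound p)"
  by (induction p) auto

lemma bnames_tr: "bnames (tr p) \<subseteq> abound p \<union> {x. \<exists>y. x = CHR ''x'' # y}"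
  by (induction p) (auto simp: Less_def fresh_def Mem_def Mem2_def)

lemma abound_plug:
  assumes "\<And>s t. abound (\<Phi> s t) = {}" shows "abound (plug \<Phi> p) \<subseteq> {x. is_v x}"
  using assms by (induction p) auto

lemma abound_connectives [simp]:
  "abound (ANot p) = abound p" "abound (AAnd p q) = abound p \<union> abound q"
  "abound (AOr p q) = abound p \<union> abound q" "abound (AIff p q) = abound p \<union> abound q"
  "abound (AEx x p) = insert x (abound p)"
  by (auto simp: connective_defs)

lemma abound_bad:
  assumes "\<And>t. abound (M t) = {}" shows "x \<in> abound (bad_fm \<Gamma> M a) \<Longrightarrow> is_v x"
    "x \<in> abound (in_hat \<Gamma> M a) \<Longrightarrow> is_v x"
  using assms abound_plug[of "\<lambda>s t. AAnd (M (apair s t)) (ARel s (AVar a) ''L'')" \<Gamma>]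
  by (auto simp: bad_fm_def differs_def in_hat_def)


lemma abound_G: "x \<in> abound (G_formula \<Gamma>) \<Longrightarrow> is_v x \<or> x \<in> {''a'', ''c'', ''k'', ''s''}"
  using abound_bad[of "\<lambda>t. AMem t ''g''" x \<Gamma>]
  by (auto simp: G_formula_def Let_def start_fm_def bound_fm_def minimal_bad_fm_def differs_def)

lemma abound_row [simp]: "abound (row i t) = {}"
  by (simp add: row_def)

lemma abound_bad_row: "x \<in> abound (bad_fm \<Gamma> (row i) a) \<Longrightarrow> is_v x"
  "x \<in> abound (in_hat \<Gamma> (row i) a) \<Longrightarrow> is_v x"
  by (rule abound_bad; simp add: row_def)+

lemma abound_Y: "x \<in> abound (Y_formula \<Gamma>) \<Longrightarrow> is_v x \<or> x \<in> {''c'', ''i''}"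
  by (auto simp: Y_formula_def dest: abound_bad_row)

lemma abound_bottomless:
  "y \<in> abound (bottomless_fm \<Gamma> x) \<Longrightarrow> is_v y \<or> y \<in> {''c'', ''i'', ''j'', ''n'', ''y'', ''z''}"
  unfolding bottomless_fm_def
  by simp (blast dest: abound_bad_row)

lemma abound_path:
  "y \<in> abound (path_fm (bottomless_fm \<Gamma>) k m) \<Longrightarrow> is_v y \<or> (\<exists>c z. y = c # z \<and> c \<noteq> CHR ''%'')"
  unfolding path_fm_def path_code_fm_def mem_fm_def next_fm_def start_fm_def
  by simp (fastforce dest: abound_bottomless)

lemma abound_h:
  "y \<in> abound (h_formula \<Gamma>) \<Longrightarrow> is_v y \<or> (\<exists>c z. y = c # z \<and> c \<noteq> CHR ''%'')"
  unfolding h_formula_def Let_def by simp (fastforce dest: abound_path)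

lemma Less_props [simp]:
  "fvars (s \<^bold>< t) = (tvars s \<union> tvars t) - {(fresh s t, N)}" "bnames (s \<^bold>< t) = {fresh s t}"
  "wf_fm (s \<^bold>< t) \<longleftrightarrow> has_ty s N \<and> has_ty t N"
  by (auto simp: Less_def Plus_def Succ_fst_def)

lemma basic_fvars [simp]:
  "fvars (is_pnt X) = {(X, Pt)}" "fvars (is_bin X) = {(X, Bn)}"
  "fvars (s \<^bold>\<in> t) = tvars s \<union> tvars t" "fvars (Mem2 s t u) = tvars s \<union> tvars t \<union> tvars u"
  "tvars (G_app g) = tvars g \<union> {(''G'', GTy), (''A'', Pt), (''L'', Bn), (''Z'', Pt)}"
  by (auto simp: is_pnt_def is_bin_def Mem_def Mem2_def G_app_def)

lemma basic_wf [simp]: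
  "wf_fm (is_pnt X)" "wf_fm (is_bin X)" "wf_fm (s \<^bold>\<in> pnt X) \<longleftrightarrow> has_ty s N"
  "wf_fm (Mem2 s t (bin X)) \<longleftrightarrow> has_ty s N \<and> has_ty t N"
  "has_ty (G_app g) \<tau> \<longleftrightarrow> \<tau> = N \<and> has_ty g Pt"
  by (auto simp: is_pnt_def is_bin_def Mem_def Mem2_def G_app_def)

lemma basic_bnames [simp]:
  "bnames (is_pnt X) = {''k''}" "bnames (is_bin X) = {''j'', ''k''}"
  "bnames (s \<^bold>\<in> t) = {}" "bnames (Mem2 s t u) = {}"
  by (auto simp: is_pnt_def is_bin_def Mem_def Mem2_def)

lemma fvars_subset_simps:
  "fvars (s \<^bold>= t) \<subseteq> S \<longleftrightarrow> tvars s \<subseteq> S \<and> tvars t \<subseteq> S" "fvars Fls \<subseteq> S"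
  "fvars (p \<^bold>\<longrightarrow> q) \<subseteq> S \<longleftrightarrow> fvars p \<subseteq> S \<and> fvars q \<subseteq> S"
  "fvars (Forall x \<rho> p) \<subseteq> S \<longleftrightarrow> fvars p \<subseteq> insert (x, \<rho>) S"
  by auto

lemma fvars_subset_leaf:
  "tvars s \<subseteq> S \<Longrightarrow> tvars t \<subseteq> S \<Longrightarrow> fvars (s \<^bold>< t) \<subseteq> S"
  "(X, Pt) \<in> S \<Longrightarrow> fvars (is_pnt X) \<subseteq> S" "(X, Bn) \<in> S \<Longrightarrow> fvars (is_bin X) \<subseteq> S"
  "tvars s \<subseteq> S \<Longrightarrow> tvars t \<subseteq> S \<Longrightarrow> fvars (s \<^bold>\<in> t) \<subseteq> S"
  "tvars s \<subseteq> S \<Longrightarrow> tvars t \<subseteq> S \<Longrightarrow> tvars u \<subseteq> S \<Longrightarrow> fvars (Mem2 s t u) \<subseteq> S"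
  by auto

text \<open>Closedness is proved as inclusion in an arbitrary set \<open>S\<close>. The inclusion
  passes to subformulas while \<open>S\<close> grows by the bound variables, so no set differences
  have to be computed.\<close>

lemma fvars_theorem:
  assumes \<Gamma>: "arith_in {''n''} {''Z''} {''X''} \<Gamma>"
  shows "fvars (theorem_fm \<Gamma> (G_formula \<Gamma>) (Y_formula \<Gamma>) (h_formula \<Gamma>)) = {}"
proof -
  note tr = subset_trans[OF fvars_tr[OF \<Gamma>]] subset_trans[OF fvars_tr[OF arith_in_G[OF \<Gamma>]]]
    subset_trans[OF fvars_tr[OF arith_in_Y[OF \<Gamma>]]] subset_trans[OF fvars_tr[OF arith_in_h[OF \<Gamma>]]]
  have "fvars (theorem_fm \<Gamma> (G_formula \<Gamma>) (Y_formula \<Gamma>) (h_formula \<Gamma>)) \<subseteq> S" for S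
    unfolding theorem_fm_def G_fm_def total_ordering_fm_def is_seq_fm_def covers_fm_def
      hierarchy_fm_def descending_fm_def
    by (simp add: fvars_subset_simps fvars_subset_leaf tr del: fvars.simps basic_fvars(1-4) Less_props)
  then show ?thesis by blast
qed

lemma wf_theorem: "wf_fm (theorem_fm \<Gamma> \<gamma> \<upsilon> \<eta>)"
  by (simp add: wf_tr theorem_fm_def G_fm_def total_ordering_fm_def is_seq_fm_def covers_fm_def
      hierarchy_fm_def descending_fm_def)

lemma bnames_theorem:
  "x \<in> bnames (theorem_fm \<Gamma> \<gamma> \<upsilon> \<eta>) \<Longrightarrow> x \<in> bnames (tr \<gamma>) \<union> bnames (tr \<upsilon>) \<union> bnames (tr \<eta>) \<union> bnames (tr \<Gamma>)
    \<or> (\<exists>c z. x = c # z \<and> c \<noteq> CHR ''%'')"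
  unfolding theorem_fm_def G_fm_def total_ordering_fm_def is_seq_fm_def covers_fm_def
    hierarchy_fm_def descending_fm_def
  by (simp add: fresh_def) (elim disjE; simp)

lemma (in henkin_names) plain_theorem:
  assumes \<Gamma>: "arith_in {''n''} {''Z''} {''X''} \<Gamma>" and b: "\<forall>x\<in>abound \<Gamma>. \<not> henkin x"
  shows "plain (theorem_fm \<Gamma> (G_formula \<Gamma>) (Y_formula \<Gamma>) (h_formula \<Gamma>))"
proof -
  have v: "\<not> henkin x" if "is_v x" for x using that by (auto simp: is_v_def vname_def)
  have "\<not> henkin x" if "x \<in> abound (G_formula \<Gamma>) \<union> abound (Y_formula \<Gamma>) \<union> abound (h_formula \<Gamma>) \<union> abound \<Gamma>" for x
    using that abound_G[of x \<Gamma>] abound_Y[of x \<Gamma>] abound_h[of x \<Gamma>] b v by auto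
  then have "\<not> henkin x" if "x \<in> bnames (tr (G_formula \<Gamma>)) \<union> bnames (tr (Y_formula \<Gamma>)) \<union>
      bnames (tr (h_formula \<Gamma>)) \<union> bnames (tr \<Gamma>)" for x
    using that bnames_tr[of "G_formula \<Gamma>"] bnames_tr[of "Y_formula \<Gamma>"] bnames_tr[of "h_formula \<Gamma>"]
      bnames_tr[of \<Gamma>] by fastforce
  then have "\<not> henkin x" if "x \<in> bnames (theorem_fm \<Gamma> (G_formula \<Gamma>) (Y_formula \<Gamma>) (h_formula \<Gamma>))" for x
    using bnames_theorem[OF that] by auto
  then show ?thesis using fvars_theorem[OF \<Gamma>] wf_theorem by (simp add: plain_def)
qed

lemma derivable_theorem:
  assumes \<Gamma>: "arith_in {''n''} {''Z''} {''X''} \<Gamma>"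
  shows "ACA0_omega \<^bold>\<turnstile> theorem_fm \<Gamma> (G_formula \<Gamma>) (Y_formula \<Gamma>) (h_formula \<Gamma>)"
proof -
  \<comment> \<open>\<open>\<Gamma>\<close> may bind arbitrary names, so Henkin names are made
    longer than all of them. They also begin with a character that starts no name bound by the
    remaining formulas.\<close>
  define K where "K = Max (insert 0 (length ` abound \<Gamma>))"
  have K: "length x \<le> K" if "x \<in> abound \<Gamma>" for x
    using that finite_abound[of \<Gamma>] by (simp add: K_def)
  define henkin where "henkin x \<longleftrightarrow> (\<exists>n>K. x = replicate n (CHR ''%''))" for x
  interpret henkin_names henkin
  proof
    have "inj (\<lambda>n. replicate (Suc K + n) (CHR ''%''))"
      by (rule injI) (metis add_left_imp_eq length_replicate)
    then have "infinite (range (\<lambda>n. replicate (Suc K + n) (CHR ''%'')))" by (rule range_inj_infinite)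
    moreover have "range (\<lambda>n. replicate (Suc K + n) (CHR ''%'')) \<subseteq> {x. henkin x}"
    proof
      fix x assume "x \<in> range (\<lambda>n. replicate (Suc K + n) (CHR ''%''))"
      then obtain n where "x = replicate (Suc K + n) (CHR ''%'')" by blast
      then show "x \<in> {x. henkin x}" unfolding henkin_def mem_Collect_eq by (intro exI[of _ "Suc K + n"]) simp
    qed
    ultimately show "infinite {x. henkin x}" by (meson finite_subset)
    show "\<exists>y. x = CHR ''%'' # y" if "henkin x" for x
      using that unfolding henkin_def by (metis gr_implies_not0 not0_implies_Suc replicate_Suc)
  qed
  have "\<not> henkin x" if "x \<in> abound \<Gamma>" for x
    using K[OF that] by (auto simp: henkin_def)
  then have plain: "plain (theorem_fm \<Gamma> (G_formula \<Gamma>) (Y_formula \<Gamma>) (h_formula \<Gamma>))"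
    using plain_theorem[OF \<Gamma>] by blast
  show ?thesis
  proof (rule completeness[OF _ plain fvars_theorem[OF \<Gamma>]])
    show "E_PRA \<subseteq> ACA0_omega" by (auto simp: ACA0_omega_def RCA0_omega_def)
    fix D :: "ty \<Rightarrow> tm set" and ap ct
    assume "applicative D ap ct" "\<And>\<rho>. D \<rho> \<noteq> {}"
      "\<And>f g \<sigma> \<tau>. f \<in> D (\<sigma> \<^bold>\<rightarrow> \<tau>) \<Longrightarrow> g \<in> D (\<sigma> \<^bold>\<rightarrow> \<tau>) \<Longrightarrow>
        (\<And>a. a \<in> D \<sigma> \<Longrightarrow> ap f a = ap g a) \<Longrightarrow> f = g"
      "\<And>p e. p \<in> ACA0_omega \<Longrightarrow> plain p \<Longrightarrow> typed_env D e \<Longrightarrow> sat D ap ct (=) e p"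
    then interpret fin_model D ap ct by (rule model_of_ACA0_omega)
    have "bij_betw (from_nat_into (D N)) UNIV (D N)"
      using infinite_num by (intro bij_betw_from_nat_into) auto
    then interpret coded_model D ap ct "from_nat_into (D N)" by unfold_locales
    show "\<exists>e. typed_env D e \<and> ssat e (theorem_fm \<Gamma> (G_formula \<Gamma>) (Y_formula \<Gamma>) (h_formula \<Gamma>))"
      using ex_env sat_theorem[OF \<Gamma>] by blast
  qed
qed

theorem theorem3p13:
  fixes \<Gamma> :: afm
  assumes "arith_in {''n''} {''Z''} {''X''} \<Gamma>"
  shows "\<exists>\<gamma> G. defines_G \<gamma> G \<and>
    (\<exists>\<upsilon> \<eta> Yc hc. defines_Y \<upsilon> Yc \<and> defines_h \<eta> hc \<and>
      (\<forall>A L Z. total_ordering A L \<longrightarrow>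
        (let F = (\<lambda>g. G g A L Z) in
          (\<forall>gs. (UNIV :: cantor set) \<subseteq> (\<Union>g\<in>set gs. cylinder (initial g (F g))) \<longrightarrow>
            hierarchy \<Gamma> A L (Yc Z A L gs) Z \<or> descending_in A L (hc Z A L gs)))) \<and>
      (ACA0_omega \<^bold>\<turnstile> theorem_fm \<Gamma> \<gamma> \<upsilon> \<eta>))"
  unfolding Let_def
  using defines_std_G[OF assms] defines_std_Y[OF assms] defines_std_h[OF assms]
    std_hierarchy_or_descending derivable_theorem[OF assms]
  by blast

end
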